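(* Let $\alpha_1,\alpha_2,\gamma_1,\gamma_2,\Gamma$ be real constants with $\Gamma>0$, $\alpha_1\neq 0$ and $\frac{2\alpha_2}{3\alpha_1}\notin\mathbf{Z}$, and consider the equation $$\partial_t u=\alpha_1\partial_x^3u+i\alpha_2\partial_x^2u+i\gamma_1|u|^2u+\gamma_2\partial_x(|u|^2u)-i\Gamma u\,\partial_x(|u|^2),\quad x\in\mathbf{T}.\qquad (E)$$ Let $s\ge1$, $T>0$, and let $u^*\in C([0,T];H^s(\mathbf{T}))$ be a solution to (E) on $[0,T]$. Then for any $\varepsilon>0$ and any $0<\tau\le T$ there exists a real analytic function $\phi$ on $\mathbf{T}$ with $\|\phi\|_{H^s}\le\varepsilon$ such that either there does not exist a solution $u$ to (E) on $[0,\tau]$ in the class $C([0,\tau];H^s(\mathbf{T}))$ with the initial condition $u(0)=u^*(0)+\phi$, or such a solution exists but $$\sup_{t\in[0,\tau]}\|u(t)-u^*(t)\|_{H^s}\ge\varepsilon^{-1}$$ (for any such solution $u$).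
   Context: Notation: $\mathbf{T}=\mathbf{R}/2\pi\mathbf{Z}$; functions are complex-valued; $\hat f(k)=\frac1{\sqrt{2\pi}}\int_{\mathbf{T}}e^{-ikx}f(x)\,dx$ for $k\in\mathbf{Z}$; $\langle\xi\rangle=1+|\xi|$; $\|f\|_{H^s}=\|\langle k\rangle^s\hat f(k)\|_{\ell^2(\mathbf{Z})}$. Notion of solution: Let $T>0$, $s\ge0$, $u_0\in H^s(\mathbf{T})$. A function $u$ is a solution of (E) with $u(0)=u_0$ on $[0,T)$ if $u\in L^\infty_{loc}([0,T);H^s(\mathbf{T}))\cap L^3_{loc}([0,T)\times\mathbf{T})$, $\partial_x(|u|^2)\in L^1_{loc}([0,T);H^{-s}(\mathbf{T}))$, and for every $\phi\in C_0^\infty([0,T)\times\mathbf{T})$, $$-\int_0^T\!\!\int_{\mathbf{T}}u\,\partial_t\phi\,dx\,dt-\int_{\mathbf{T}}u_0\phi(0,\cdot)\,dx=\int_0^T\!\!\int_{\mathbf{T}}\big[u(-\alpha_1\partial_x^3\phi+i\alpha_2\partial_x^2\phi)+|u|^2u(i\gamma_1\phi-\gamma_2\partial_x\phi)\big]dx\,dt-i\Gamma\int_0^T\langle\partial_x(|u|^2)(t),u(t)\phi(t)\rangle_{H^{-s},H^s}\,dt .$$ A function $u$ is a solution on the closed interval $[0,T]$ if $u\in C([0,T];H^{s}(\mathbf{T}))$ for some $s>1/2$ and $u|_{[0,T)}$ is a solution on $[0,T)$, that is, $u|_{[0,T)}\in L^\infty_{loc}([0,T);H^s(\mathbf{T}))\cap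 L^3_{loc}([0,T)\times\mathbf{T})$, $\partial_x(|u|^2)\in L^1_{loc}([0,T);H^{-s}(\mathbf{T}))$, and the displayed integral identity holds for every $\phi\in C_0^\infty([0,T)\times\mathbf{T})$. *)

theory Defs
  imports "HOL-Analysis.Analysis"
begin

text \<open>
  Functions on \<open>\<^bold>T = \<^bold>R/2\<pi>\<^bold>Z\<close> are \<open>2\<pi>\<close>-periodic functions on the reals; integrals
  over \<open>\<^bold>T\<close> are integrals over the period \<open>[0, 2\<pi>]\<close>. Elements of \<open>H\<^sup>s(\<^bold>T)\<close>, \<open>s \<ge> 0\<close>, are
  represented by functions, equality being equality almost everywhere.
  A periodic distribution (needed for \<open>H\<^sup>-\<^sup>s\<close>) is represented by its sequence of Fourier
  coefficients, so that \<open>H\<^sup>\<sigma>\<close> is, for every real \<open>\<sigma>\<close>, a weighted \<open>\<ell>\<^sup>2\<close>-space.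
\<close>

abbreviation torus :: "real measure" where
  "torus \<equiv> lebesgue_on {0..2*pi}"

definition periodic :: "(real \<Rightarrow> complex) \<Rightarrow> bool" where
  "periodic f \<longleftrightarrow> (\<forall>x. f (x + 2*pi) = f x)"

definition fourier :: "(real \<Rightarrow> complex) \<Rightarrow> int \<Rightarrow> complex" where
  "fourier f k =
     1 / complex_of_real (sqrt (2*pi)) * (LINT x|torus. exp (- \<i> * of_int k * of_real x) * f x)"

definition bracket :: "real \<Rightarrow> real" where
  "bracket \<xi> = 1 + \<bar>\<xi>\<bar>"

definition sobolev_seq :: "real \<Rightarrow> (int \<Rightarrow> complex) set" where
  "sobolev_seq \<sigma> = {a. (\<lambda>k. (bracket (of_int k) powr \<sigma> * cmod (a k))\<^sup>2) summable_on UNIV}"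

definition sobolev_seq_norm :: "real \<Rightarrow> (int \<Rightarrow> complex) \<Rightarrow> real" where
  "sobolev_seq_norm \<sigma> a = sqrt (\<Sum>\<^sub>\<infinity>k. (bracket (of_int k) powr \<sigma> * cmod (a k))\<^sup>2)"

text \<open>
  For \<open>s \<ge> 0\<close> only: every element of \<open>H\<^sup>s\<close> is then a (square-)integrable function. The value of
  the norm is meaningful only on \<open>H\<^sup>s\<close>, because a divergent \<open>infsum\<close> is \<open>0\<close>.
\<close>

definition sobolev :: "real \<Rightarrow> (real \<Rightarrow> complex) set" where
  "sobolev s = {f. periodic f \<and> integrable torus f \<and> fourier f \<in> sobolev_seq s}"

definition sobolev_norm :: "real \<Rightarrow> (real \<Rightarrow> complex) \<Rightarrow> real" where
  "sobolev_norm s f = sobolev_seq_norm s (fourier f)"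

text \<open>
  The bilinear (not sesquilinear) duality of \<open>H\<^sup>-\<^sup>s\<close> and \<open>H\<^sup>s\<close> extending \<open>\<integral> f g dx\<close>, in terms of
  Fourier coefficients; no constant appears since \<open>f = (2\<pi>)\<^sup>-\<^sup>1\<^sup>/\<^sup>2 \<Sum> fourier f k e\<^sup>i\<^sup>k\<^sup>x\<close>.
\<close>

definition pairing :: "(int \<Rightarrow> complex) \<Rightarrow> (int \<Rightarrow> complex) \<Rightarrow> complex" where
  "pairing a b = (\<Sum>\<^sub>\<infinity>k. a k * b (- k))"

definition real_analytic :: "(real \<Rightarrow> complex) \<Rightarrow> bool" where
  "real_analytic f \<longleftrightarrow>
     (\<forall>x\<^sub>0. \<exists>r>0. \<exists>a :: nat \<Rightarrow> complex. \<forall>x. \<bar>x - x\<^sub>0\<bar> < r \<longrightarrow>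
        (\<lambda>n. a n * of_real (x - x\<^sub>0) ^ n) sums f x)"

text \<open>
  Functions of time and space are written \<open>u t x\<close>. In the spaces
  \<open>L\<^sup>p\<^sub>l\<^sub>o\<^sub>c([0,T); H\<^sup>\<sigma>)\<close> strong measurability is expressed by measurability of all Fourier
  coefficients, which is the same since \<open>H\<^sup>\<sigma>\<close> is a separable Hilbert space (Pettis).
\<close>

definition continuous_in_sobolev :: "real \<Rightarrow> real \<Rightarrow> (real \<Rightarrow> real \<Rightarrow> complex) \<Rightarrow> bool" where
  "continuous_in_sobolev s T u \<longleftrightarrow>
     (\<forall>t\<in>{0..T}. u t \<in> sobolev s) \<and>
     (\<forall>t\<^sub>0\<in>{0..T}. ((\<lambda>t. sobolev_norm s (\<lambda>x. u t x - u t\<^sub>0 x)) \<longlongrightarrow> 0) (at t\<^sub>0 within {0..T}))"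

definition Linfty_loc_sobolev :: "real \<Rightarrow> real \<Rightarrow> (real \<Rightarrow> real \<Rightarrow> complex) \<Rightarrow> bool" where
  "Linfty_loc_sobolev s T u \<longleftrightarrow>
     (\<forall>T'\<in>{0<..<T}.
        (\<forall>k. (\<lambda>t. fourier (u t) k) \<in> borel_measurable (lebesgue_on {0..T'})) \<and>
        (\<exists>C. AE t in lebesgue_on {0..T'}. u t \<in> sobolev s \<and> sobolev_norm s (u t) \<le> C))"

definition L1_loc_sobolev_seq :: "real \<Rightarrow> real \<Rightarrow> (real \<Rightarrow> int \<Rightarrow> complex) \<Rightarrow> bool" where
  "L1_loc_sobolev_seq \<sigma> T g \<longleftrightarrow>
     (\<forall>T'\<in>{0<..<T}.
        (\<forall>k. (\<lambda>t. g t k) \<in> borel_measurable (lebesgue_on {0..T'})) \<and>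
        (AE t in lebesgue_on {0..T'}. g t \<in> sobolev_seq \<sigma>) \<and>
        integrable (lebesgue_on {0..T'}) (\<lambda>t. sobolev_seq_norm \<sigma> (g t)))"

definition L3_loc :: "real \<Rightarrow> (real \<Rightarrow> real \<Rightarrow> complex) \<Rightarrow> bool" where
  "L3_loc T u \<longleftrightarrow>
     (\<forall>T'\<in>{0<..<T}.
        (\<lambda>(t, x). u t x) \<in> borel_measurable (lebesgue_on ({0..T'} \<times> {0..2*pi})) \<and>
        integrable (lebesgue_on ({0..T'} \<times> {0..2*pi})) (\<lambda>(t, x). cmod (u t x) ^ 3))"

text \<open>Fourier coefficients of the distribution \<open>\<partial>\<^sub>x(|f|\<^sup>2)\<close>.\<close>

definition dx_abs_sq :: "(real \<Rightarrow> complex) \<Rightarrow> int \<Rightarrow> complex" where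
  "dx_abs_sq f k = \<i> * of_int k * fourier (\<lambda>x. of_real ((cmod (f x))\<^sup>2)) k"

text \<open>
  Test functions in \<open>C\<^sub>0\<^sup>\<infinity>([0,T) \<times> \<^bold>T)\<close>, extended by zero to \<open>[0,\<infinity>) \<times> \<^bold>T\<close>. They need not vanish
  at \<open>t = 0\<close>, where time derivatives are one-sided. Values at negative times are irrelevant.
\<close>

definition dt :: "(real \<Rightarrow> real \<Rightarrow> complex) \<Rightarrow> real \<Rightarrow> real \<Rightarrow> complex" where
  "dt \<phi> t x = vector_derivative (\<lambda>t'. \<phi> t' x) (at t within {0..})"

definition dx :: "(real \<Rightarrow> real \<Rightarrow> complex) \<Rightarrow> real \<Rightarrow> real \<Rightarrow> complex" where
  "dx \<phi> t x = vector_derivative (\<phi> t) (at x)"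

primrec Ck :: "nat \<Rightarrow> (real \<Rightarrow> real \<Rightarrow> complex) \<Rightarrow> bool" where
  "Ck 0 \<phi> \<longleftrightarrow> continuous_on ({0..} \<times> UNIV) (\<lambda>(t, x). \<phi> t x)"
| "Ck (Suc n) \<phi> \<longleftrightarrow>
     (\<forall>t\<ge>0. \<forall>x. (\<lambda>t'. \<phi> t' x) differentiable (at t within {0..}) \<and> \<phi> t differentiable (at x)) \<and>
     Ck n (dt \<phi>) \<and> Ck n (dx \<phi>)"

definition test_function :: "real \<Rightarrow> (real \<Rightarrow> real \<Rightarrow> complex) \<Rightarrow> bool" where
  "test_function T \<phi> \<longleftrightarrow>
     (\<forall>n. Ck n \<phi>) \<and> (\<forall>t\<ge>0. periodic (\<phi> t)) \<and> (\<exists>T'<T. \<forall>t\<ge>T'. \<forall>x. \<phi> t x = 0)"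

text \<open>
  Solutions of
  \<open>\<partial>\<^sub>t u = \<alpha>\<^sub>1 \<partial>\<^sub>x\<^sup>3 u + i \<alpha>\<^sub>2 \<partial>\<^sub>x\<^sup>2 u + i \<gamma>\<^sub>1 |u|\<^sup>2 u + \<gamma>\<^sub>2 \<partial>\<^sub>x(|u|\<^sup>2 u) - i \<Gamma> u \<partial>\<^sub>x(|u|\<^sup>2)\<close>
  on \<open>[0,T)\<close> with initial value \<open>u\<^sub>0\<close>.
\<close>

definition solution_on_halfopen ::
  "real \<Rightarrow> real \<Rightarrow> real \<Rightarrow> real \<Rightarrow> real \<Rightarrow> real \<Rightarrow> real \<Rightarrow> (real \<Rightarrow> complex) \<Rightarrow>
   (real \<Rightarrow> real \<Rightarrow> complex) \<Rightarrow> bool" where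
  "solution_on_halfopen \<alpha>\<^sub>1 \<alpha>\<^sub>2 \<gamma>\<^sub>1 \<gamma>\<^sub>2 \<Gamma> s T u\<^sub>0 u \<longleftrightarrow>
     0 < T \<and> 0 \<le> s \<and> u\<^sub>0 \<in> sobolev s \<and>
     Linfty_loc_sobolev s T u \<and> L3_loc T u \<and>
     L1_loc_sobolev_seq (- s) T (\<lambda>t. dx_abs_sq (u t)) \<and>
     (\<forall>\<phi>. test_function T \<phi> \<longrightarrow>
        - (LINT t|lebesgue_on {0..<T}. LINT x|torus. u t x * dt \<phi> t x)
        - (LINT x|torus. u\<^sub>0 x * \<phi> 0 x)
        = (LINT t|lebesgue_on {0..<T}. LINT x|torus.
             u t x * (- of_real \<alpha>\<^sub>1 * dx (dx (dx \<phi>)) t x + \<i> * of_real \<alpha>\<^sub>2 * dx (dx \<phi>) t x)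
             + of_real ((cmod (u t x))\<^sup>2) * u t x *
               (\<i> * of_real \<gamma>\<^sub>1 * \<phi> t x - of_real \<gamma>\<^sub>2 * dx \<phi> t x))
          - \<i> * of_real \<Gamma> *
            (LINT t|lebesgue_on {0..<T}.
               pairing (dx_abs_sq (u t)) (fourier (\<lambda>x. u t x * \<phi> t x))))"

definition solution_on_closed ::
  "real \<Rightarrow> real \<Rightarrow> real \<Rightarrow> real \<Rightarrow> real \<Rightarrow> real \<Rightarrow> (real \<Rightarrow> real \<Rightarrow> complex) \<Rightarrow> bool" where
  "solution_on_closed \<alpha>\<^sub>1 \<alpha>\<^sub>2 \<gamma>\<^sub>1 \<gamma>\<^sub>2 \<Gamma> T u \<longleftrightarrow>
     (\<exists>s>1/2. continuous_in_sobolev s T u \<and>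
              solution_on_halfopen \<alpha>\<^sub>1 \<alpha>\<^sub>2 \<gamma>\<^sub>1 \<gamma>\<^sub>2 \<Gamma> s T (u 0) u)"

end

theory Submission imports Defs "HOL-Real_Asymp.Real_Asymp" begin

text \<open>
  Write \<open>a\<^sub>k(t)\<close> for the Fourier coefficients of a solution. Then
  \<open>a\<^sub>k' = - i(\<alpha>\<^sub>1 k\<^sup>3 + \<alpha>\<^sub>2 k\<^sup>2) a\<^sub>k + N\<^sub>k\<close> with a cubic convolution \<open>N\<^sub>k\<close>, whose resonant part is a multiple
  \<open>\<nu>\<^sub>k a\<^sub>k\<close> of \<open>a\<^sub>k\<close>. The Raman term makes \<open>Re \<nu>\<^sub>k = \<Gamma>/2\<pi> \<Sum>\<^sub>j (k - j) |a\<^sub>j|\<^sup>2\<close>, which is at least \<open>\<rho> k\<close> for large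
  \<open>k\<close> as long as \<open>a\<^sub>0\<close> stays away from \<open>0\<close>. Solving for \<open>a\<^sub>k(0)\<close> backwards in time therefore expresses it by
  an exponentially small term and a time integral of the nonresonant part, damped by \<open>exp (- \<rho> k t)\<close>. The damping
  gains a factor \<open>1/k\<close>, which only compensates the derivative in the nonlinearity. Since
  \<open>2\<alpha>\<^sub>2/(3\<alpha>\<^sub>1)\<close> is not an integer, the phase
  \<open>3\<alpha>\<^sub>1 (k - k\<^sub>1)(k - k\<^sub>3)(k\<^sub>1 + k\<^sub>3 + 2\<alpha>\<^sub>2/(3\<alpha>\<^sub>1))\<close> is bounded below off the resonances, and an integration by
  parts in time gains a further \<open>k\<^sup>-\<^sup>1\<^sup>/\<^sup>4\<close>. Consequently all solutions bounded by \<open>R\<close> in \<open>H\<^sup>s\<close> satisfy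
  \<open>\<langle>k\<rangle>\<^sup>s |a\<^sub>k(0)| \<le> \<delta>\<^sub>k\<close> with a common null sequence \<open>\<delta>\<close>. If the theorem failed, the initial values
  \<open>u\<^sup>*(0) + c + b \<langle>N\<rangle>\<^sup>-\<^sup>s e\<^sup>i\<^sup>N\<^sup>x\<close> with fixed small \<open>c, b\<close> would for all \<open>N\<close> belong to solutions with a common
  bound, which contradicts this decay at \<open>k = N\<close>. The constant \<open>c\<close> serves to keep \<open>a\<^sub>0\<close> away from \<open>0\<close>.
\<close>

section \<open>Convolution sums over the integers\<close>

text \<open>The growth has a definite sign because the Raman symbol
  \<open>- i \<Gamma> * i m = \<Gamma> m\<close> is real, whereas the symbol of the other two cubic
  terms is purely imaginary and only turns phases.

  The obstacle is that the nonlinearity maps \<open>H^s\<close> only into \<open>H^(s-1)\<close>,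
  and integration by parts puts such a rough factor into one of three slots. The divided symbol
  therefore has to yield \<open>k^(-1/4)\<close> at the cost of at most one derivative on a second
  factor and a quarter derivative on the third. The quarter is what \<open>s >= 1\<close> affords:
  the third factor must be absolutely summable, and \<open><k>^(1/4) a_k\<close> is, since
  \<open>2 * (1 - 1/4) = 3/2 > 1\<close>.

  The boundary terms of the integration by parts are not helped by the damping. They recover their
  factor \<open>1/k\<close> by charging \<open>k <= <i> + <j> + <l>\<close> to one of the three
  factors, which makes that factor rough as well and leads to the same sums.

  The contradiction needs uniformity: the time \<open>t0\<close>, the growth rate and
  \<open>\<delta>\<close> may depend on \<open>R\<close>, \<open>\<tau>\<close> and a lower bound
  for the initial mode 0, but not on the solution.\<close>

abbreviation nsum :: "('a \<Rightarrow> ennreal) \<Rightarrow> ennreal" where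
  "nsum f \<equiv> \<integral>\<^sup>+k. f k \<partial>count_space UNIV"

lemma nsum_swap:
  fixes f :: "'a::countable \<Rightarrow> 'b::countable \<Rightarrow> ennreal"
  shows "nsum (\<lambda>x. nsum (f x)) = nsum (\<lambda>y. nsum (\<lambda>x. f x y))"
  by (rule nn_integral_count_space_nn_integral) auto

lemma nsum_cmult: "nsum (\<lambda>x. c * f x) = c * nsum f"
  by (rule nn_integral_cmult) auto

lemma nsum_multc: "nsum (\<lambda>x. f x * c) = nsum f * c"
  by (rule nn_integral_multc) auto

lemma nsum_add: "nsum (\<lambda>x. f x + g x) = nsum f + nsum g"
  by (rule nn_integral_add) auto

lemma nsum_mono: "(\<And>x. f x \<le> g x) \<Longrightarrow> nsum f \<le> nsum g"
  by (rule nn_integral_mono) auto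

lemma nsum_reindex:
  assumes "bij g" shows "nsum (\<lambda>x. f (g x)) = nsum f"
  using nn_integral_bij_count_space[of g UNIV UNIV f] assms by simp

lemma nsum_shift: "nsum (\<lambda>k::int. f (k + j)) = nsum f"
  by (rule nsum_reindex) (simp add: bij_plus_right)

lemma nsum_reflect: "nsum (\<lambda>k::int. f (j - k)) = nsum f"
  by (rule nsum_reindex) (rule involuntory_imp_bij, simp)

lemma nsum_uminus: "nsum (\<lambda>k::int. f (- k)) = nsum f"
  using nsum_reflect[of f 0] by simp

lemma nsum_CS:
  "(nsum (\<lambda>k. f k * g k))\<^sup>2 \<le> nsum (\<lambda>k. (f k)\<^sup>2) * nsum (\<lambda>k. (g k)\<^sup>2)"
  by (rule Cauchy_Schwarz_nn_integral) auto

lemma ennreal_le_of_square: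
  fixes x :: ennreal
  assumes "x\<^sup>2 \<le> ennreal (c\<^sup>2)" "c \<ge> 0"
  shows "x \<le> ennreal c"
proof (cases x)
  case (real r)
  then have "r\<^sup>2 \<le> c\<^sup>2" using assms by (simp add: ennreal_power)
  then have "r \<le> c" using assms(2) power2_le_imp_le by blast
  then show ?thesis using real by (simp add: ennreal_leI)
next
  case top
  then show ?thesis using assms by (simp add: power2_eq_square ennreal_top_mult top_unique)
qed

text \<open>With values in \<open>ennreal\<close> every rearrangement is free of summability
  conditions; complex sums are compared with these majorants.\<close>

definition conv3 ::
  "(int \<Rightarrow> ennreal) \<Rightarrow> (int \<Rightarrow> ennreal) \<Rightarrow> (int \<Rightarrow> ennreal) \<Rightarrow> int \<Rightarrow> ennreal" where
  "conv3 f g h k = nsum (\<lambda>i. nsum (\<lambda>j. f i * g j * h (k - i - j)))"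

lemma conv3_commute12: "conv3 f g h k = conv3 g f h k"
  unfolding conv3_def by (subst nsum_swap) (simp add: mult_ac diff_diff_eq add_ac)

lemma conv3_commute23: "conv3 f g h k = conv3 f h g k"
proof -
  have "nsum (\<lambda>j. f i * g j * h (k - i - j)) = nsum (\<lambda>j. f i * h j * g (k - i - j))" for i
    using nsum_reflect[of "\<lambda>j. f i * g j * h (k - i - j)" "k - i"] by (simp add: mult_ac)
  then show ?thesis unfolding conv3_def by simp
qed

lemma nsum_mult_shift_le:
  assumes "nsum (\<lambda>k. (f k)\<^sup>2) \<le> ennreal (A\<^sup>2)" "nsum (\<lambda>k. (g k)\<^sup>2) \<le> ennreal (B\<^sup>2)"
    and "A \<ge> 0" "B \<ge> 0"
  shows "nsum (\<lambda>k. f k * g (j - k :: int)) \<le> ennreal (A * B)"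
proof (rule ennreal_le_of_square)
  have "(nsum (\<lambda>k. f k * g (j - k)))\<^sup>2 \<le> nsum (\<lambda>k. (f k)\<^sup>2) * nsum (\<lambda>k. (g (j - k))\<^sup>2)"
    by (rule nsum_CS)
  also have "nsum (\<lambda>k. (g (j - k))\<^sup>2) = nsum (\<lambda>k. (g k)\<^sup>2)"
    by (rule nsum_reflect)
  also have "nsum (\<lambda>k. (f k)\<^sup>2) * nsum (\<lambda>k. (g k)\<^sup>2) \<le> ennreal (A\<^sup>2) * ennreal (B\<^sup>2)"
    by (intro mult_mono assms) auto
  finally show "(nsum (\<lambda>k. f k * g (j - k)))\<^sup>2 \<le> ennreal ((A * B)\<^sup>2)"
    by (simp add: ennreal_mult power_mult_distrib)
qed (use assms in auto)

text \<open>Young's inequality from l2, l2 and l1 into bounded sequences: by Cauchy-Schwarz the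
  convolution of the two l2 factors is bounded, and summing it against the l1 factor keeps the
  bound.\<close>

lemma conv3_le:
  assumes "nsum (\<lambda>k. (f k)\<^sup>2) \<le> ennreal (A\<^sup>2)" "nsum (\<lambda>k. (g k)\<^sup>2) \<le> ennreal (B\<^sup>2)"
    and "nsum h \<le> ennreal C" and "A \<ge> 0" "B \<ge> 0" "C \<ge> 0"
  shows "conv3 f g h k \<le> ennreal (A * B * C)"
proof -
  have "conv3 f g h k = conv3 h f g k"
    by (metis conv3_commute12 conv3_commute23)
  also have "\<dots> = nsum (\<lambda>i. h i * nsum (\<lambda>j. f j * g (k - i - j)))"
    unfolding conv3_def by (simp add: nsum_cmult[symmetric] mult_ac)
  also have "\<dots> \<le> nsum (\<lambda>i. h i * ennreal (A * B))"
    by (intro nsum_mono mult_left_mono nsum_mult_shift_le assms) auto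
  also have "\<dots> \<le> ennreal C * ennreal (A * B)"
    unfolding nsum_multc by (intro mult_right_mono assms) auto
  finally show ?thesis using assms by (simp add: ennreal_mult mult_ac)
qed

text \<open>Young's inequality from l1 and l2 into l2, by expanding the square: each correlation of
  two translates of \<open>f\<close> is at most \<open>A^2\<close> by Cauchy-Schwarz, and what is
  left is the square of the sum of \<open>g\<close>.\<close>

lemma conv2_l2:
  assumes f: "nsum (\<lambda>k. (f k)\<^sup>2) \<le> ennreal (A\<^sup>2)" and g: "nsum g \<le> ennreal B"
    and "A \<ge> 0" "B \<ge> 0"
  shows "nsum (\<lambda>k. (nsum (\<lambda>j. g j * f (k - j :: int)))\<^sup>2) \<le> ennreal ((A * B)\<^sup>2)"
proof -
  have sh: "nsum (\<lambda>k. (f (k - j))\<^sup>2) \<le> ennreal (A\<^sup>2)" for j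
    using nsum_shift[of "\<lambda>k. (f k)\<^sup>2" "-j"] f by simp
  have *: "nsum (\<lambda>k. f (k - i) * f (k - j)) \<le> ennreal (A\<^sup>2)" for i j
  proof (rule ennreal_le_of_square)
    have "(nsum (\<lambda>k. f (k - i) * f (k - j)))\<^sup>2 \<le> nsum (\<lambda>k. (f (k - i))\<^sup>2) * nsum (\<lambda>k. (f (k - j))\<^sup>2)"
      by (rule nsum_CS)
    also have "\<dots> \<le> ennreal (A\<^sup>2) * ennreal (A\<^sup>2)"
      by (intro mult_mono sh) auto
    finally show "(nsum (\<lambda>k. f (k - i) * f (k - j)))\<^sup>2 \<le> ennreal ((A\<^sup>2)\<^sup>2)"
      by (simp add: ennreal_mult[symmetric] power2_eq_square)
  qed auto
  have "(nsum (\<lambda>j. g j * f (k - j)))\<^sup>2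
      = nsum (\<lambda>i. nsum (\<lambda>j. g i * g j * (f (k - i) * f (k - j))))" for k
    unfolding power2_eq_square by (simp add: nsum_cmult[symmetric] nsum_multc[symmetric] mult_ac)
  then have "nsum (\<lambda>k. (nsum (\<lambda>j. g j * f (k - j)))\<^sup>2)
      = nsum (\<lambda>k. nsum (\<lambda>i. nsum (\<lambda>j. g i * g j * (f (k - i) * f (k - j)))))"
    by simp
  also have "\<dots> = nsum (\<lambda>i. nsum (\<lambda>k. nsum (\<lambda>j. g i * g j * (f (k - i) * f (k - j)))))"
    by (rule nsum_swap)
  also have "\<dots> = nsum (\<lambda>i. nsum (\<lambda>j. nsum (\<lambda>k. g i * g j * (f (k - i) * f (k - j)))))"
    by (subst nsum_swap) simp
  also have "\<dots> = nsum (\<lambda>i. nsum (\<lambda>j. g i * g j * nsum (\<lambda>k. f (k - i) * f (k - j))))"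
    by (simp add: nsum_cmult)
  also have "\<dots> \<le> nsum (\<lambda>i. nsum (\<lambda>j. g i * g j * ennreal (A\<^sup>2)))"
    by (intro nsum_mono mult_left_mono *) auto
  also have "\<dots> = nsum g * nsum g * ennreal (A\<^sup>2)"
    by (simp add: nsum_cmult nsum_multc mult.assoc)
  also have "\<dots> \<le> ennreal B * ennreal B * ennreal (A\<^sup>2)"
    by (intro mult_mono g) auto
  finally show ?thesis using assms
    by (simp add: ennreal_mult[symmetric] power2_eq_square mult_ac)
qed

lemma conv3_l2:
  assumes "nsum (\<lambda>k. (f k)\<^sup>2) \<le> ennreal (A\<^sup>2)" "nsum g \<le> ennreal B" "nsum h \<le> ennreal C"
    and "A \<ge> 0" "B \<ge> 0" "C \<ge> 0"
  shows "nsum (\<lambda>k. (conv3 f g h k)\<^sup>2) \<le> ennreal ((A * B * C)\<^sup>2)"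
proof -
  have "conv3 f g h k = conv3 h g f k" for k
    by (metis conv3_commute12 conv3_commute23)
  also have "conv3 h g f k = nsum (\<lambda>i. h i * nsum (\<lambda>j. g j * f (k - i - j)))" for k
    unfolding conv3_def by (simp add: nsum_cmult[symmetric] mult_ac)
  finally show ?thesis
    by (simp, intro conv2_l2 assms) (use assms in auto)
qed

section \<open>Bracket weights and their summability\<close>

lemma bracket_ge_1 [simp]: "bracket x \<ge> 1"
  by (simp add: bracket_def)

lemma bracket_pos [simp]: "bracket x > 0"
  by (rule less_le_trans[OF zero_less_one bracket_ge_1])

lemma bracket_nonneg [simp]: "bracket x \<ge> 0"
  by (simp add: bracket_def)

lemma le_bracket_powr_mult:
  assumes "r \<ge> 0" "x \<ge> 0" shows "x \<le> bracket y powr r * x"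
proof -
  have "1 * x \<le> bracket y powr r * x"
    using assms by (intro mult_right_mono ge_one_powr_ge_zero) auto
  then show ?thesis by simp
qed

lemma bracket_minus [simp]: "bracket (- x) = bracket x"
  by (simp add: bracket_def)

lemma bracket_powr_summable: "Infinite_Set_Sum.abs_summable_on (\<lambda>k::int. bracket k powr - (3/2)) UNIV"
proof -
  have nat: "Infinite_Set_Sum.abs_summable_on (\<lambda>n::nat. bracket n powr - (3/2)) UNIV"
  proof -
    have "summable (\<lambda>n. real n powr - (3/2))"
      by (subst summable_real_powr_iff) simp
    then have "summable (\<lambda>n. real (Suc n) powr - (3/2))"
      by (subst summable_Suc_iff)
    then have "summable (\<lambda>n. bracket (real n) powr - (3/2))"
      by (simp add: bracket_def add_ac)
    then show ?thesis by (simp add: abs_summable_on_nat_iff')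
  qed
  have 1: "Infinite_Set_Sum.abs_summable_on (\<lambda>k::int. bracket k powr - (3/2)) (range int)"
    by (rule abs_summable_on_reindex_iff[THEN iffD1, of int UNIV]) (use nat in auto)
  have 2: "Infinite_Set_Sum.abs_summable_on (\<lambda>k::int. bracket k powr - (3/2)) (range (\<lambda>n. - int n))"
    by (rule abs_summable_on_reindex_iff[THEN iffD1, of "\<lambda>n. - int n" UNIV])
      (use nat in \<open>auto simp: inj_on_def\<close>)
  have "Infinite_Set_Sum.abs_summable_on (\<lambda>k::int. bracket k powr - (3/2)) (range int \<union> range (\<lambda>n. - int n))"
    using 1 2 by (rule abs_summable_on_union)
  also have "range int \<union> range (\<lambda>n. - int n) = UNIV"
  proof -
    have "k \<in> range int \<union> range (\<lambda>n. - int n)" for k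
      by (cases k rule: int_cases2) auto
    then show ?thesis by blast
  qed
  finally show ?thesis .
qed

text \<open>The Cauchy-Schwarz constant of the embedding of l2 with weight \<open><k>^(3/4)\<close>
  into l1.\<close>

definition embed_const :: real where
  "embed_const = sqrt (\<Sum>\<^sub>ak\<in>(UNIV::int set). bracket k powr - (3/2))"

lemma nsum_bracket: "nsum (\<lambda>k::int. ennreal (bracket k powr - (3/2))) = ennreal (embed_const\<^sup>2)"
  using nn_integral_conv_infsetsum[OF bracket_powr_summable]
  by (simp add: embed_const_def infsetsum_nonneg)

lemma embed_const_nonneg [simp]: "embed_const \<ge> 0"
  unfolding embed_const_def by (simp add: infsetsum_nonneg)

lemma nsum_weighted_le:
  fixes x :: "int \<Rightarrow> real"
  assumes "nsum (\<lambda>k. (ennreal (bracket k powr s * x k))\<^sup>2) \<le> ennreal (R\<^sup>2)"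
    and "s \<ge> 1" "R \<ge> 0" "\<And>k. x k \<ge> 0"
  shows "nsum (\<lambda>k. ennreal (bracket k powr (1/4) * x k)) \<le> ennreal (embed_const * R)"
proof (rule ennreal_le_of_square)
  have "nsum (\<lambda>k. ennreal (bracket k powr (1/4) * x k))
      \<le> nsum (\<lambda>k::int. ennreal (bracket k powr - (3/4)) * ennreal (bracket k powr s * x k))"
  proof (intro nsum_mono)
    fix k :: int
    \<comment> \<open>Splitting 1/4 = -3/4 + 1 leaves a square-summable power on one side and, as
      \<open>s >= 1\<close>, at most the weight \<open>s\<close> on the other.\<close>
    have "bracket k powr (1/4) = bracket k powr - (3/4) * bracket k powr 1"
      by (subst powr_add[symmetric]) simp
    also have "\<dots> \<le> bracket k powr - (3/4) * bracket k powr s"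
      by (intro mult_left_mono powr_mono assms) auto
    finally show "ennreal (bracket k powr (1/4) * x k)
        \<le> ennreal (bracket k powr - (3/4)) * ennreal (bracket k powr s * x k)"
      using assms(4)[of k] by (subst ennreal_mult[symmetric]) (auto simp: mult.assoc[symmetric] intro!: ennreal_leI mult_right_mono)
  qed
  then have "(nsum (\<lambda>k. ennreal (bracket k powr (1/4) * x k)))\<^sup>2 \<le>
    (nsum (\<lambda>k::int. ennreal (bracket k powr - (3/4)) * ennreal (bracket k powr s * x k)))\<^sup>2"
    by (rule power_mono) simp
  also have "\<dots> \<le> nsum (\<lambda>k::int. (ennreal (bracket k powr - (3/4)))\<^sup>2)
      * nsum (\<lambda>k. (ennreal (bracket k powr s * x k))\<^sup>2)"
    by (rule nsum_CS)
  also have "(\<lambda>k::int. (ennreal (bracket k powr - (3/4)))\<^sup>2) = (\<lambda>k. ennreal (bracket k powr - (3/2)))"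
    by (auto simp: power2_eq_square ennreal_mult[symmetric] powr_add[symmetric])
  also have "nsum \<dots> * nsum (\<lambda>k. (ennreal (bracket k powr s * x k))\<^sup>2) \<le> ennreal (embed_const\<^sup>2) * ennreal (R\<^sup>2)"
    unfolding nsum_bracket by (intro mult_left_mono assms) auto
  finally show "(nsum (\<lambda>k. ennreal (bracket k powr (1/4) * x k)))\<^sup>2 \<le> ennreal ((embed_const * R)\<^sup>2)"
    by (simp add: ennreal_mult power_mult_distrib)
qed (use assms in auto)

section \<open>Fourier coefficients of integrable functions\<close>

lemma measurable_torus_continuous:
  fixes g :: "real \<Rightarrow> 'a::euclidean_space"
  assumes "continuous_on UNIV g" shows "g \<in> borel_measurable torus"
  by (rule continuous_imp_measurable_on_sets_lebesgue[OF continuous_on_subset[OF assms]]) auto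

lemma torus_integrable_mult_bounded:
  fixes f g :: "real \<Rightarrow> complex"
  assumes "integrable torus f" "g \<in> borel_measurable torus" "AE x in torus. norm (g x) \<le> B"
  shows "integrable torus (\<lambda>x. g x * f x)"
proof (rule Bochner_Integration.integrable_bound[of _ "\<lambda>x. B * norm (f x)"])
  show "integrable torus (\<lambda>x. B * norm (f x))"
    using assms(1) by (intro integrable_mult_right integrable_norm)
  show "(\<lambda>x. g x * f x) \<in> borel_measurable torus"
    using assms(1,2) by (intro borel_measurable_times) auto
  show "AE x in torus. norm (g x * f x) \<le> norm (B * norm (f x))"
  proof (use assms(3) in eventually_elim)
    case (elim x)
    then have "norm (g x) * norm (f x) \<le> B * norm (f x)" by (intro mult_right_mono) auto
    then show ?case by (simp add: norm_mult)
  qed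
qed

lemma torus_integrable_mult:
  fixes f g :: "real \<Rightarrow> complex"
  assumes "integrable torus f" "continuous_on UNIV g"
  shows "integrable torus (\<lambda>x. g x * f x)"
proof -
  have "compact (g ` {0..2*pi})"
    by (intro compact_continuous_image continuous_on_subset[OF assms(2)]) auto
  then obtain B where "\<forall>y\<in>g ` {0..2*pi}. norm y \<le> B"
    using compact_imp_bounded bounded_iff by metis
  then show ?thesis
    by (intro torus_integrable_mult_bounded[OF assms(1) measurable_torus_continuous[OF assms(2)], of B] AE_I2)
       (auto simp: space_restrict_space)
qed

lemma emeasure_torus [simp]: "emeasure torus (space torus) = ennreal (2 * pi)"
  by (simp add: emeasure_restrict_space space_restrict_space)

lemma finite_measure_torus: "finite_measure torus"
  by (rule finite_measureI) (simp only: emeasure_torus, simp)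

interpretation torus: finite_measure torus by (rule finite_measure_torus)

lemma torus_integrable_continuous:
  fixes g :: "real \<Rightarrow> complex"
  assumes "continuous_on UNIV g" shows "integrable torus g"
  using torus_integrable_mult[of "\<lambda>_. 1" g] assms by (simp add: torus.integrable_const)

lemma fourier_altdef:
  "fourier f k = 1 / complex_of_real (sqrt (2*pi)) * (LINT x|torus. cis (- (of_int k * x)) * f x)"
  by (simp add: fourier_def cis_conv_exp mult_ac)

lemma AE_torus: "AE x in lebesgue. P x \<Longrightarrow> AE x in torus. P x"
  by (subst AE_restrict_space_iff) (auto elim: eventually_mono)

lemma integrable_fourier:
  assumes "integrable torus f" shows "integrable torus (\<lambda>x. cis (- (of_int k * x)) * f x)"
  by (intro torus_integrable_mult assms continuous_on_cis continuous_intros)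

lemma fourier_cong_AE:
  assumes "AE x in torus. f x = g x" "integrable torus f" "integrable torus g"
  shows "fourier f k = fourier g k"
  unfolding fourier_altdef
  by (intro arg_cong2[of _ _ _ _ times] refl integral_cong_AE borel_measurable_integrable[OF integrable_fourier] assms)
    (use assms(1) in eventually_elim, simp)

lemma fourier_add:
  assumes "integrable torus f" "integrable torus g"
  shows "fourier (\<lambda>x. f x + g x) k = fourier f k + fourier g k"
  using assms[THEN integrable_fourier, of k]
  by (simp add: fourier_altdef distrib_left del: times_divide_eq_left)

lemma fourier_diff:
  assumes "integrable torus f" "integrable torus g"
  shows "fourier (\<lambda>x. f x - g x) k = fourier f k - fourier g k"
  using assms[THEN integrable_fourier, of k]
  by (simp add: fourier_altdef right_diff_distrib del: times_divide_eq_left)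

section \<open>Uniqueness of Fourier coefficients\<close>

text \<open>
  Vanishing of all Fourier coefficients is preserved by multiplication with \<open>e\<^sup>i\<^sup>n\<^sup>x\<close>. This makes it
  possible to multiply by a polynomial in \<open>cos x, sin x\<close> by induction on the polynomial, without
  writing products of trigonometric polynomials in closed form.
\<close>

definition fourier_null :: "(real \<Rightarrow> complex) \<Rightarrow> bool" where
  "fourier_null f \<longleftrightarrow> integrable torus f \<and> (\<forall>k::int. (LINT x|torus. cis (of_int k * x) * f x) = 0)"

lemma fourier_nullI:
  assumes "integrable torus f" "\<And>k. fourier f k = 0" shows "fourier_null f"
  unfolding fourier_null_def
proof (intro conjI allI)
  fix k :: int
  show "(LINT x|torus. cis (of_int k * x) * f x) = 0"
    using assms(2)[of "-k"] by (simp add: fourier_altdef)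
qed (fact assms)

lemma continuous_cis_mult [continuous_intros]: "continuous_on S (\<lambda>x. cis (a * x))"
  by (intro continuous_on_cis continuous_intros)

lemma fourier_null_cis:
  assumes "fourier_null f" shows "fourier_null (\<lambda>x. cis (of_int n * x) * f x)"
  unfolding fourier_null_def
proof (intro conjI allI)
  show "integrable torus (\<lambda>x. cis (of_int n * x) * f x)"
    using assms by (intro torus_integrable_mult continuous_cis_mult) (auto simp: fourier_null_def)
  fix k :: int
  have "(LINT x|torus. cis (of_int k * x) * (cis (of_int n * x) * f x)) =
     (LINT x|torus. cis (of_int (k + n) * x) * f x)"
    by (simp add: mult.assoc[symmetric] cis_mult distrib_right)
  then show "(LINT x|torus. cis (of_int k * x) * (cis (of_int n * x) * f x)) = 0"
    using assms by (simp add: fourier_null_def del: of_int_add)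
qed

lemma fourier_null_add:
  assumes "fourier_null f" "fourier_null g" shows "fourier_null (\<lambda>x. f x + g x)"
proof -
  have "integrable torus (\<lambda>x. cis (of_int k * x) * f x)" "integrable torus (\<lambda>x. cis (of_int k * x) * g x)" for k
    using assms by (auto intro!: torus_integrable_mult continuous_cis_mult simp: fourier_null_def)
  then show ?thesis using assms by (auto simp: fourier_null_def distrib_left)
qed

lemma fourier_null_cmult:
  assumes "fourier_null f" shows "fourier_null (\<lambda>x. c * f x)"
  using assms by (auto simp: fourier_null_def mult.left_commute[of _ c])

lemma fourier_null_polynomial:
  assumes "real_polynomial_function p" "fourier_null f"
  shows "fourier_null (\<lambda>x. complex_of_real (p (cis x)) * f x)"
  using assms
proof (induction p arbitrary: f rule: real_polynomial_function.induct)
  case (linear h)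
  interpret h: bounded_linear h by fact
  \<comment> \<open>A real-linear functional of \<open>cis x\<close> is a combination of
    \<open>cos x\<close> and \<open>sin x\<close>, hence by Euler's formula of \<open>cis x\<close>
    and \<open>cis (- x)\<close>; \<open>a\<close> and \<open>b\<close> are its values at 1 and at
    the imaginary unit.\<close>
  define a where "a = complex_of_real (h 1)"
  define b where "b = complex_of_real (h \<i>)"
  have "h (cis x) = h (cos x *\<^sub>R 1 + sin x *\<^sub>R \<i>)" for x
    by (intro arg_cong[of _ _ h]) (simp add: complex_eq_iff)
  then have h: "h (cis x) = cos x * h 1 + sin x * h \<i>" for x
    by (simp only: h.add h.scaleR real_scaleR_def)
  have "complex_of_real (h (cis x)) * f x =
     ((a - \<i> * b) / 2) * (cis (of_int 1 * x) * f x) + ((a + \<i> * b) / 2) * (cis (of_int (-1) * x) * f x)" for x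
    unfolding h a_def b_def by (simp add: complex_eq_iff field_simps)
  then have eq: "(\<lambda>x. complex_of_real (h (cis x)) * f x) = (\<lambda>x.
     ((a - \<i> * b) / 2) * (cis (of_int 1 * x) * f x) + ((a + \<i> * b) / 2) * (cis (of_int (-1) * x) * f x))"
    by (rule ext)
  show ?case unfolding eq
    by (rule fourier_null_add[OF fourier_null_cmult[OF fourier_null_cis] fourier_null_cmult[OF fourier_null_cis]])
      (fact linear.prems)+
next
  case (const c)
  then show ?case by (rule fourier_null_cmult)
next
  case (add p q)
  have "(\<lambda>x. complex_of_real (p (cis x)) * f x + complex_of_real (q (cis x)) * f x) =
    (\<lambda>x. complex_of_real (p (cis x) + q (cis x)) * f x)" by (simp add: distrib_right)
  with fourier_null_add[OF add.IH(1)[OF add.prems] add.IH(2)[OF add.prems]] show ?case by simp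
next
  case (mult p q)
  from mult.IH(1)[OF mult.IH(2)[OF mult.prems]] show ?case by (simp add: mult.assoc)
qed

text \<open>Stone-Weierstrass on the circle: \<open>h\<close> is uniformly within \<open>e\<close>
  of a real polynomial, whose integral against \<open>f\<close> vanishes, so the integral in
  question is at most \<open>e\<close> times the L1 norm of \<open>f\<close>.\<close>

lemma fourier_null_continuous:
  fixes h :: "complex \<Rightarrow> real"
  assumes f: "fourier_null f" and h: "continuous_on UNIV h"
  shows "(LINT x|torus. h (cis x) *\<^sub>R f x) = 0"
proof -
  have int: "integrable torus (\<lambda>x. h (cis x) *\<^sub>R f x)" if "continuous_on UNIV h" for h :: "complex \<Rightarrow> real"
    using f that unfolding fourier_null_def scaleR_conv_of_real
    by (intro torus_integrable_mult continuous_on_of_real continuous_on_compose2[OF that]) (auto intro!: continuous_intros)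
  have intf: "integrable torus f" using f by (simp add: fourier_null_def)
  define N where "N = (LINT x|torus. norm (f x))"
  have "norm (LINT x|torus. h (cis x) *\<^sub>R f x) \<le> e * N" if e: "e > 0" for e
  proof -
    obtain p where p: "real_polynomial_function p" "\<And>z. z \<in> sphere 0 1 \<Longrightarrow> \<bar>h z - p z\<bar> < e"
      using Stone_Weierstrass_real_polynomial_function[of "sphere (0::complex) 1" h e] e
        continuous_on_subset[OF h] by auto
    have cp: "continuous_on UNIV p"
      using p(1) continuous_on_polymonial_function real_polynomial_function_eq by blast
    have "(LINT x|torus. cis (of_int 0 * x) * (complex_of_real (p (cis x)) * f x)) = 0"
      using fourier_null_polynomial[OF p(1) f] unfolding fourier_null_def by blast
    then have "(LINT x|torus. p (cis x) *\<^sub>R f x) = 0" by (simp add: scaleR_conv_of_real)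
    then have "(LINT x|torus. h (cis x) *\<^sub>R f x) = (LINT x|torus. h (cis x) *\<^sub>R f x - p (cis x) *\<^sub>R f x)"
      using int[OF h] int[OF cp] by simp
    also have "norm \<dots> \<le> (LINT x|torus. norm (h (cis x) *\<^sub>R f x - p (cis x) *\<^sub>R f x))"
      by (rule integral_norm_bound)
    also have "\<dots> \<le> (LINT x|torus. e * norm (f x))"
    proof (rule integral_mono)
      show "integrable torus (\<lambda>x. norm (h (cis x) *\<^sub>R f x - p (cis x) *\<^sub>R f x))"
        using int[OF h] int[OF cp] by auto
      show "integrable torus (\<lambda>x. e * norm (f x))" using intf by auto
      show "norm (h (cis x) *\<^sub>R f x - p (cis x) *\<^sub>R f x) \<le> e * norm (f x)" for x
        using p(2)[of "cis x"] by (simp add: scaleR_left_diff_distrib[symmetric] mult_right_mono)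
    qed
    finally show ?thesis by (simp add: N_def)
  qed
  note * = this
  have "N \<ge> 0" unfolding N_def by (rule integral_nonneg_AE) auto
  show ?thesis
  proof (rule ccontr)
    assume "(LINT x|torus. h (cis x) *\<^sub>R f x) \<noteq> 0"
    then have pos: "norm (LINT x|torus. h (cis x) *\<^sub>R f x) > 0" (is "?n > 0") by simp
    \<comment> \<open>Here \<open>e\<close> is half the integral divided by \<open>N + 1\<close>;
      adding 1 avoids a division by zero when \<open>N = 0\<close>.\<close>
    have "?n \<le> ?n / (2 * (N + 1)) * N" using pos \<open>N \<ge> 0\<close> by (intro *) auto
    also have "\<dots> \<le> ?n / 2" using \<open>N \<ge> 0\<close> pos by (simp add: field_simps)
    finally show False using pos by simp
  qed
qed

text \<open>
  The trigonometric approximation only sees the circle, so intervals are detected as preimages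
  of compact arcs, on which \<open>max 0 (1 - n * dist)\<close> decreases to the indicator.
\<close>

lemma fourier_null_interval:
  assumes f: "fourier_null f" and a: "0 < a" "a < 2 * pi"
  shows "(LINT x|torus. indicat_real {0..a} x *\<^sub>R f x) = 0"
proof -
  have intf: "integrable torus f" using f by (simp add: fourier_null_def)
  define K where "K = cis ` {0..a}"
  have K: "compact K" "K \<noteq> {}" unfolding K_def
    using a by (auto intro!: compact_continuous_image continuous_on_cis continuous_intros)
  define h where "h n z = max 0 (1 - real n * infdist z K)" for n z
  have ch: "continuous_on UNIV (h n)" for n
    unfolding h_def by (intro continuous_intros)
  have lim: "(\<lambda>n. h n z) \<longlonglongrightarrow> indicat_real K z" for z
  proof (cases "z \<in> K")
    case True then show ?thesis by (simp add: h_def)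
  next
    case False
    then have pos: "infdist z K > 0"
      using K in_closed_iff_infdist_zero[of K z] infdist_nonneg[of z K] compact_imp_closed by fastforce
    obtain m :: nat where "real m > 1 / infdist z K" using reals_Archimedean2 by blast
    then have "real m * infdist z K \<ge> 1" using pos by (simp add: field_simps)
    then have "h n z = 0" if "n \<ge> m" for n
    proof -
      have "real n * infdist z K \<ge> real m * infdist z K" using that pos by (intro mult_right_mono) auto
      with \<open>real m * infdist z K \<ge> 1\<close> show ?thesis by (simp add: h_def)
    qed
    then have "eventually (\<lambda>n. h n z = 0) sequentially" by (auto simp: eventually_sequentially)
    then show ?thesis using False by (simp add: tendsto_eventually)
  qed
  have "(\<lambda>n. LINT x|torus. h n (cis x) *\<^sub>R f x) \<longlonglongrightarrow> (LINT x|torus. indicat_real K (cis x) *\<^sub>R f x)"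
  proof (rule integral_dominated_convergence[where w="\<lambda>x. norm (f x)"])
    have meas: "(\<lambda>x. h n (cis x)) \<in> borel_measurable torus" for n
      by (intro measurable_torus_continuous continuous_on_compose2[OF ch]) (auto intro!: continuous_intros)
    then show "(\<lambda>x. h n (cis x) *\<^sub>R f x) \<in> borel_measurable torus" for n
      using intf by (intro borel_measurable_scaleR) auto
    have "(\<lambda>x. indicat_real K (cis x)) \<in> borel_measurable torus"
      by (rule borel_measurable_LIMSEQ_real[OF lim meas])
    then show "(\<lambda>x. indicat_real K (cis x) *\<^sub>R f x) \<in> borel_measurable torus"
      using intf by (intro borel_measurable_scaleR) auto
    show "integrable torus (\<lambda>x. norm (f x))" using intf by simp
    show "AE x in torus. (\<lambda>n. h n (cis x) *\<^sub>R f x) \<longlonglongrightarrow> indicat_real K (cis x) *\<^sub>R f x"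
      by (intro AE_I2 tendsto_intros lim)
    have "h n z \<le> 1" "h n z \<ge> 0" for n z using infdist_nonneg[of z K] by (auto simp: h_def)
    then show "AE x in torus. norm (h n (cis x) *\<^sub>R f x) \<le> norm (f x)" for n
      by (intro AE_I2) (simp add: mult_left_le_one_le)
  qed
  moreover have "(LINT x|torus. h n (cis x) *\<^sub>R f x) = 0" for n
    by (rule fourier_null_continuous[OF f ch])
  ultimately have "(LINT x|torus. indicat_real K (cis x) *\<^sub>R f x) = 0"
    by (simp add: LIMSEQ_const_iff)
  moreover have "(LINT x|torus. indicat_real K (cis x) *\<^sub>R f x) = (LINT x|torus. indicat_real {0..a} x *\<^sub>R f x)"
  proof (rule integral_cong_AE)
    \<comment> \<open>The endpoint has to be removed: \<open>cis (2 * pi) = cis 0\<close> lies in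
      \<open>K\<close>, although \<open>2 * pi\<close> lies beyond \<open>a\<close>.\<close>
    have "{2*pi} \<in> null_sets torus"
      by (simp add: null_sets_restrict_space)
    then have "AE x in torus. x \<noteq> 2 * pi"
      by (drule_tac AE_not_in) simp
    then show "AE x in torus. indicat_real K (cis x) *\<^sub>R f x = indicat_real {0..a} x *\<^sub>R f x"
      using AE_space
    proof eventually_elim
      case (elim x)
      then have x: "0 \<le> x" "x < 2 * pi" by (auto simp: space_restrict_space)
      have "cis x \<in> K \<longleftrightarrow> x \<in> {0..a}"
      proof
        assume "cis x \<in> K"
        then obtain y where y: "y \<in> {0..a}" "cis x = cis y" by (auto simp: K_def)
        have "x = y" using cos_one_2pi x y a
          by (metis (full_types) Arg2pi_unique atLeastAtMost_iff cis_conv_exp mult_1 of_real_1 order_le_less_trans zero_less_one)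
        with y show "x \<in> {0..a}" by simp
      qed (auto simp: K_def)
      then show ?case by (simp add: indicator_def)
    qed
    have "{0..a} \<in> sets torus"
      using a by (auto simp: sets_restrict_space image_iff intro!: bexI[of _ "{0..a}"])
    then show "(\<lambda>x. indicat_real {0..a} x *\<^sub>R f x) \<in> borel_measurable torus"
      using intf by (intro borel_measurable_scaleR borel_measurable_indicator) auto
    have "(\<lambda>x. indicat_real K (cis x)) \<in> borel_measurable torus"
      by (rule borel_measurable_LIMSEQ_real[OF lim]) (intro measurable_torus_continuous continuous_on_compose2[OF ch], auto intro!: continuous_intros)
    then show "(\<lambda>x. indicat_real K (cis x) *\<^sub>R f x) \<in> borel_measurable torus"
      using intf by (intro borel_measurable_scaleR) auto
  qed
  ultimately show ?thesis by simp
qed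

text \<open>The half-lines \<open>{..a}\<close> form an intersection-stable generator of the Borel
  sets, so Dynkin's argument carries the vanishing of the integral from them to all Borel sets; a
  Lebesgue set differs from a Borel set only inside a null set.\<close>

lemma fourier_null_imp_AE_zero:
  assumes f: "fourier_null f" shows "AE x in torus. f x = 0"
proof -
  have intf: "integrable torus f" using f by (simp add: fourier_null_def)
  have sets: "A \<inter> {0..2*pi} \<in> sets torus" if "A \<in> sets lebesgue" for A
    using that by (auto simp: sets_restrict_space)
  have int_ind: "integrable torus (\<lambda>x. indicat_real A x *\<^sub>R f x)" if "A \<in> sets lebesgue" for A
  proof -
    have "integrable torus (\<lambda>x. indicat_real (A \<inter> {0..2*pi}) x *\<^sub>R f x)"
      by (intro integrable_mult_indicator sets that intf)
    then show ?thesis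
      by (subst Bochner_Integration.integrable_cong[OF refl])
        (auto simp: indicator_def space_restrict_space)
  qed
  have borel: "(LINT x|torus. indicat_real A x *\<^sub>R f x) = 0" if "A \<in> sets borel" for A :: "real set"
  proof -
    have "A \<in> sigma_sets UNIV (range (\<lambda>a::real. {..a}))"
      using that by (simp add: borel_eq_atMost)
    show ?thesis
    proof (rule sigma_sets_induct_disjoint[where P="\<lambda>A. (LINT x|torus. indicat_real A x *\<^sub>R f x) = 0"])
      show "A \<in> sigma_sets UNIV (range (\<lambda>a::real. {..a}))" by fact
      show "Int_stable (range (\<lambda>a::real. {..a}))"
        by (auto intro!: Int_stableI simp: min_def)
    next
      fix A assume "A \<in> range (\<lambda>a::real. {..a})"
      then obtain a where A: "A = {..a}" by blast
      have "(LINT x|torus. cis (of_int 0 * x) * f x) = 0"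
        using f unfolding fourier_null_def by blast
      then have tot: "(LINT x|torus. f x) = 0" by simp
      consider "a \<le> 0" | "0 < a" "a < 2 * pi" | "2 * pi \<le> a" by linarith
      then show "(LINT x|torus. indicat_real A x *\<^sub>R f x) = 0"
      proof cases
        case 1
        have "{0} \<in> null_sets torus" by (simp add: null_sets_restrict_space)
        then have "AE x in torus. x \<noteq> 0" by (drule_tac AE_not_in) simp
        then have "AE x in torus. indicat_real A x *\<^sub>R f x = 0"
          using AE_space by eventually_elim (use 1 in \<open>auto simp: A indicator_def space_restrict_space\<close>)
        then show ?thesis by (rule integral_eq_zero_AE)
      next
        case 2
        have "(LINT x|torus. indicat_real A x *\<^sub>R f x) = (LINT x|torus. indicat_real {0..a} x *\<^sub>R f x)"
          by (intro Bochner_Integration.integral_cong) (auto simp: A indicator_def space_restrict_space)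
        with fourier_null_interval[OF f 2] show ?thesis by simp
      next
        case 3
        have "(LINT x|torus. indicat_real A x *\<^sub>R f x) = (LINT x|torus. f x)"
          using 3 by (intro Bochner_Integration.integral_cong) (auto simp: A indicator_def space_restrict_space)
        with tot show ?thesis by simp
      qed
    next
      fix A assume A: "A \<in> sigma_sets UNIV (range (\<lambda>a::real. {..a}))"
        and *: "(LINT x|torus. indicat_real A x *\<^sub>R f x) = 0"
      have "(LINT x|torus. cis (of_int 0 * x) * f x) = 0"
        using f unfolding fourier_null_def by blast
      then have tot: "(LINT x|torus. f x) = 0" by simp
      have "A \<in> sets borel" using A by (simp add: borel_eq_atMost)
      then have "A \<in> sets lebesgue" by (simp add: sets_completionI_sets)
      then have "(LINT x|torus. f x - indicat_real A x *\<^sub>R f x) = 0"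
        using * tot int_ind intf by simp
      also have "(\<lambda>x. f x - indicat_real A x *\<^sub>R f x) = (\<lambda>x. indicat_real (UNIV - A) x *\<^sub>R f x)"
        by (auto simp: indicator_def)
      finally show "(LINT x|torus. indicat_real (UNIV - A) x *\<^sub>R f x) = 0" .
    next
      fix A :: "nat \<Rightarrow> real set"
      assume A: "disjoint_family A" "range A \<subseteq> sigma_sets UNIV (range (\<lambda>a::real. {..a}))"
        and *: "\<And>i. (LINT x|torus. indicat_real (A i) x *\<^sub>R f x) = 0"
      have "A i \<in> sets (borel :: real measure)" for i
        using A(2) by (auto simp: borel_eq_atMost)
      then have Al: "A i \<in> sets lebesgue" for i by (simp add: sets_completionI_sets)
      have eq: "(LINT x|torus. indicat_real B x *\<^sub>R f x) = (LINT x:(B \<inter> {0..2*pi})|torus. f x)" for B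
        unfolding set_lebesgue_integral_def
        by (intro Bochner_Integration.integral_cong) (auto simp: indicator_def space_restrict_space)
      have "(LINT x:(\<Union>i. A i \<inter> {0..2*pi})|torus. f x) = (\<Sum>i. LINT x:(A i \<inter> {0..2*pi})|torus. f x)"
      proof (rule lebesgue_integral_countable_add)
        show "A i \<inter> {0..2*pi} \<in> sets torus" for i by (rule sets[OF Al])
        show "A i \<inter> {0..2*pi} \<inter> (A j \<inter> {0..2*pi}) = {}" if "i \<noteq> j" for i j
          using A(1) that by (auto simp: disjoint_family_on_def)
        show "set_integrable torus (\<Union>i. A i \<inter> {0..2*pi}) f"
          unfolding set_integrable_def
          by (intro integrable_mult_indicator intf sets.countable_UN') (auto intro: sets[OF Al])
      qed
      also have "\<dots> = 0" using * by (simp add: eq[symmetric])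
      finally show "(LINT x|torus. indicat_real (\<Union>i. A i) x *\<^sub>R f x) = 0"
        unfolding eq by simp
    qed auto
  qed
  show ?thesis
  proof (rule torus.density_zero[OF intf])
    fix A assume "A \<in> sets torus"
    then have "A \<in> sets lebesgue" by (auto simp: sets_restrict_space)
    then obtain S N N' where A: "A = S \<union> N" "N \<subseteq> N'" "N' \<in> null_sets lborel" "S \<in> sets lborel"
      by (rule sets_completionE)
    have "N' \<in> null_sets lebesgue" using A(3) by (rule null_sets_completionI)
    then have "AE x in lebesgue. x \<notin> N'" by (rule AE_not_in)
    then have "AE x in torus. x \<notin> N'"
      by (rule AE_torus)
    then have "AE x in torus. indicat_real A x *\<^sub>R f x = indicat_real S x *\<^sub>R f x"
      by eventually_elim (use A in \<open>auto simp: indicator_def\<close>)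
    then have "(LINT x|torus. indicat_real A x *\<^sub>R f x) = (LINT x|torus. indicat_real S x *\<^sub>R f x)"
      using int_ind \<open>A \<in> sets lebesgue\<close> A(4)
      by (intro integral_cong_AE) (auto intro: borel_measurable_integrable sets_completionI_sets)
    with borel A(4) show "set_lebesgue_integral torus A f = 0"
      by (simp add: set_lebesgue_integral_def)
  qed
qed

lemma fourier_eq_imp_AE_eq:
  assumes "integrable torus f" "integrable torus g" "\<And>k. fourier f k = fourier g k"
  shows "AE x in torus. f x = g x"
proof -
  have "fourier_null (\<lambda>x. f x - g x)"
    using assms by (intro fourier_nullI) (auto simp: fourier_diff)
  from fourier_null_imp_AE_zero[OF this] show ?thesis by eventually_elim simp
qed

section \<open>Products of absolutely convergent Fourier series\<close>

abbreviation csum :: "('a \<Rightarrow> complex) \<Rightarrow> complex" where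
  "csum f \<equiv> LINT k|count_space UNIV. f k"

abbreviation csummable :: "('a \<Rightarrow> complex) \<Rightarrow> bool" where
  "csummable f \<equiv> integrable (count_space UNIV) f"

lemma csummable_iff: "csummable f \<longleftrightarrow> nsum (\<lambda>k. ennreal (cmod (f k))) < \<infinity>"
  by (simp add: integrable_iff_bounded)

lemma csummableI: "nsum (\<lambda>k. ennreal (cmod (f k))) \<le> ennreal C \<Longrightarrow> csummable f"
  unfolding csummable_iff by (rule le_less_trans) auto

lemma cmod_csum_le: "ennreal (cmod (csum f)) \<le> nsum (\<lambda>k. ennreal (cmod (f k)))"
  using integral_norm_bound_ennreal[of "count_space UNIV" f]
  by (cases "csummable f") (auto simp: not_integrable_integral_eq)

lemma csum_reindex:
  fixes g :: "'a \<Rightarrow> 'b" and f :: "'b \<Rightarrow> complex"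
  assumes "bij g" shows "csum (\<lambda>x. f (g x)) = csum f"
  using integral_bij_count_space[of g UNIV UNIV f] assms by simp

lemma csummable_reindex:
  fixes g :: "'a \<Rightarrow> 'b" and f :: "'b \<Rightarrow> complex"
  assumes "bij g" shows "csummable (\<lambda>x. f (g x)) \<longleftrightarrow> csummable f"
  unfolding csummable_iff using nsum_reindex[OF assms, of "\<lambda>x. ennreal (cmod (f x))"] by simp

lemma csum_pair:
  fixes f :: "'a::countable \<times> 'b::countable \<Rightarrow> complex"
  assumes "csummable f"
  shows "csum f = csum (\<lambda>i. csum (\<lambda>j. f (i, j)))"
    and "csummable (\<lambda>i. csum (\<lambda>j. f (i, j)))"
proof -
  interpret pair_sigma_finite "count_space (UNIV :: 'a set)" "count_space (UNIV :: 'b set)"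
    by (intro pair_sigma_finite.intro sigma_finite_measure_count_space)
  have *: "count_space UNIV \<Otimes>\<^sub>M count_space UNIV = (count_space UNIV :: ('a \<times> 'b) measure)"
    by (subst pair_measure_countable) auto
  have "integrable (count_space UNIV \<Otimes>\<^sub>M count_space UNIV) f"
    unfolding * by (rule assms)
  from integral_fst'[OF this] integrable_fst'[OF this]
  show "csum f = csum (\<lambda>i. csum (\<lambda>j. f (i, j)))" "csummable (\<lambda>i. csum (\<lambda>j. f (i, j)))"
    unfolding * by simp_all
qed

lemma nsum_pair: "nsum f = nsum (\<lambda>i. nsum (\<lambda>j. f (i, j)))"
  by (rule nn_integral_fst_count_space[symmetric])

lemma infsum_eq_csum:
  fixes f :: "'a \<Rightarrow> complex"
  assumes "csummable f" shows "infsum f UNIV = csum f"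
  using infsetsum_infsum[of f UNIV] assms by (simp add: abs_summable_on_def infsetsum_def)

definition fseries :: "(int \<Rightarrow> complex) \<Rightarrow> real \<Rightarrow> complex" where
  "fseries a x = 1 / complex_of_real (sqrt (2*pi)) * csum (\<lambda>j. a j * cis (of_int j * x))"

text \<open>Fubini for counting measure times the circle, justified by the summability of
  \<open>a\<close>: the product is integrated term by term, and each exponential shifts the
  frequency of \<open>g\<close>.\<close>

lemma
  assumes a: "csummable a" and g: "integrable torus g"
  shows integrable_fseries_mult: "integrable torus (\<lambda>x. fseries a x * g x)"
    and fourier_fseries_mult: "fourier (\<lambda>x. fseries a x * g x) k =
      1 / complex_of_real (sqrt (2*pi)) * csum (\<lambda>j. a j * fourier g (k - j))"
proof -
  interpret pair_sigma_finite "count_space (UNIV :: int set)" torus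
    by (intro pair_sigma_finite.intro sigma_finite_measure_count_space) unfold_locales
  define F where "F k j x = a j * (cis (of_int (j - k) * x) * g x)" for k j x
  have intj: "integrable torus (\<lambda>x. cis (of_int j * x) * g x)" for j
    by (intro torus_integrable_mult g continuous_cis_mult)
  have prod: "integrable (count_space UNIV \<Otimes>\<^sub>M torus) (case_prod (F k))" for k
  proof (rule Fubini_integrable)
    have "F k j \<in> borel_measurable torus" for j
      unfolding F_def using intj[of "j - k"]
      by (intro borel_measurable_times borel_measurable_const borel_measurable_integrable)
    then show "case_prod (F k) \<in> borel_measurable (count_space UNIV \<Otimes>\<^sub>M torus)"
      by (intro measurable_pair_measure_countable1) auto
    have "(LINT x|torus. norm (F k j x)) = norm (a j) * (LINT x|torus. norm (g x))" for j
      by (simp add: F_def norm_mult)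
    then show "integrable (count_space UNIV) (\<lambda>j. LINT x|torus. norm (case_prod (F k) (j, x)))"
      using a by simp
    show "AE j in count_space UNIV. integrable torus (\<lambda>x. case_prod (F k) (j, x))"
      unfolding F_def using intj[of "_ - k"] by simp
  qed
  have F0: "csum (\<lambda>j. F k j x) = cis (- (of_int k * x)) * (csum (\<lambda>j. a j * cis (of_int j * x)) * g x)" for k x
  proof -
    have "F k j x = (a j * cis (of_int j * x)) * (cis (- (of_int k * x)) * g x)" for j
    proof -
      have "cis (of_int (j - k) * x) = cis (of_int j * x) * cis (- (of_int k * x))"
        by (simp add: cis_mult left_diff_distrib)
      then show ?thesis by (simp add: F_def mult_ac)
    qed
    then have "csum (\<lambda>j. F k j x) = csum (\<lambda>j. (a j * cis (of_int j * x)) * (cis (- (of_int k * x)) * g x))" by simp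
    also have "\<dots> = csum (\<lambda>j. (a j * cis (of_int j * x))) * (cis (- (of_int k * x)) * g x)"
      by (cases "csummable (\<lambda>j. a j * cis (of_int j * x))") (simp_all add: not_integrable_integral_eq)
    finally show ?thesis by (simp add: mult_ac)
  qed
  \<comment> \<open>For \<open>k = 0\<close> the modulating factor is 1, so this is the product
    itself up to normalisation.\<close>
  have "integrable torus (\<lambda>x. csum (\<lambda>j. F 0 j x))"
    using integrable_snd[OF prod[of 0]] by simp
  then have "integrable torus (\<lambda>x. 1 / complex_of_real (sqrt (2*pi)) * csum (\<lambda>j. F 0 j x))"
    by (rule integrable_mult_right)
  then show "integrable torus (\<lambda>x. fseries a x * g x)"
    unfolding F0 fseries_def by (simp add: mult_ac)
  have "(LINT x|torus. cis (- (of_int k * x)) * (fseries a x * g x)) =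
      (LINT x|torus. 1 / complex_of_real (sqrt (2*pi)) * csum (\<lambda>j. F k j x))"
    unfolding F0 fseries_def by (simp add: mult_ac)
  also have "\<dots> = 1 / complex_of_real (sqrt (2*pi)) * (LINT x|torus. csum (\<lambda>j. F k j x))"
    by simp
  also have "(LINT x|torus. csum (\<lambda>j. F k j x)) = csum (\<lambda>j. LINT x|torus. F k j x)"
    by (rule Fubini_integral[OF prod])
  also have "csum (\<lambda>j. LINT x|torus. F k j x) =
      csum (\<lambda>j. complex_of_real (sqrt (2*pi)) * (a j * fourier g (k - j)))"
    unfolding F_def by (simp add: fourier_altdef left_diff_distrib)
  also have "\<dots> = complex_of_real (sqrt (2*pi)) * csum (\<lambda>j. a j * fourier g (k - j))"
    by simp
  finally show "fourier (\<lambda>x. fseries a x * g x) k =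
      1 / complex_of_real (sqrt (2*pi)) * csum (\<lambda>j. a j * fourier g (k - j))"
    unfolding fourier_altdef[of "\<lambda>x. fseries a x * g x"] by simp
qed

lemma has_vector_derivative_cis: "((\<lambda>t. cis (w * t)) has_vector_derivative \<i> * of_real w * cis (w * t)) (at t within S)"
proof -
  have "((\<lambda>z. exp (\<i> * of_real w * z)) has_field_derivative \<i> * of_real w * exp (\<i> * of_real w * of_real t)) (at (of_real t))"
    by (auto intro!: derivative_eq_intros)
  then have "((\<lambda>t. exp (\<i> * of_real w * of_real t)) has_vector_derivative \<i> * of_real w * exp (\<i> * of_real w * of_real t)) (at t within S)"
    by (rule has_vector_derivative_real_field)
  then show ?thesis by (simp add: cis_conv_exp mult_ac)
qed

lemma has_vector_derivative_cis_antideriv: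
  assumes "w \<noteq> 0"
  shows "((\<lambda>t. cis (w * t) / (\<i> * of_real w)) has_vector_derivative cis (w * t)) (at t within S)"
  using has_vector_derivative_divide[OF has_vector_derivative_cis[of w t S], of "\<i> * of_real w"] assms by simp

lemma cis_period: "cis (of_int n * (x + 2 * pi)) = cis (of_int n * x)"
proof -
  have "cis (of_int n * (x + 2 * pi)) = cis (of_int n * x) * cis (2 * pi * of_int n)"
    by (simp add: cis_mult distrib_left mult_ac)
  also have "cis (2 * pi * of_int n) = 1" by (rule cis_multiple_2pi) auto
  finally show ?thesis by simp
qed

lemma fourier_cis: "fourier (\<lambda>x. cis (of_int n * x)) k = (if k = n then complex_of_real (sqrt (2*pi)) else 0)"
proof -
  have "(LINT x|torus. cis (of_int m * x)) = (if m = 0 then 2 * pi else 0)" for m :: int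
  proof (cases "m = 0")
    case False
    define G where "G x = cis (of_int m * x) / (\<i> * of_real (of_int m))" for x
    have "((\<lambda>x. cis (of_int m * x)) has_integral G (2*pi) - G 0) {0..2*pi}"
      unfolding G_def using False by (intro fundamental_theorem_of_calculus has_vector_derivative_cis_antideriv) auto
    moreover have "G (2*pi) = G 0"
      using cis_period[of m 0] by (simp add: G_def)
    ultimately have "integral {0..2*pi} (\<lambda>x. cis (of_int m * x)) = 0"
      by (simp add: integral_unique)
    moreover have "integrable torus (\<lambda>x. cis (of_int m * x))"
      by (intro torus_integrable_continuous continuous_cis_mult)
    ultimately show ?thesis using False by (simp add: lebesgue_integral_eq_integral)
  qed (simp add: measure_restrict_space scaleR_conv_of_real)
  from this[of "n - k"] have *: "(LINT x|torus. cis (of_int (n - k) * x)) = (if k = n then 2 * pi else 0)"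
    by (auto simp del: of_int_diff)
  have "(LINT x|torus. cis (- (of_int k * x)) * cis (of_int n * x)) = (LINT x|torus. cis (of_int (n - k) * x))"
    by (intro Bochner_Integration.integral_cong refl) (simp add: cis_mult left_diff_distrib)
  then show ?thesis
    unfolding fourier_altdef *
    by (simp add: field_simps flip: of_real_mult)
qed

lemma csum_single: "csum (\<lambda>j. if j = k then c else 0) = c"
proof -
  have "csum (\<lambda>j. if j = k then c else 0) = (\<Sum>j | j \<in> UNIV \<and> (if j = k then c else 0) \<noteq> 0. (if j = k then c else 0))"
    by (rule lebesgue_integral_count_space_finite_support) (rule finite_subset[of _ "{k}"], auto)
  also have "\<dots> = (\<Sum>j\<in>{k}. if j = k then c else 0)"
    by (rule sum.mono_neutral_left) auto
  finally show ?thesis by simp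
qed

text \<open>The product formula with the constant function 1 shows that the series has the
  coefficients of \<open>u\<close>; uniqueness of Fourier coefficients does the rest.\<close>

lemma csummable_imp_AE_fseries:
  assumes u: "integrable torus u" and a: "csummable (fourier u)"
  shows "AE x in torus. u x = fseries (fourier u) x"
proof (rule fourier_eq_imp_AE_eq[OF u])
  have 1: "integrable torus (\<lambda>x. 1 :: complex)" by simp
  show "integrable torus (fseries (fourier u))"
    using integrable_fseries_mult[OF a 1] by simp
  have f1: "fourier (\<lambda>x. 1) k = (if k = 0 then complex_of_real (sqrt (2*pi)) else 0)" for k
    using fourier_cis[of 0 k] by simp
  fix k
  have "fourier (fseries (fourier u)) k =
      1 / complex_of_real (sqrt (2*pi)) * csum (\<lambda>j. fourier u j * fourier (\<lambda>x. 1) (k - j))"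
    using fourier_fseries_mult[OF a 1] by simp
  also have "csum (\<lambda>j. fourier u j * fourier (\<lambda>x. 1) (k - j)) = csum (\<lambda>j. if j = k then fourier u k * complex_of_real (sqrt (2*pi)) else 0)"
    by (intro Bochner_Integration.integral_cong) (auto simp: f1)
  also have "\<dots> = fourier u k * complex_of_real (sqrt (2*pi))"
    by (rule csum_single)
  finally show "fourier u k = fourier (fseries (fourier u)) k" by simp
qed

text \<open>Absolute summability is asked of one factor only and the other is merely integrable, so
  the formula can be iterated to reach cubic products.\<close>

lemma
  assumes u: "integrable torus u" and a: "csummable (fourier u)" and g: "integrable torus g"
  shows integrable_wiener_mult: "integrable torus (\<lambda>x. u x * g x)"
    and fourier_wiener_mult: "fourier (\<lambda>x. u x * g x) k =
      1 / complex_of_real (sqrt (2*pi)) * csum (\<lambda>j. fourier u j * fourier g (k - j))"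
proof -
  have int: "integrable torus (\<lambda>x. fseries (fourier u) x * g x)"
    by (rule integrable_fseries_mult[OF a g])
  have AE: "AE x in torus. u x * g x = fseries (fourier u) x * g x"
    using csummable_imp_AE_fseries[OF u a] by eventually_elim simp
  have meas: "(\<lambda>x. u x * g x) \<in> borel_measurable torus"
    using u g by (intro borel_measurable_times) auto
  show int': "integrable torus (\<lambda>x. u x * g x)"
    using integrable_cong_AE[OF meas _ AE] int by auto
  have "fourier (\<lambda>x. u x * g x) k = fourier (\<lambda>x. fseries (fourier u) x * g x) k"
    by (rule fourier_cong_AE[OF AE int' int])
  then show "fourier (\<lambda>x. u x * g x) k =
      1 / complex_of_real (sqrt (2*pi)) * csum (\<lambda>j. fourier u j * fourier g (k - j))"
    using fourier_fseries_mult[OF a g] by simp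
qed

lemma fourier_cnj: "fourier (\<lambda>x. cnj (u x)) k = cnj (fourier u (- k))"
proof -
  have "(LINT x|torus. cis (- (of_int k * x)) * cnj (u x)) = (LINT x|torus. cnj (cis (of_int k * x) * u x))"
    by (simp add: cis_cnj)
  also have "\<dots> = cnj (LINT x|torus. cis (of_int k * x) * u x)"
    by (rule integral_bounded_linear'[OF bounded_linear_cnj bounded_linear_cnj]) simp
  finally show ?thesis by (simp add: fourier_altdef)
qed

section \<open>Weighted sequence spaces and cubic convolutions\<close>

lemma bracket_add3_le: "bracket (x + y + z) \<le> bracket x + bracket y + bracket z"
  by (simp add: bracket_def)

abbreviation wt :: "real \<Rightarrow> (int \<Rightarrow> complex) \<Rightarrow> int \<Rightarrow> ennreal" where
  "wt s a k \<equiv> ennreal (bracket (of_int k) powr s * cmod (a k))"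

text \<open>A certified bound instead of the norm: a divergent \<open>infsum\<close> has the value
  0, so smallness of \<open>sobolev_seq_norm\<close> alone would not show membership in the
  space.\<close>

definition l2_weighted :: "real \<Rightarrow> real \<Rightarrow> (int \<Rightarrow> complex) \<Rightarrow> bool" where
  "l2_weighted s R a \<longleftrightarrow> R \<ge> 0 \<and> nsum (\<lambda>k. (wt s a k)\<^sup>2) \<le> ennreal (R\<^sup>2)"

lemma l2_weighted_reflect: "l2_weighted s R (\<lambda>j. cnj (a (- j))) \<longleftrightarrow> l2_weighted s R a"
  unfolding l2_weighted_def
  using nsum_uminus[of "\<lambda>k. (wt s a k)\<^sup>2"] by simp

lemma l2_weighted_summable:
  assumes "l2_weighted s R a"
  shows "(\<lambda>k. (bracket k powr s * cmod (a k))\<^sup>2) summable_on UNIV"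
    and "l2_weighted s (sobolev_seq_norm s a) a" "sobolev_seq_norm s a \<le> R"
proof -
  have int: "integrable (count_space UNIV) (\<lambda>k::int. (bracket k powr s * cmod (a k))\<^sup>2)"
  proof -
    have "nsum (\<lambda>k. (wt s a k)\<^sup>2) < \<infinity>"
      using assms by (auto simp: l2_weighted_def intro: le_less_trans[OF _ ennreal_less_top])
    then show ?thesis by (simp add: integrable_iff_bounded ennreal_power)
  qed
  then have abs: "Infinite_Set_Sum.abs_summable_on (\<lambda>k::int. (bracket k powr s * cmod (a k))\<^sup>2) UNIV"
    by (simp add: abs_summable_on_def)
  then show sum: "(\<lambda>k. (bracket k powr s * cmod (a k))\<^sup>2) summable_on UNIV"
    by (rule abs_summable_summable[OF abs_summable_equivalent[THEN iffD2]])
  have eq: "nsum (\<lambda>k. (wt s a k)\<^sup>2) = ennreal ((sobolev_seq_norm s a)\<^sup>2)"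
    using nn_integral_conv_infsetsum[OF abs] infsetsum_infsum[OF abs]
    by (simp add: sobolev_seq_norm_def infsum_nonneg ennreal_power)
  have nn: "sobolev_seq_norm s a \<ge> 0" by (simp add: sobolev_seq_norm_def infsum_nonneg)
  with eq show "l2_weighted s (sobolev_seq_norm s a) a" by (simp add: l2_weighted_def)
  have "(sobolev_seq_norm s a)\<^sup>2 \<le> R\<^sup>2" using assms eq by (simp add: l2_weighted_def)
  then show "sobolev_seq_norm s a \<le> R"
    by (rule power2_le_imp_le) (use assms in \<open>simp add: l2_weighted_def\<close>)
qed

lemma l2_weighted_sobolev_seq:
  assumes "a \<in> sobolev_seq s" shows "l2_weighted s (sobolev_seq_norm s a) a"
proof -
  let ?f = "\<lambda>k::int. (bracket k powr s * cmod (a k))\<^sup>2"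
  have sum: "?f summable_on UNIV" using assms by (simp add: sobolev_seq_def)
  have abs: "Infinite_Set_Sum.abs_summable_on ?f UNIV"
    by (rule abs_summable_equivalent[THEN iffD1, OF summable_on_iff_abs_summable_on_real[THEN iffD1, OF sum]])
  have "nsum (\<lambda>k. (wt s a k)\<^sup>2) = ennreal ((sobolev_seq_norm s a)\<^sup>2)"
    using nn_integral_conv_infsetsum[OF abs] infsetsum_infsum[OF abs]
    by (simp add: sobolev_seq_norm_def infsum_nonneg ennreal_power)
  then show ?thesis by (simp add: l2_weighted_def sobolev_seq_norm_def infsum_nonneg)
qed

lemma l2_weighted_mono: "l2_weighted s R a \<Longrightarrow> R \<le> R' \<Longrightarrow> l2_weighted s R' a"
  unfolding l2_weighted_def by (meson ennreal_leI order_trans power_mono)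

lemma l2_weighted_pointwise:
  assumes "l2_weighted s R a" shows "bracket k powr s * cmod (a k) \<le> R"
proof -
  have "(wt s a k)\<^sup>2 \<le> nsum (\<lambda>k. (wt s a k)\<^sup>2)"
    by (rule nn_integral_ge_point) auto
  also have "\<dots> \<le> ennreal (R\<^sup>2)" using assms by (simp add: l2_weighted_def)
  finally have "(bracket k powr s * cmod (a k))\<^sup>2 \<le> R\<^sup>2" by (simp add: ennreal_power)
  then show ?thesis by (rule power2_le_imp_le) (use assms in \<open>simp add: l2_weighted_def\<close>)
qed

lemma l2_weighted_norm_le:
  assumes "l2_weighted s R a" "s \<ge> 0" shows "cmod (a k) \<le> R"
  by (rule order_trans[OF le_bracket_powr_mult l2_weighted_pointwise[OF assms(1), of k]]) (use assms in auto)

lemma l2_weighted_l1: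
  assumes "l2_weighted s R a" "s \<ge> 1"
  shows "nsum (wt (1/4) a) \<le> ennreal (embed_const * R)"
    and "nsum (\<lambda>k. ennreal (cmod (a k))) \<le> ennreal (embed_const * R)"
proof -
  show *: "nsum (wt (1/4) a) \<le> ennreal (embed_const * R)"
    by (rule nsum_weighted_le) (use assms in \<open>auto simp: l2_weighted_def\<close>)
  have "cmod (a k) \<le> bracket k powr (1/4) * cmod (a k)" for k
    by (rule le_bracket_powr_mult) auto
  then have "nsum (\<lambda>k. ennreal (cmod (a k))) \<le> nsum (wt (1/4) a)"
    by (intro nsum_mono ennreal_leI)
  with * show "nsum (\<lambda>k. ennreal (cmod (a k))) \<le> ennreal (embed_const * R)" by simp
qed

lemma l2_weighted_csummable: "l2_weighted s R a \<Longrightarrow> s \<ge> 1 \<Longrightarrow> csummable a"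
  using l2_weighted_l1(2) csummableI by blast

lemma ennreal_sum3_square: "(x + y + z)\<^sup>2 \<le> 3 * (x\<^sup>2 + y\<^sup>2 + (z::ennreal)\<^sup>2)"
proof (cases "x = top \<or> y = top \<or> z = top")
  case True
  then show ?thesis by (auto simp: power2_eq_square ennreal_top_mult ennreal_mult_top)
next
  case False
  then obtain a b c where [simp]: "x = ennreal a" "y = ennreal b" "z = ennreal c"
    and nn: "a \<ge> 0" "b \<ge> 0" "c \<ge> 0"
    by (cases x; cases y; cases z) auto
  have "3 * (a\<^sup>2 + b\<^sup>2 + c\<^sup>2) - (a + b + c)\<^sup>2 = (a - b)\<^sup>2 + (b - c)\<^sup>2 + (a - c)\<^sup>2"
    by (simp add: power2_eq_square algebra_simps)
  then have "(a + b + c)\<^sup>2 \<le> 3 * (a\<^sup>2 + b\<^sup>2 + c\<^sup>2)"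
    by (smt (verit) zero_le_power2)
  then have "ennreal ((a + b + c)\<^sup>2) \<le> ennreal (3 * (a\<^sup>2 + b\<^sup>2 + c\<^sup>2))" by (rule ennreal_leI)
  also have "\<dots> = 3 * ((ennreal a)\<^sup>2 + (ennreal b)\<^sup>2 + (ennreal c)\<^sup>2)"
    using nn by (simp add: ennreal_mult ennreal_power)
  also have "ennreal ((a + b + c)\<^sup>2) = (ennreal a + ennreal b + ennreal c)\<^sup>2"
    using nn by (simp add: ennreal_power[symmetric])
  finally show ?thesis by simp
qed

text \<open>A crude substitute for Minkowski's inequality: squaring yields
  \<open>3 * (A^2 + B^2)\<close>, which is at most \<open>4 * (A + B)^2\<close>. Only uniformity of
  the bounds matters later, not their size.\<close>

lemma l2_weighted_add:
  assumes "l2_weighted s A a" "l2_weighted s B b"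
  shows "l2_weighted s (2 * (A + B)) (\<lambda>k. a k + b k)"
proof -
  have nn: "A \<ge> 0" "B \<ge> 0" using assms by (auto simp: l2_weighted_def)
  define f where "f k = ennreal (bracket (of_int k) powr s * cmod (a k))" for k
  define g where "g k = ennreal (bracket (of_int k) powr s * cmod (b k))" for k
  have "nsum (\<lambda>k. (ennreal (bracket k powr s * cmod (a k + b k)))\<^sup>2) \<le> nsum (\<lambda>k. 3 * ((f k)\<^sup>2 + (g k)\<^sup>2))"
  proof (rule nsum_mono)
    fix k :: int
    have "bracket k powr s * cmod (a k + b k) \<le> bracket k powr s * (cmod (a k) + cmod (b k))"
      by (intro mult_left_mono norm_triangle_ineq) auto
    then have "ennreal (bracket k powr s * cmod (a k + b k)) \<le> f k + g k + 0"
      unfolding f_def g_def by (simp add: ennreal_plus[symmetric] distrib_left ennreal_leI del: ennreal_plus)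
    then have "(ennreal (bracket k powr s * cmod (a k + b k)))\<^sup>2 \<le> (f k + g k + 0)\<^sup>2"
      by (rule power_mono) simp
    also have "\<dots> \<le> 3 * ((f k)\<^sup>2 + (g k)\<^sup>2)"
      using ennreal_sum3_square[of "f k" "g k" 0] by simp
    finally show "(ennreal (bracket k powr s * cmod (a k + b k)))\<^sup>2 \<le> 3 * ((f k)\<^sup>2 + (g k)\<^sup>2)" .
  qed
  also have "\<dots> = 3 * (nsum (\<lambda>k. (f k)\<^sup>2) + nsum (\<lambda>k. (g k)\<^sup>2))"
    by (simp add: nsum_cmult nsum_add)
  also have "\<dots> \<le> 3 * (ennreal (A\<^sup>2) + ennreal (B\<^sup>2))"
    using assms by (intro mult_left_mono add_mono) (auto simp: l2_weighted_def f_def g_def)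
  also have "\<dots> = ennreal (3 * (A\<^sup>2 + B\<^sup>2))" by (simp add: ennreal_mult ennreal_plus)
  also have "\<dots> \<le> ennreal ((2 * (A + B))\<^sup>2)"
    using nn mult_nonneg_nonneg[OF nn] by (intro ennreal_leI) (simp add: power2_eq_square algebra_simps)
  finally show ?thesis using nn by (simp add: l2_weighted_def)
qed

lemma l2_weighted_uminus: "l2_weighted s A (\<lambda>k. - a k) \<longleftrightarrow> l2_weighted s A a"
  by (simp add: l2_weighted_def)

text \<open>A loss of one derivative, falling on the output frequency \<open>k\<close> or on the
  frequency \<open>m\<close> of the quadratic factor, is common to all symbols considered
  below.\<close>

locale cubic_form =
  fixes sym :: "int \<Rightarrow> int \<Rightarrow> complex" and Ksym s :: real
  assumes cmod_sym_le: "cmod (sym k m) \<le> Ksym * (bracket k + \<bar>of_int m\<bar>)"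
    and Ksym_pos: "Ksym > 0" and s_ge_1: "s \<ge> 1"
begin

text \<open>
  The conjugated factor enters through the reflected sequence \<open>cnj (b (- j))\<close>, so that the sum runs
  over all \<open>i + j + l = k\<close> and is symmetric in the three frequencies.
\<close>

definition term3 where
  "term3 a b c k = (\<lambda>(i::int, j::int). sym k (i + j) * (a i * cnj (b (- j)) * c (k - i - j)))"

text \<open>The factor \<open>1 / (2 * pi)\<close> stems from two multiplications of functions, each
  costing \<open>1 / sqrt (2 * pi)\<close> in the unitary normalisation.\<close>

definition Tri :: "(int \<Rightarrow> complex) \<Rightarrow> (int \<Rightarrow> complex) \<Rightarrow> (int \<Rightarrow> complex) \<Rightarrow> int \<Rightarrow> complex" where
  "Tri a b c k = 1 / of_real (2 * pi) * csum (term3 a b c k)"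

text \<open>The largest of the three frequencies dominates both \<open>k\<close> and
  \<open>i + j\<close> up to a factor 3, so it can carry the weight \<open>s - 1\<close> together
  with the one derivative of the symbol. The sum of the three weights replaces their
  maximum.\<close>

lemma bracket_powr_sym_le:
  fixes i j l k :: int assumes "k = i + j + l"
  shows "bracket k powr (s - 1) * cmod (sym k (i + j))
    \<le> 2 * Ksym * 3 powr s * (bracket i powr s + bracket j powr s + bracket l powr s)"
proof -
  define M where "M = max (bracket i) (max (bracket j) (bracket l))"
  have M: "bracket i \<le> M" "bracket j \<le> M" "bracket l \<le> M" "M \<ge> 1"
    by (auto simp: M_def le_max_iff_disj)
  have k: "bracket k \<le> 3 * M"
    using bracket_add3_le[of i j l] M unfolding assms by simp
  have m: "\<bar>real_of_int (i + j)\<bar> \<le> 3 * M" using M by (simp add: bracket_def)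
  have "cmod (sym k (i + j)) \<le> Ksym * (bracket k + \<bar>of_int (i + j)\<bar>)"
    by (rule cmod_sym_le)
  also have "\<dots> \<le> Ksym * (3 * M + 3 * M)"
    using Ksym_pos k m by (intro mult_left_mono add_mono) auto
  finally have 1: "cmod (sym k (i + j)) \<le> 2 * Ksym * (3 * M)" by simp
  have "bracket k powr (s - 1) * cmod (sym k (i + j)) \<le> (3 * M) powr (s - 1) * (2 * Ksym * (3 * M))"
    using k s_ge_1 M by (intro mult_mono powr_mono2 1) auto
  also have "\<dots> = 2 * Ksym * ((3 * M) powr (s - 1) * (3 * M) powr 1)"
    using M by simp
  also have "\<dots> = 2 * Ksym * 3 powr s * M powr s"
    unfolding powr_add[symmetric] using M by (simp add: powr_mult)
  also have "\<dots> \<le> 2 * Ksym * 3 powr s * (bracket i powr s + bracket j powr s + bracket l powr s)"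
    using Ksym_pos by (intro mult_left_mono) (auto simp: M_def max_def)
  finally show ?thesis .
qed

lemma nsum_term3_le:
  "nsum (\<lambda>\<kappa>. ennreal (bracket k powr (s - 1) * cmod (term3 a b c k \<kappa>))) \<le>
    ennreal (2 * Ksym * 3 powr s) *
     (conv3 (wt s a) (\<lambda>j. ennreal (cmod (b (- j)))) (\<lambda>l. ennreal (cmod (c l))) k
    + conv3 (\<lambda>i. ennreal (cmod (a i))) (\<lambda>j. ennreal (bracket j powr s * cmod (b (- j)))) (\<lambda>l. ennreal (cmod (c l))) k
    + conv3 (\<lambda>i. ennreal (cmod (a i))) (\<lambda>j. ennreal (cmod (b (- j)))) (wt s c) k)"
proof -
  let ?K = "2 * Ksym * 3 powr s"
  have K: "?K \<ge> 0" using Ksym_pos by simp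
  have "ennreal (bracket k powr (s - 1) * cmod (term3 a b c k (i, j))) \<le>
    ennreal ?K * ((wt s a i) * ennreal (cmod (b (- j))) * ennreal (cmod (c (k - i - j)))
     + ennreal (cmod (a i)) * ennreal (bracket j powr s * cmod (b (- j))) * ennreal (cmod (c (k - i - j)))
     + ennreal (cmod (a i)) * ennreal (cmod (b (- j))) * ennreal (bracket (k - i - j) powr s * cmod (c (k - i - j))))" for i j
  proof -
    define l where "l = k - i - j"
    have k: "k = i + j + l" by (simp add: l_def)
    define P where "P = cmod (a i) * cmod (b (- j)) * cmod (c l)"
    have P: "P \<ge> 0" by (simp add: P_def)
    have "bracket k powr (s - 1) * cmod (term3 a b c k (i, j)) = bracket k powr (s - 1) * cmod (sym k (i + j)) * P"
      by (simp add: term3_def norm_mult P_def l_def mult_ac)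
    also have "\<dots> \<le> ?K * (bracket i powr s + bracket j powr s + bracket l powr s) * P"
      by (intro mult_right_mono bracket_powr_sym_le k P)
    finally have "ennreal (bracket k powr (s - 1) * cmod (term3 a b c k (i, j))) \<le>
      ennreal (?K * (bracket i powr s + bracket j powr s + bracket l powr s) * P)" by (rule ennreal_leI)
    also have "?K * (bracket i powr s + bracket j powr s + bracket l powr s) * P =
       ?K * (bracket i powr s * cmod (a i) * cmod (b (- j)) * cmod (c l)
       + cmod (a i) * (bracket j powr s * cmod (b (- j))) * cmod (c l)
       + cmod (a i) * cmod (b (- j)) * (bracket l powr s * cmod (c l)))"
      by (simp add: P_def algebra_simps)
    finally show ?thesis using K
      by (simp add: l_def ennreal_mult[symmetric] ennreal_plus[symmetric] del: ennreal_plus)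
  qed
  then have "nsum (\<lambda>i. nsum (\<lambda>j. ennreal (bracket k powr (s - 1) * cmod (term3 a b c k (i, j))))) \<le>
    nsum (\<lambda>i. nsum (\<lambda>j. ennreal ?K * ((wt s a i) * ennreal (cmod (b (- j))) * ennreal (cmod (c (k - i - j)))
     + ennreal (cmod (a i)) * ennreal (bracket j powr s * cmod (b (- j))) * ennreal (cmod (c (k - i - j)))
     + ennreal (cmod (a i)) * ennreal (cmod (b (- j))) * ennreal (bracket (k - i - j) powr s * cmod (c (k - i - j))))))"
    by (intro nsum_mono)
  then show ?thesis
    unfolding nsum_cmult nsum_add conv3_def nsum_pair[of "\<lambda>\<kappa>. ennreal (bracket k powr (s - 1) * cmod (term3 a b c k \<kappa>))"] .
qed

text \<open>The part \<open>2 * Ksym * 3 powr s\<close> comes from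
  \<open>bracket_powr_sym_le\<close>, the further 3 from squaring a sum of three terms, and each of
  the two summable factors costs one \<open>embed_const\<close>.\<close>

definition Ctri :: real where "Ctri = 6 * Ksym * 3 powr s * embed_const\<^sup>2"

lemma Ctri_nonneg: "Ctri \<ge> 0" using Ksym_pos by (simp add: Ctri_def)

text \<open>In each of the three summands one factor carries the full weight and stays in l2, the
  other two are absolutely summable by the embedding, and Young's inequality applies.\<close>

lemma nsum_term3_l2:
  assumes a: "l2_weighted s A a" and b: "l2_weighted s B b" and c: "l2_weighted s C c"
  shows "nsum (\<lambda>k. (nsum (\<lambda>\<kappa>. ennreal (bracket k powr (s - 1) * cmod (term3 a b c k \<kappa>))))\<^sup>2)
    \<le> ennreal ((Ctri * A * B * C)\<^sup>2)"
proof -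
  let ?E = embed_const
  define K where "K = 2 * Ksym * 3 powr s"
  have nn: "A \<ge> 0" "B \<ge> 0" "C \<ge> 0" "K \<ge> 0"
    using a b c Ksym_pos by (auto simp: l2_weighted_def K_def)
  have b': "l2_weighted s B (\<lambda>j. cnj (b (- j)))" using b by (simp add: l2_weighted_reflect)
  note l2 = a[unfolded l2_weighted_def] b'[unfolded l2_weighted_def complex_mod_cnj] c[unfolded l2_weighted_def]
  note l1 = l2_weighted_l1(2)[OF a s_ge_1] l2_weighted_l1(2)[OF b' s_ge_1, unfolded complex_mod_cnj]
    l2_weighted_l1(2)[OF c s_ge_1]
  let ?x = "conv3 (wt s a) (\<lambda>j. ennreal (cmod (b (- j)))) (\<lambda>l. ennreal (cmod (c l)))"
  let ?y = "conv3 (\<lambda>i. ennreal (cmod (a i))) (\<lambda>j. ennreal (bracket j powr s * cmod (b (- j)))) (\<lambda>l. ennreal (cmod (c l)))"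
  let ?z = "conv3 (\<lambda>i. ennreal (cmod (a i))) (\<lambda>j. ennreal (cmod (b (- j)))) (wt s c)"
  have x: "nsum (\<lambda>k. (?x k)\<^sup>2) \<le> ennreal ((A * (?E * B) * (?E * C))\<^sup>2)"
    using l2 l1 nn by (intro conv3_l2) auto
  have "nsum (\<lambda>k. (?y k)\<^sup>2) \<le> ennreal ((B * (?E * A) * (?E * C))\<^sup>2)"
    unfolding conv3_commute12[of "\<lambda>i. ennreal (cmod (a i))"] using l2 l1 nn by (intro conv3_l2) auto
  moreover have "nsum (\<lambda>k. (?z k)\<^sup>2) \<le> ennreal ((C * (?E * A) * (?E * B))\<^sup>2)"
  proof -
    have "?z k = conv3 (wt s c) (\<lambda>i. ennreal (cmod (a i))) (\<lambda>j. ennreal (cmod (b (- j)))) k" for k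
      by (metis conv3_commute12 conv3_commute23)
    then show ?thesis using l2 l1 nn by (simp, intro conv3_l2) auto
  qed
  moreover note x
  moreover define D where "D = A * B * C * ?E\<^sup>2"
  ultimately have D: "nsum (\<lambda>k. (?x k)\<^sup>2) \<le> ennreal (D\<^sup>2)" "nsum (\<lambda>k. (?y k)\<^sup>2) \<le> ennreal (D\<^sup>2)"
      "nsum (\<lambda>k. (?z k)\<^sup>2) \<le> ennreal (D\<^sup>2)"
    by (simp_all add: power2_eq_square mult_ac)
  have "(nsum (\<lambda>\<kappa>. ennreal (bracket k powr (s - 1) * cmod (term3 a b c k \<kappa>))))\<^sup>2
      \<le> ennreal (K\<^sup>2) * (3 * ((?x k)\<^sup>2 + (?y k)\<^sup>2 + (?z k)\<^sup>2))" for k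
  proof -
    have "(nsum (\<lambda>\<kappa>. ennreal (bracket k powr (s - 1) * cmod (term3 a b c k \<kappa>))))\<^sup>2
       \<le> (ennreal K * (?x k + ?y k + ?z k))\<^sup>2"
      unfolding K_def by (intro power_mono nsum_term3_le) auto
    also have "\<dots> = ennreal (K\<^sup>2) * (?x k + ?y k + ?z k)\<^sup>2"
      using nn by (simp add: power_mult_distrib ennreal_power)
    also have "\<dots> \<le> ennreal (K\<^sup>2) * (3 * ((?x k)\<^sup>2 + (?y k)\<^sup>2 + (?z k)\<^sup>2))"
      by (intro mult_left_mono ennreal_sum3_square) auto
    finally show ?thesis .
  qed
  then have "nsum (\<lambda>k. (nsum (\<lambda>\<kappa>. ennreal (bracket k powr (s - 1) * cmod (term3 a b c k \<kappa>))))\<^sup>2)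
    \<le> nsum (\<lambda>k. ennreal (K\<^sup>2) * (3 * ((?x k)\<^sup>2 + (?y k)\<^sup>2 + (?z k)\<^sup>2)))"
    by (intro nsum_mono)
  also have "\<dots> = ennreal (K\<^sup>2) * (3 * (nsum (\<lambda>k. (?x k)\<^sup>2) + nsum (\<lambda>k. (?y k)\<^sup>2) + nsum (\<lambda>k. (?z k)\<^sup>2)))"
    by (simp only: nsum_cmult nsum_add)
  also have "\<dots> \<le> ennreal (K\<^sup>2) * (3 * (ennreal (D\<^sup>2) + ennreal (D\<^sup>2) + ennreal (D\<^sup>2)))"
    by (intro mult_left_mono add_mono D) auto
  also have "ennreal (D\<^sup>2) + ennreal (D\<^sup>2) + ennreal (D\<^sup>2) = ennreal (D\<^sup>2 + D\<^sup>2 + D\<^sup>2)"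
    by (simp only: ennreal_plus zero_le_power2 add_nonneg_nonneg)
  also have "ennreal (K\<^sup>2) * (3 * ennreal (D\<^sup>2 + D\<^sup>2 + D\<^sup>2)) = ennreal (K\<^sup>2) * (ennreal 3 * ennreal (D\<^sup>2 + D\<^sup>2 + D\<^sup>2))"
    by simp
  also have "\<dots> = ennreal (K\<^sup>2 * (3 * (D\<^sup>2 + D\<^sup>2 + D\<^sup>2)))"
    by (simp only: ennreal_mult zero_le_power2 add_nonneg_nonneg zero_le_numeral mult_nonneg_nonneg)
  also have "K\<^sup>2 * (3 * (D\<^sup>2 + D\<^sup>2 + D\<^sup>2)) = (3 * K * D)\<^sup>2"
    by (simp add: power2_eq_square)
  also have "3 * K * D = Ctri * A * B * C"
    by (simp add: K_def D_def Ctri_def)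
  finally show ?thesis .
qed

lemma nsum_cmod_term3_le:
  assumes a: "l2_weighted s A a" and b: "l2_weighted s B b" and c: "l2_weighted s C c"
  shows "nsum (\<lambda>\<kappa>. ennreal (cmod (term3 a b c k \<kappa>))) \<le> ennreal (Ctri * A * B * C)"
proof -
  have nn: "A \<ge> 0" "B \<ge> 0" "C \<ge> 0"
    using a b c by (auto simp: l2_weighted_def)
  let ?S = "\<lambda>k. nsum (\<lambda>\<kappa>. ennreal (bracket k powr (s - 1) * cmod (term3 a b c k \<kappa>)))"
  have "(?S k)\<^sup>2 \<le> nsum (\<lambda>k. (?S k)\<^sup>2)"
    by (rule nn_integral_ge_point) auto
  with nsum_term3_l2[OF a b c] have "(?S k)\<^sup>2 \<le> ennreal ((Ctri * A * B * C)\<^sup>2)" by (rule order_trans[rotated])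
  then have S: "?S k \<le> ennreal (Ctri * A * B * C)"
    by (rule ennreal_le_of_square) (use nn Ctri_nonneg in simp)
  have "nsum (\<lambda>\<kappa>. ennreal (cmod (term3 a b c k \<kappa>))) \<le> ?S k"
    using s_ge_1 by (intro nsum_mono ennreal_leI le_bracket_powr_mult) auto
  with S show ?thesis by (rule order_trans[rotated])
qed

lemma
  assumes a: "l2_weighted s A a" and b: "l2_weighted s B b" and c: "l2_weighted s C c"
  shows csummable_term3: "csummable (term3 a b c k)"
    and l2_weighted_Tri: "l2_weighted (s - 1) (Ctri * A * B * C) (Tri a b c)"
proof -
  have nn: "A \<ge> 0" "B \<ge> 0" "C \<ge> 0"
    using a b c by (auto simp: l2_weighted_def)
  let ?S = "\<lambda>k. nsum (\<lambda>\<kappa>. ennreal (bracket k powr (s - 1) * cmod (term3 a b c k \<kappa>)))"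
  note * = nsum_term3_l2[OF a b c]
  show "csummable (term3 a b c k)" by (rule csummableI[OF nsum_cmod_term3_le[OF a b c]])
  have "ennreal (bracket k powr (s - 1) * cmod (Tri a b c k)) \<le> ?S k" for k
  proof -
    have "cmod (Tri a b c k) \<le> 1 * cmod (csum (term3 a b c k))"
      unfolding Tri_def norm_mult using pi_gt3 by (intro mult_right_mono) (auto simp: norm_divide)
    then have "ennreal (bracket k powr (s - 1) * cmod (Tri a b c k)) \<le>
      ennreal (bracket k powr (s - 1) * cmod (csum (term3 a b c k)))"
      by (intro ennreal_leI mult_left_mono) auto
    also have "\<dots> \<le> ennreal (bracket k powr (s - 1)) * nsum (\<lambda>\<kappa>. ennreal (cmod (term3 a b c k \<kappa>)))"
      by (subst ennreal_mult) (auto intro!: mult_left_mono cmod_csum_le)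
    also have "\<dots> = ?S k"
      by (subst nsum_cmult[symmetric]) (simp add: ennreal_mult)
    finally show ?thesis .
  qed
  then have "nsum (\<lambda>k. (ennreal (bracket k powr (s - 1) * cmod (Tri a b c k)))\<^sup>2) \<le> nsum (\<lambda>k. (?S k)\<^sup>2)"
    by (intro nsum_mono power_mono) auto
  then show "l2_weighted (s - 1) (Ctri * A * B * C) (Tri a b c)"
    unfolding l2_weighted_def using nn Ctri_nonneg * by (auto intro: order_trans)
qed

text \<open>Telescoping, with one argument exchanged at a time. It makes \<open>Tri\<close>
  Lipschitz on bounded sets, hence continuous along solutions.\<close>

lemma Tri_diff:
  assumes a: "l2_weighted s A a" and b: "l2_weighted s B b"
  shows "Tri a a a k - Tri b b b k =
    Tri (\<lambda>i. a i - b i) a a k + Tri b (\<lambda>i. a i - b i) a k + Tri b b (\<lambda>i. a i - b i) k"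
proof -
  have d: "l2_weighted s (2 * (A + B)) (\<lambda>i. a i - b i)"
    using l2_weighted_add[OF a, of B "\<lambda>i. - b i"] b by (simp add: l2_weighted_uminus)
  define t0 t1 t2 t3 where "t0 = term3 b b b k" and "t1 = term3 (\<lambda>i. a i - b i) a a k"
    and "t2 = term3 b (\<lambda>i. a i - b i) a k" and "t3 = term3 b b (\<lambda>i. a i - b i) k"
  have int: "csummable t0" "csummable t1" "csummable t2" "csummable t3"
    unfolding t0_def t1_def t2_def t3_def
    by (rule csummable_term3[OF b b b] csummable_term3[OF d a a] csummable_term3[OF b d a] csummable_term3[OF b b d])+
  have "term3 a a a k = (\<lambda>\<kappa>. t0 \<kappa> + (t1 \<kappa> + t2 \<kappa> + t3 \<kappa>))"
    by (auto simp: t0_def t1_def t2_def t3_def term3_def algebra_simps)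
  then have "csum (term3 a a a k) = csum t0 + (csum t1 + csum t2 + csum t3)"
    using int by simp
  then have "csum (term3 a a a k) - csum t0 = csum t1 + csum t2 + csum t3" by simp
  then show ?thesis
    unfolding Tri_def t0_def[symmetric] t1_def[symmetric] t2_def[symmetric] t3_def[symmetric]
    by (simp only: distrib_left[symmetric] right_diff_distrib[symmetric])
qed

lemma continuous_on_Tri:
  assumes a: "\<And>t. t \<in> S \<Longrightarrow> l2_weighted s R (a t)"
    and d: "\<And>t. t \<in> S \<Longrightarrow> l2_weighted s (sobolev_seq_norm s (\<lambda>i. a t i - a t' i)) (\<lambda>i. a t i - a t' i)"
    and lim: "((\<lambda>t. sobolev_seq_norm s (\<lambda>i. a t i - a t' i)) \<longlongrightarrow> 0) (at t' within S)"
    and t': "t' \<in> S"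
  shows "((\<lambda>t. Tri (a t) (a t) (a t) k) \<longlongrightarrow> Tri (a t') (a t') (a t') k) (at t' within S)"
proof -
  define N where "N t = sobolev_seq_norm s (\<lambda>i. a t i - a t' i)" for t
  have *: "cmod (Tri x y z k) \<le> Ctri * A * B * C"
    if "l2_weighted s A x" "l2_weighted s B y" "l2_weighted s C z" for A B C x y z
    using s_ge_1 by (intro l2_weighted_norm_le[OF l2_weighted_Tri[OF that]]) simp
  have "cmod (Tri (a t) (a t) (a t) k - Tri (a t') (a t') (a t') k) \<le> 3 * Ctri * R\<^sup>2 * N t" if t: "t \<in> S" for t
  proof -
    note d' = d[OF t, folded N_def] and at = a[OF t] and at' = a[OF t']
    have "cmod (Tri (a t) (a t) (a t) k - Tri (a t') (a t') (a t') k) \<le>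
       Ctri * N t * R * R + Ctri * R * N t * R + Ctri * R * R * N t"
      unfolding Tri_diff[OF at at']
      by (intro order_trans[OF norm_triangle_ineq] add_mono *[OF d' at at] *[OF at' d' at] *[OF at' at' d'])
    then show ?thesis by (simp add: power2_eq_square mult_ac)
  qed
  then have "eventually (\<lambda>t. cmod (Tri (a t) (a t) (a t) k - Tri (a t') (a t') (a t') k) \<le> 3 * Ctri * R\<^sup>2 * N t) (at t' within S)"
    by (auto simp: eventually_at_filter)
  moreover have "((\<lambda>t. 3 * Ctri * R\<^sup>2 * N t) \<longlongrightarrow> 0) (at t' within S)"
    using tendsto_mult_left[OF lim, of "3 * Ctri * R\<^sup>2"] by (simp add: N_def)
  ultimately have "((\<lambda>t. Tri (a t) (a t) (a t) k - Tri (a t') (a t') (a t') k) \<longlongrightarrow> 0) (at t' within S)"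
    by (rule Lim_null_comparison)
  then show ?thesis by (simp add: Lim_null[symmetric])
qed

end

section \<open>Test functions\<close>

text \<open>
  This family is closed under differentiation, and \<open>flat 0 (n * (T - t))\<close> increases to the indicator
  of \<open>t < T\<close> as \<open>n\<close> grows; hence no compactly supported bump functions are needed to turn the weak
  formulation into integral equations.
\<close>

definition flat :: "nat \<Rightarrow> real \<Rightarrow> real" where
  "flat j y = (if y > 0 then inverse y ^ j * exp (- inverse y) else 0)"

lemma flat_nonpos [simp]: "y \<le> 0 \<Longrightarrow> flat j y = 0"
  by (simp add: flat_def)

lemma flat_nonneg: "flat j y \<ge> 0"
  by (simp add: flat_def)

lemma tendsto_flat_0: "(flat j \<longlongrightarrow> 0) (at 0)"
proof (rule filterlim_split_at)
  show "(flat j \<longlongrightarrow> 0) (at_left 0)"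
    by (rule tendsto_eventually) (auto simp: eventually_at_filter)
  have "((\<lambda>x. x ^ j / exp x) \<longlongrightarrow> 0) (at_top :: real filter)"
    by (rule tendsto_power_div_exp_0)
  then have "((\<lambda>y. inverse y ^ j / exp (inverse y)) \<longlongrightarrow> (0::real)) (at_right 0)"
    by (rule filterlim_compose[OF _ filterlim_inverse_at_top_right])
  moreover have "eventually (\<lambda>y. inverse y ^ j / exp (inverse y) = flat j y) (at_right (0::real))"
    by (auto simp: eventually_at_filter flat_def exp_minus divide_inverse)
  ultimately show "(flat j \<longlongrightarrow> 0) (at_right 0)"
    by (rule Lim_transform_eventually)
qed

lemma flat_has_derivative:
  "(flat j has_real_derivative (flat (j + 2) y - real j * flat (j + 1) y)) (at y)"
proof -
  consider "y < 0" | "y = 0" | "y > 0" by linarith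
  then show ?thesis
  proof cases
    case 1
    have "((\<lambda>_. 0) has_real_derivative 0) (at y)" by simp
    moreover have "eventually (\<lambda>z. 0 = flat j z) (nhds y)"
      using eventually_nhds_in_open[of "{..<0}" y] 1 by (auto elim!: eventually_mono)
    ultimately have "(flat j has_real_derivative 0) (at y)"
      using DERIV_cong_ev[OF refl _ refl, of "\<lambda>_. 0" "flat j" y 0] by blast
    then show ?thesis using 1 by simp
  next
    case 2
    \<comment> \<open>At 0 the difference quotient is exactly the next member of the family, which
      tends to 0 there.\<close>
    have "(flat j (0 + h) - flat j 0) / h = flat (j + 1) h" for h
      by (simp add: flat_def divide_inverse)
    then have "((\<lambda>h. (flat j (0 + h) - flat j 0) / h) \<longlongrightarrow> 0) (at 0)"
      using tendsto_flat_0[of "j + 1"] by simp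
    then show ?thesis using 2 by (simp add: DERIV_def)
  next
    case 3
    have "((\<lambda>y. inverse y ^ j * exp (- inverse y)) has_real_derivative
       (flat (j + 2) y - real j * flat (j + 1) y)) (at y)"
      using 3
      by (auto intro!: derivative_eq_intros simp: flat_def)
        (cases j; simp add: power2_eq_square algebra_simps)
    moreover have ev: "eventually (\<lambda>z. inverse z ^ j * exp (- inverse z) = flat j z) (nhds y)"
      using eventually_nhds_in_open[of "{0<..}" y] 3 by (auto elim!: eventually_mono simp: flat_def)
    ultimately show ?thesis
      using DERIV_cong_ev[OF refl ev refl] by blast
  qed
qed

lemma flat_0_le_1: "flat 0 y \<le> 1"
  by (simp add: flat_def)

lemma tendsto_flat_0_at_top: "y > 0 \<Longrightarrow> (\<lambda>n. flat 0 (real n * y)) \<longlonglongrightarrow> 1"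
proof -
  assume y: "y > 0"
  have "filterlim (\<lambda>n. real n * y) at_top sequentially"
    using filterlim_tendsto_pos_mult_at_top[OF tendsto_const y filterlim_real_sequentially]
    by (simp add: mult.commute)
  then have "(\<lambda>n. exp (- inverse (real n * y))) \<longlonglongrightarrow> exp (- 0)"
    by (intro tendsto_intros tendsto_inverse_0_at_top)
  moreover have "eventually (\<lambda>n. exp (- inverse (real n * y)) = flat 0 (real n * y)) sequentially"
    using eventually_gt_at_top[of 0] by eventually_elim (use y in \<open>simp add: flat_def\<close>)
  ultimately show ?thesis
    using Lim_transform_eventually by fastforce
qed

section \<open>One-sided time derivatives and smooth test functions\<close>

lemma at_within_nonneg_not_bot: "t \<ge> 0 \<Longrightarrow> at t within {0..} \<noteq> (bot :: real filter)"
proof -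
  assume "t \<ge> 0"
  then have "at_right t \<le> at t within {0..}" by (intro at_le) auto
  then show ?thesis using trivial_limit_at_right_real[of t] by (metis bot.extremum_unique)
qed

lemma dt_eqI:
  assumes "((\<lambda>t. \<phi> t x) has_vector_derivative d) (at t within {0..})" "t \<ge> 0"
  shows "dt \<phi> t x = d"
  unfolding dt_def using assms by (intro vector_derivative_within at_within_nonneg_not_bot)

lemma dt_cong:
  assumes "\<And>t. t \<ge> 0 \<Longrightarrow> \<phi> t x = \<psi> t x" "t \<ge> 0" shows "dt \<phi> t x = dt \<psi> t x"
proof -
  have "((\<lambda>t. \<phi> t x) has_vector_derivative d) (at t within {0..}) \<longleftrightarrow>
     ((\<lambda>t. \<psi> t x) has_vector_derivative d) (at t within {0..})" for d
    by (rule has_vector_derivative_cong_ev) (use assms in auto)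
  then show ?thesis by (simp add: dt_def vector_derivative_def)
qed

text \<open>At negative times the derivative within \<open>{0..}\<close> that defines
  \<open>dt\<close> has an unspecified value, so identities between derivatives are available for
  \<open>t >= 0\<close> only, and smoothness has to be transferred along such identities.\<close>

lemma Ck_cong:
  assumes "Ck n \<phi>" "\<And>t x. t \<ge> 0 \<Longrightarrow> \<phi> t x = \<psi> t x" shows "Ck n \<psi>"
  using assms
proof (induction n arbitrary: \<phi> \<psi>)
  case 0
  have "continuous_on ({0..} \<times> UNIV) (\<lambda>(t, x). \<psi> t x) \<longleftrightarrow> continuous_on ({0..} \<times> UNIV) (\<lambda>(t, x). \<phi> t x)"
    by (rule continuous_on_cong) (use 0 in auto)
  with 0 show ?case by simp
next
  case (Suc n)
  have x: "\<psi> t = \<phi> t" if "t \<ge> 0" for t using Suc.prems(2) that by auto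
  have "(\<lambda>t'. \<psi> t' x) differentiable (at t within {0..})" if "t \<ge> 0" for t x
    using Suc.prems that
    by (intro differentiable_transform_within[of "\<lambda>t'. \<phi> t' x" t "{0..}" 1 "\<lambda>t'. \<psi> t' x"]) auto
  moreover have "Ck n (dt \<psi>)"
  proof (rule Suc.IH[of "dt \<phi>"])
    show "Ck n (dt \<phi>)" using Suc.prems by simp
    show "dt \<phi> t z = dt \<psi> t z" if "t \<ge> 0" for t z using Suc.prems(2) that by (rule dt_cong)
  qed
  moreover have "Ck n (dx \<psi>)"
  proof (rule Suc.IH[of "dx \<phi>"])
    show "Ck n (dx \<phi>)" using Suc.prems by simp
    show "dx \<phi> t z = dx \<psi> t z" if "t \<ge> 0" for t z using x[OF that] by (simp add: dx_def)
  qed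
  ultimately show ?case using Suc.prems x by auto
qed

lemma Ck_add:
  assumes "Ck n \<phi>" "Ck n \<psi>" shows "Ck n (\<lambda>t x. \<phi> t x + \<psi> t x)"
  using assms
proof (induction n arbitrary: \<phi> \<psi>)
  case 0
  then show ?case by (auto simp: case_prod_unfold intro!: continuous_intros)
next
  case (Suc n)
  have *: "dt (\<lambda>t x. \<phi> t x + \<psi> t x) t x = dt \<phi> t x + dt \<psi> t x" if "t \<ge> 0" for t x
    using Suc.prems that unfolding dt_def[of \<phi>] dt_def[of \<psi>]
    by (intro dt_eqI has_vector_derivative_add) (auto simp: vector_derivative_works)
  have **: "dx (\<lambda>t x. \<phi> t x + \<psi> t x) t x = dx \<phi> t x + dx \<psi> t x" if "t \<ge> 0" for t x
    using Suc.prems that unfolding dx_def by (intro vector_derivative_add_at) auto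
  have "Ck n (dt (\<lambda>t x. \<phi> t x + \<psi> t x))"
    by (rule Ck_cong[OF Suc.IH[of "dt \<phi>" "dt \<psi>"]]) (use Suc.prems * in auto)
  moreover have "Ck n (dx (\<lambda>t x. \<phi> t x + \<psi> t x))"
    by (rule Ck_cong[OF Suc.IH[of "dx \<phi>" "dx \<psi>"]]) (use Suc.prems ** in auto)
  ultimately show ?case using Suc.prems by (auto intro: differentiable_add)
qed

definition wave :: "complex \<Rightarrow> nat \<Rightarrow> real \<Rightarrow> real \<Rightarrow> int \<Rightarrow> real \<Rightarrow> real \<Rightarrow> complex" where
  "wave c j r T m t x = c * of_real (flat j (r * (T - t))) * cis (of_int m * x)"

lemma wave_dt:
  "((\<lambda>t. wave c j r T m t x) has_vector_derivative
    wave (- of_real r * c) (j + 2) r T m t x + wave (of_real (r * real j) * c) (j + 1) r T m t x) (at t within S)"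
proof -
  have "((\<lambda>t. flat j (r * (T - t))) has_real_derivative
     (flat (j + 2) (r * (T - t)) - real j * flat (j + 1) (r * (T - t))) * (- r)) (at t within S)"
    by (rule DERIV_chain2[OF flat_has_derivative]) (auto intro!: derivative_eq_intros)
  then have "((\<lambda>t. c * of_real (flat j (r * (T - t))) * cis (of_int m * x)) has_vector_derivative
    c * of_real ((flat (j + 2) (r * (T - t)) - real j * flat (j + 1) (r * (T - t))) * (- r)) * cis (of_int m * x)) (at t within S)"
    by (intro has_vector_derivative_mult_left has_vector_derivative_mult_right has_vector_derivative_of_real; assumption?)
  then show ?thesis unfolding wave_def
    by (rule has_vector_derivative_eq_rhs) (simp add: algebra_simps)
qed

lemma wave_dx: "(wave c j r T m t has_vector_derivative wave (\<i> * of_int m * c) j r T m t x) (at x within S)"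
  using has_vector_derivative_mult_right[OF has_vector_derivative_cis[of "of_int m" x S], of "c * of_real (flat j (r * (T - t)))"]
  unfolding wave_def[abs_def] by (simp add: mult_ac)

text \<open>A time derivative yields two waves of higher index, a space derivative one wave with
  another coefficient; hence the induction on the order runs over all \<open>c\<close> and
  \<open>j\<close> at once.\<close>

lemma Ck_wave: "Ck n (wave c j r T m)"
proof (induction n arbitrary: c j)
  case 0
  have "isCont (flat j) y" for y by (rule DERIV_isCont[OF flat_has_derivative])
  then have cf: "continuous_on UNIV (flat j)" by (simp add: continuous_at_imp_continuous_on)
  have "continuous_on ({0..} \<times> UNIV) (\<lambda>p. c * of_real (flat j (r * (T - fst p))) * cis (of_int m * snd p))"
    by (intro continuous_intros continuous_on_compose2[OF cf] continuous_on_cis subset_UNIV)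
  then show ?case by (simp add: wave_def case_prod_unfold)
next
  case (Suc n)
  have "Ck n (dt (wave c j r T m))"
    by (rule Ck_cong[OF Ck_add[OF Suc.IH[of "- of_real r * c" "j + 2"] Suc.IH[of "of_real (r * real j) * c" "j + 1"]]])
      (rule dt_eqI[OF wave_dt, symmetric])
  moreover have "dx (wave c j r T m) = wave (\<i> * of_int m * c) j r T m"
    unfolding dx_def by (intro ext vector_derivative_at wave_dx)
  ultimately show ?case
    using Suc.IH by (auto intro: differentiableI_vector[OF wave_dt] differentiableI_vector[OF wave_dx])
qed

lemma dx_wave: "dx (wave c j r T m) = wave (\<i> * of_int m * c) j r T m"
  unfolding dx_def by (intro ext vector_derivative_at wave_dx)

lemma test_function_wave:
  assumes "r > 0" "T' < T" shows "test_function T (wave c j r T' m)"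
  unfolding test_function_def
proof (intro conjI allI impI exI[of _ T'] Ck_wave assms(2))
  fix t x :: real
  show "periodic (wave c j r T' m t)"
    by (simp add: periodic_def wave_def cis_period)
  show "wave c j r T' m t x = 0" if "T' \<le> t"
    using that assms(1) by (simp add: wave_def mult_nonneg_nonpos)
qed

section \<open>From the weak formulation to integral equations\<close>

lemma integral_flat_mollifier:
  assumes T: "T > 0" and n: "n > 0" and ab: "a \<le> b"
  shows "((\<lambda>t. n * flat 2 (n * (T - t))) has_integral flat 0 (n * (T - a)) - flat 0 (n * (T - b))) {a..b}"
proof (rule has_integral_eq_rhs[OF fundamental_theorem_of_calculus[OF ab]])
  \<comment> \<open>As \<open>flat 2\<close> is the derivative of \<open>flat 0\<close>, the kernel
    is an approximate identity with an explicit antiderivative: it is nonnegative, and in the limit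
    all its mass sits at \<open>T\<close>.\<close>
  show "((\<lambda>t. - flat 0 (n * (T - t))) has_vector_derivative n * flat 2 (n * (T - t))) (at t within {a..b})" for t
    unfolding has_real_derivative_iff_has_vector_derivative[symmetric]
    by (rule DERIV_cong[OF DERIV_minus[OF DERIV_chain2[OF flat_has_derivative, of "\<lambda>t. n * (T - t)"]]])
      (auto intro!: derivative_eq_intros simp: numeral_2_eq_2)
qed simp

lemma continuous_on_flat [continuous_intros]:
  "continuous_on S g \<Longrightarrow> continuous_on S (\<lambda>t. flat j (g t))"
proof -
  have "isCont (flat j) y" for y by (rule DERIV_isCont[OF flat_has_derivative])
  then have "continuous_on UNIV (flat j)" by (simp add: continuous_at_imp_continuous_on)
  then show "continuous_on S g \<Longrightarrow> continuous_on S (\<lambda>t. flat j (g t))"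
    by (rule continuous_on_compose2) auto
qed

lemma tendsto_flat_integral:
  fixes F :: "real \<Rightarrow> complex"
  assumes T: "T > 0" and F: "continuous_on {0..T} F"
  shows "(\<lambda>n. integral {0..T} (\<lambda>t. (real n * flat 2 (real n * (T - t))) *\<^sub>R F t)) \<longlonglongrightarrow> F T"
proof -
  have bdd: "bounded (F ` {0..T})"
    using F by (intro compact_imp_bounded compact_continuous_image) auto
  then obtain B where B: "\<And>t. t \<in> {0..T} \<Longrightarrow> cmod (F t) \<le> B" and B0: "B > 0"
    using bounded_pos by (metis imageI)
  define w where "w n t = real n * flat 2 (real n * (T - t))" for n t
  have w0: "w n t \<ge> 0" for n t by (simp add: w_def flat_nonneg)
  have cw: "continuous_on S (w n)" for S n unfolding w_def by (intro continuous_intros)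
  have iw: "(w n has_integral flat 0 (real n * (T - a)) - flat 0 (real n * (T - b))) {a..b}"
    if "a \<le> b" "n > 0" for a b n
    unfolding w_def using integral_flat_mollifier[OF T, of "real n" a b] that by simp
  have "(\<lambda>n. integral {0..T} (\<lambda>t. w n t *\<^sub>R (F t - F T))) \<longlonglongrightarrow> 0"
  proof (rule LIMSEQ_I)
    fix e :: real assume e: "e > 0"
    obtain d where d: "d > 0" "\<And>t. t \<in> {0..T} \<Longrightarrow> dist t T < d \<Longrightarrow> dist (F t) (F T) < e / 2"
      using F T e unfolding continuous_on_iff by (metis atLeastAtMost_iff half_gt_zero less_eq_real_def)
    \<comment> \<open>Halving \<open>d\<close> puts the closed interval \<open>{c..T}\<close> inside
      the \<open>d\<close>-neighbourhood of \<open>T\<close>, and \<open>max\<close> keeps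
      \<open>c\<close> nonnegative when \<open>d\<close> is large.\<close>
    define c where "c = max 0 (T - d / 2)"
    have c: "0 \<le> c" "c < T" and cd: "\<And>t. t \<in> {c..T} \<Longrightarrow> dist t T < d"
      using d(1) T by (auto simp: c_def dist_real_def)
    \<comment> \<open>The mass of the kernel on \<open>{0..c}\<close> is a difference of two values
      of the cut-off that both tend to 1.\<close>
    have "(\<lambda>n. 2 * B * (flat 0 (real n * (T - 0)) - flat 0 (real n * (T - c)))) \<longlonglongrightarrow> 2 * B * (1 - 1)"
      using c T by (intro tendsto_intros tendsto_flat_0_at_top) auto
    then have "eventually (\<lambda>n. 2 * B * (flat 0 (real n * (T - 0)) - flat 0 (real n * (T - c))) < e / 2) sequentially"
      by (rule order_tendstoD) (use e in simp)
    then have "eventually (\<lambda>n. norm (integral {0..T} (\<lambda>t. w n t *\<^sub>R (F t - F T))) < e) sequentially"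
      using eventually_gt_at_top[of 0]
    proof eventually_elim
      case (elim n)
      have int: "(\<lambda>t. w n t *\<^sub>R (F t - F T)) integrable_on {a..b}" if "{a..b} \<subseteq> {0..T}" for a b
        by (intro integrable_continuous_interval continuous_intros cw continuous_on_subset[OF F that])
      have "norm (integral {0..c} (\<lambda>t. w n t *\<^sub>R (F t - F T))) \<le> integral {0..c} (\<lambda>t. 2 * B * w n t)"
      proof (rule integral_norm_bound_integral)
        show "norm (w n t *\<^sub>R (F t - F T)) \<le> 2 * B * w n t" if "t \<in> {0..c}" for t
        proof -
          have "cmod (F t - F T) \<le> B + B"
            using that c T by (intro order_trans[OF norm_triangle_ineq4] add_mono B) auto
          then show ?thesis using mult_left_mono[OF _ w0, of "cmod (F t - F T)" "B + B" n t] by (simp add: w0 mult_ac)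
        qed
        show "(\<lambda>t. 2 * B * w n t) integrable_on {0..c}"
          by (intro integrable_continuous_interval continuous_intros cw)
      qed (use int c in auto)
      also have "\<dots> = 2 * B * (flat 0 (real n * (T - 0)) - flat 0 (real n * (T - c)))"
        using integral_unique[OF iw[OF c(1) elim(2)]] by simp
      finally have 1: "norm (integral {0..c} (\<lambda>t. w n t *\<^sub>R (F t - F T))) < e / 2" using elim by simp
      have "norm (integral {c..T} (\<lambda>t. w n t *\<^sub>R (F t - F T))) \<le> integral {c..T} (\<lambda>t. e / 2 * w n t)"
      proof (rule integral_norm_bound_integral)
        show "norm (w n t *\<^sub>R (F t - F T)) \<le> e / 2 * w n t" if "t \<in> {c..T}" for t
        proof -
          have "cmod (F t - F T) \<le> e / 2"
            using d(2)[of t] cd[OF that] that c by (simp add: dist_norm)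
          then show ?thesis using mult_left_mono[OF _ w0, of "cmod (F t - F T)" "e / 2" n t] by (simp add: w0 mult_ac)
        qed
        show "(\<lambda>t. e / 2 * w n t) integrable_on {c..T}"
          by (intro integrable_continuous_interval continuous_intros cw)
      qed (use int c in auto)
      also have "\<dots> = e / 2 * flat 0 (real n * (T - c))"
        using integral_unique[OF iw[of c T n]] c elim(2) by simp
      also have "\<dots> \<le> e / 2" using flat_0_le_1 e by (simp add: mult_left_le)
      finally have 2: "norm (integral {c..T} (\<lambda>t. w n t *\<^sub>R (F t - F T))) \<le> e / 2" .
      have "integral {0..T} (\<lambda>t. w n t *\<^sub>R (F t - F T)) =
          integral {0..c} (\<lambda>t. w n t *\<^sub>R (F t - F T)) + integral {c..T} (\<lambda>t. w n t *\<^sub>R (F t - F T))"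
        using c int by (intro Henstock_Kurzweil_Integration.integral_combine[symmetric]) auto
      then show ?case using 1 2 norm_triangle_ineq
        by (smt (verit) field_sum_of_halves)
    qed
    then show "\<exists>no. \<forall>n\<ge>no. norm (integral {0..T} (\<lambda>t. w n t *\<^sub>R (F t - F T)) - 0) < e"
      by (simp add: eventually_sequentially)
  qed
  moreover have "(\<lambda>n. flat 0 (real n * T) *\<^sub>R F T) \<longlonglongrightarrow> 1 *\<^sub>R F T"
    by (intro tendsto_intros tendsto_flat_0_at_top T)
  ultimately have "(\<lambda>n. integral {0..T} (\<lambda>t. w n t *\<^sub>R (F t - F T)) + flat 0 (real n * T) *\<^sub>R F T) \<longlonglongrightarrow> 0 + 1 *\<^sub>R F T"
    by (rule tendsto_add)
  moreover have "eventually (\<lambda>n. integral {0..T} (\<lambda>t. w n t *\<^sub>R (F t - F T)) + flat 0 (real n * T) *\<^sub>R F T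
     = integral {0..T} (\<lambda>t. w n t *\<^sub>R F t)) sequentially"
    using eventually_gt_at_top[of 0]
  proof eventually_elim
    case (elim n)
    have "integral {0..T} (\<lambda>t. w n t *\<^sub>R (F t - F T)) = integral {0..T} (\<lambda>t. w n t *\<^sub>R F t - w n t *\<^sub>R F T)"
      by (simp add: scaleR_diff_right)
    also have "\<dots> = integral {0..T} (\<lambda>t. w n t *\<^sub>R F t) - integral {0..T} (\<lambda>t. w n t *\<^sub>R F T)"
      by (intro Henstock_Kurzweil_Integration.integral_diff integrable_continuous_interval continuous_intros cw F)
    also have "integral {0..T} (\<lambda>t. w n t *\<^sub>R F T) = flat 0 (real n * T) *\<^sub>R F T"
      using has_integral_scaleR_left[OF iw[of 0 T n], of "F T"] T elim by (intro integral_unique) simp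
    finally show ?case by simp
  qed
  ultimately show ?thesis unfolding w_def by (simp add: tendsto_cong)
qed

lemma tendsto_flat_0_integral:
  fixes G :: "real \<Rightarrow> complex"
  assumes T: "T > 0" and G: "continuous_on {0..T} G"
  shows "(\<lambda>n. integral {0..T} (\<lambda>t. flat 0 (real n * (T - t)) *\<^sub>R G t)) \<longlonglongrightarrow> integral {0..T} G"
proof -
  have "(\<lambda>n. integral {0..T} (\<lambda>t. flat 0 (real n * (T - t)) *\<^sub>R G t)) \<longlonglongrightarrow>
      integral {0..T} (\<lambda>t. if t < T then G t else 0)"
  proof (rule dominated_convergence(2))
    show "(\<lambda>t. flat 0 (real n * (T - t)) *\<^sub>R G t) integrable_on {0..T}" for n
      by (intro integrable_continuous_interval continuous_intros G)
    show "(\<lambda>t. cmod (G t)) integrable_on {0..T}"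
      by (intro integrable_continuous_interval continuous_intros G)
    show "norm (flat 0 (real n * (T - t)) *\<^sub>R G t) \<le> cmod (G t)" for n t
      using flat_0_le_1 flat_nonneg by (simp add: mult_left_le_one_le)
    show "(\<lambda>n. flat 0 (real n * (T - t)) *\<^sub>R G t) \<longlonglongrightarrow> (if t < T then G t else 0)" if "t \<in> {0..T}" for t
    proof (cases "t < T")
      case True
      then have "(\<lambda>n. flat 0 (real n * (T - t)) *\<^sub>R G t) \<longlonglongrightarrow> 1 *\<^sub>R G t"
        by (intro tendsto_intros tendsto_flat_0_at_top) auto
      then show ?thesis using True by simp
    qed (use that in simp)
  qed
  \<comment> \<open>At \<open>t = T\<close> the limit is 0 because \<open>flat 0 0 = 0\<close>; a
    single point is negligible.\<close>
  also have "integral {0..T} (\<lambda>t. if t < T then G t else 0) = integral {0..T} G"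
    by (rule integral_spike[of "{T}"]) auto
  finally show ?thesis .
qed

text \<open>Hypothesis \<open>eq\<close> is a weak equation tested with the cut-off
  \<open>flat 0 (n * (T - t))\<close>. As \<open>n\<close> grows, the derivative of the cut-off
  concentrates at \<open>T\<close>, while the cut-off itself tends to 1 before
  \<open>T\<close>.\<close>

lemma weak_imp_integral_equation:
  fixes F G :: "real \<Rightarrow> complex"
  assumes T: "T > 0" and F: "continuous_on {0..T} F" and G: "continuous_on {0..T} G"
    and eq: "\<And>n::nat. n > 0 \<Longrightarrow> integral {0..T} (\<lambda>t. (real n * flat 2 (real n * (T - t))) *\<^sub>R F t) - flat 0 (real n * T) *\<^sub>R F 0
       = integral {0..T} (\<lambda>t. flat 0 (real n * (T - t)) *\<^sub>R G t)"
  shows "F T = F 0 + integral {0..T} G"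
proof -
  have "(\<lambda>n. integral {0..T} (\<lambda>t. (real n * flat 2 (real n * (T - t))) *\<^sub>R F t) - flat 0 (real n * T) *\<^sub>R F 0)
     \<longlonglongrightarrow> F T - 1 *\<^sub>R F 0"
    by (intro tendsto_intros tendsto_flat_integral tendsto_flat_0_at_top T F)
  moreover have "eventually (\<lambda>n. integral {0..T} (\<lambda>t. (real n * flat 2 (real n * (T - t))) *\<^sub>R F t) - flat 0 (real n * T) *\<^sub>R F 0
       = integral {0..T} (\<lambda>t. flat 0 (real n * (T - t)) *\<^sub>R G t)) sequentially"
    using eventually_gt_at_top[of 0] by eventually_elim (rule eq)
  ultimately have "(\<lambda>n. integral {0..T} (\<lambda>t. flat 0 (real n * (T - t)) *\<^sub>R G t)) \<longlonglongrightarrow> F T - 1 *\<^sub>R F 0"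
    by (rule Lim_transform_eventually)
  with tendsto_flat_0_integral[OF T G] have "F T - 1 *\<^sub>R F 0 = integral {0..T} G"
    using LIMSEQ_unique by blast
  then show ?thesis by (simp add: algebra_simps)
qed

lemma LINT_halfopen_eq_integral:
  fixes f :: "real \<Rightarrow> complex"
  assumes "0 < T'" "T' < T" "continuous_on {0..T'} g" "\<And>t. 0 \<le> t \<Longrightarrow> t \<le> T' \<Longrightarrow> f t = g t"
    and "\<And>t. T' < t \<Longrightarrow> t < T \<Longrightarrow> f t = 0"
  shows "(LINT t|lebesgue_on {0..<T}. f t) = integral {0..T'} g"
proof -
  have "(LINT t|lebesgue_on {0..<T}. f t) = (LINT t|lebesgue. indicat_real {0..<T} t *\<^sub>R f t)"
    by (rule integral_restrict_space) auto
  also have "\<dots> = (LINT t|lebesgue. indicat_real {0..T'} t *\<^sub>R g t)"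
    using assms by (intro Bochner_Integration.integral_cong) (auto simp: indicator_def)
  also have "\<dots> = (LINT t|lebesgue_on {0..T'}. g t)"
    by (rule integral_restrict_space[symmetric]) auto
  also have "\<dots> = integral {0..T'} g"
    using assms(3) by (intro lebesgue_integral_eq_integral continuous_imp_integrable_real) auto
  finally show ?thesis .
qed

section \<open>The equations for the Fourier modes\<close>

lemma sobolev_imp_l2_weighted:
  assumes "f \<in> sobolev s" shows "l2_weighted s (sobolev_norm s f) (fourier f)"
  using assms l2_weighted_sobolev_seq unfolding sobolev_def sobolev_norm_def by blast

lemma continuous_in_sobolev_l2:
  assumes u: "continuous_in_sobolev s T u" and t: "t \<in> {0..T}" "t' \<in> {0..T}"
  shows "l2_weighted s (sobolev_norm s (\<lambda>x. u t x - u t' x)) (\<lambda>k. fourier (u t) k - fourier (u t') k)"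
    and "sobolev_norm s (\<lambda>x. u t x - u t' x) = sobolev_seq_norm s (\<lambda>k. fourier (u t) k - fourier (u t') k)"
proof -
  have s: "u t \<in> sobolev s" "u t' \<in> sobolev s" using u t by (auto simp: continuous_in_sobolev_def)
  then have "fourier (\<lambda>x. u t x - u t' x) = (\<lambda>k. fourier (u t) k - fourier (u t') k)"
    by (intro ext fourier_diff) (auto simp: sobolev_def)
  then show *: "sobolev_norm s (\<lambda>x. u t x - u t' x) = sobolev_seq_norm s (\<lambda>k. fourier (u t) k - fourier (u t') k)"
    by (simp add: sobolev_norm_def)
  have "l2_weighted s (2 * (sobolev_norm s (u t) + sobolev_norm s (u t'))) (\<lambda>k. fourier (u t) k - fourier (u t') k)"
    using l2_weighted_add[OF sobolev_imp_l2_weighted[OF s(1)], of "sobolev_norm s (u t')" "\<lambda>k. - fourier (u t') k"]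
      sobolev_imp_l2_weighted[OF s(2)] by (simp add: l2_weighted_uminus)
  then show "l2_weighted s (sobolev_norm s (\<lambda>x. u t x - u t' x)) (\<lambda>k. fourier (u t) k - fourier (u t') k)"
    unfolding * by (rule l2_weighted_summable(2))
qed

lemma continuous_in_sobolev_increment:
  assumes u: "continuous_in_sobolev s T u"
  shows "t \<in> {0..T} \<Longrightarrow> t' \<in> {0..T} \<Longrightarrow>
      l2_weighted s (sobolev_seq_norm s (\<lambda>i. fourier (u t) i - fourier (u t') i)) (\<lambda>i. fourier (u t) i - fourier (u t') i)"
    and "t' \<in> {0..T} \<Longrightarrow>
      ((\<lambda>t. sobolev_seq_norm s (\<lambda>i. fourier (u t) i - fourier (u t') i)) \<longlongrightarrow> 0) (at t' within {0..T})"
proof -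
  show "t \<in> {0..T} \<Longrightarrow> t' \<in> {0..T} \<Longrightarrow>
      l2_weighted s (sobolev_seq_norm s (\<lambda>i. fourier (u t) i - fourier (u t') i)) (\<lambda>i. fourier (u t) i - fourier (u t') i)"
    using continuous_in_sobolev_l2[OF u] by metis
  assume t': "t' \<in> {0..T}"
  have lim: "((\<lambda>t. sobolev_norm s (\<lambda>x. u t x - u t' x)) \<longlongrightarrow> 0) (at t' within {0..T})"
    using u t' by (auto simp: continuous_in_sobolev_def)
  show "((\<lambda>t. sobolev_seq_norm s (\<lambda>i. fourier (u t) i - fourier (u t') i)) \<longlongrightarrow> 0) (at t' within {0..T})"
    by (rule Lim_transform_within[OF lim, of 1]) (use continuous_in_sobolev_l2(2)[OF u _ t'] in auto)
qed

text \<open>The triangle inequality \<open>l2_weighted_add\<close> has a factor 2, so it gives a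
  local bound near every time rather than continuity of the norm; compactness of the interval makes
  the bound global.\<close>

lemma continuous_in_sobolev_bounded:
  assumes u: "continuous_in_sobolev s T u"
  shows "\<exists>R. \<forall>t\<in>{0..T}. l2_weighted s R (fourier (u t))"
proof -
  define N where "N t = sobolev_norm s (u t)" for t
  have l2: "l2_weighted s (N t) (fourier (u t))" if "t \<in> {0..T}" for t
    using u that unfolding N_def by (intro sobolev_imp_l2_weighted) (auto simp: continuous_in_sobolev_def)
  have "\<exists>d>0. \<forall>t\<in>{0..T}. dist t t' < d \<longrightarrow> N t \<le> 2 * (1 + N t')" if t': "t' \<in> {0..T}" for t'
  proof -
    have "((\<lambda>t. sobolev_norm s (\<lambda>x. u t x - u t' x)) \<longlongrightarrow> 0) (at t' within {0..T})"
      using u t' by (auto simp: continuous_in_sobolev_def)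
    then have "eventually (\<lambda>t. sobolev_norm s (\<lambda>x. u t x - u t' x) < 1) (at t' within {0..T})"
      by (rule order_tendstoD) simp
    then obtain d where d: "d > 0" "\<And>t. t \<in> {0..T} \<Longrightarrow> t \<noteq> t' \<Longrightarrow> dist t t' < d \<Longrightarrow> sobolev_norm s (\<lambda>x. u t x - u t' x) < 1"
      unfolding eventually_at by blast
    have "N t \<le> 2 * (1 + N t')" if t: "t \<in> {0..T}" "dist t t' < d" for t
    proof (cases "t = t'")
      case True
      then show ?thesis using l2[OF t'] by (auto simp: l2_weighted_def)
    next
      case False
      have "l2_weighted s 1 (\<lambda>k. fourier (u t) k - fourier (u t') k)"
        using d(2)[OF t(1) False t(2)] by (intro l2_weighted_mono[OF continuous_in_sobolev_l2(1)[OF u t(1) t']]) simp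
      from l2_weighted_add[OF this l2[OF t']]
      have "l2_weighted s (2 * (1 + N t')) (fourier (u t))" by simp
      then show ?thesis unfolding N_def sobolev_norm_def by (rule l2_weighted_summable(3))
    qed
    with d(1) show ?thesis by blast
  qed
  then obtain d where d: "\<And>t'. t' \<in> {0..T} \<Longrightarrow> d t' > 0"
    "\<And>t' t. t' \<in> {0..T} \<Longrightarrow> t \<in> {0..T} \<Longrightarrow> dist t t' < d t' \<Longrightarrow> N t \<le> 2 * (1 + N t')"
    by metis
  have "{0..T} \<subseteq> (\<Union>t'\<in>{0..T}. ball t' (d t'))" using d(1) by force
  then obtain C where C: "C \<subseteq> {0..T}" "finite C" "{0..T} \<subseteq> (\<Union>t'\<in>C. ball t' (d t'))"
    using compactE_image[OF compact_Icc, of "{0..T}" "\<lambda>t'. ball t' (d t')"] by (metis open_ball)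
  \<comment> \<open>The sum over the finite cover dominates each local bound, its terms being
    nonnegative.\<close>
  define R where "R = (\<Sum>t'\<in>C. 2 * (1 + N t'))"
  have nn: "N t \<ge> 0" if "t \<in> {0..T}" for t using l2[OF that] by (simp add: l2_weighted_def)
  have "N t \<le> R" if t: "t \<in> {0..T}" for t
  proof -
    obtain t' where t': "t' \<in> C" "dist t t' < d t'" using C(3) t by (auto simp: dist_commute)
    then have "N t \<le> 2 * (1 + N t')" using d(2) t C(1) by blast
    also have "\<dots> \<le> R" unfolding R_def
      by (rule member_le_sum[OF t'(1), of "\<lambda>t'. 2 * (1 + N t')"]) (use nn C in auto)
    finally show ?thesis .
  qed
  then show ?thesis using l2 l2_weighted_mono by blast
qed

section \<open>Symbols and Fourier coefficients of the nonlinear terms\<close>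

locale raman_nls =
  fixes \<alpha>\<^sub>1 \<alpha>\<^sub>2 \<gamma>\<^sub>1 \<gamma>\<^sub>2 \<Gamma> s :: real
  assumes Gamma_pos: "\<Gamma> > 0" and alpha1: "\<alpha>\<^sub>1 \<noteq> 0" and nonint: "2 * \<alpha>\<^sub>2 / (3 * \<alpha>\<^sub>1) \<notin> \<int>"
    and s1: "s \<ge> 1"
begin

text \<open>
  Symbols of the two cubic nonlinearities (\<open>symc\<close>) and of the Raman term (\<open>symr\<close>). The argument \<open>m\<close>
  is the frequency of the factor \<open>|u|\<^sup>2\<close>.
\<close>

definition symc :: "int \<Rightarrow> int \<Rightarrow> complex" where
  "symc k m = \<i> * of_real \<gamma>\<^sub>1 + \<i> * of_real \<gamma>\<^sub>2 * of_int k"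

definition symr :: "int \<Rightarrow> int \<Rightarrow> complex" where
  "symr k m = of_real \<Gamma> * of_int m"

definition symf :: "int \<Rightarrow> int \<Rightarrow> complex" where
  "symf k m = symc k m + symr k m"

definition Ks :: real where "Ks = \<bar>\<gamma>\<^sub>1\<bar> + \<bar>\<gamma>\<^sub>2\<bar> + \<Gamma>"

lemma Ks_pos: "Ks > 0" using Gamma_pos by (simp add: Ks_def)

lemma cmod_symc: "cmod (symc k m) \<le> \<bar>\<gamma>\<^sub>1\<bar> * bracket k + \<bar>\<gamma>\<^sub>2\<bar> * bracket k"
proof -
  have "cmod (symc k m) \<le> \<bar>\<gamma>\<^sub>1\<bar> + \<bar>\<gamma>\<^sub>2\<bar> * \<bar>of_int k\<bar>"
    unfolding symc_def by (rule order_trans[OF norm_triangle_ineq]) (simp add: norm_mult)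
  also have "\<bar>\<gamma>\<^sub>1\<bar> + \<bar>\<gamma>\<^sub>2\<bar> * \<bar>of_int k\<bar> = \<bar>\<gamma>\<^sub>1\<bar> * 1 + \<bar>\<gamma>\<^sub>2\<bar> * \<bar>of_int k\<bar>" by simp
  also have "\<dots> \<le> \<bar>\<gamma>\<^sub>1\<bar> * bracket k + \<bar>\<gamma>\<^sub>2\<bar> * bracket k"
    by (intro add_mono mult_left_mono) (auto simp: bracket_def)
  finally show ?thesis .
qed

lemma cmod_symr: "cmod (symr k m) = \<Gamma> * \<bar>of_int m\<bar>"
  using Gamma_pos by (simp add: symr_def norm_mult)

lemma
  shows symc_le: "cmod (symc k m) \<le> Ks * (bracket k + \<bar>of_int m\<bar>)"
    and symr_le: "cmod (symr k m) \<le> Ks * (bracket k + \<bar>of_int m\<bar>)"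
    and symf_le: "cmod (symf k m) \<le> Ks * (bracket k + \<bar>of_int m\<bar>)"
proof -
  have nn: "\<bar>\<gamma>\<^sub>1\<bar> * \<bar>real_of_int m\<bar> \<ge> 0" "\<bar>\<gamma>\<^sub>2\<bar> * \<bar>real_of_int m\<bar> \<ge> 0" "\<Gamma> * bracket k \<ge> 0"
    "\<Gamma> * \<bar>real_of_int m\<bar> \<ge> 0" "\<bar>\<gamma>\<^sub>1\<bar> * bracket k \<ge> 0" "\<bar>\<gamma>\<^sub>2\<bar> * bracket k \<ge> 0"
    using Gamma_pos by auto
  have K: "Ks * (bracket k + \<bar>of_int m\<bar>) = \<bar>\<gamma>\<^sub>1\<bar> * bracket k + \<bar>\<gamma>\<^sub>2\<bar> * bracket k + \<Gamma> * bracket k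
    + \<bar>\<gamma>\<^sub>1\<bar> * \<bar>real_of_int m\<bar> + \<bar>\<gamma>\<^sub>2\<bar> * \<bar>real_of_int m\<bar> + \<Gamma> * \<bar>real_of_int m\<bar>"
    by (simp add: Ks_def algebra_simps)
  show "cmod (symc k m) \<le> Ks * (bracket k + \<bar>of_int m\<bar>)" "cmod (symr k m) \<le> Ks * (bracket k + \<bar>of_int m\<bar>)"
    using nn cmod_symc[of k m] unfolding cmod_symr K by linarith+
  show "cmod (symf k m) \<le> Ks * (bracket k + \<bar>of_int m\<bar>)"
    using nn cmod_symc[of k m] norm_triangle_ineq[of "symc k m" "symr k m"]
    unfolding symf_def cmod_symr K by linarith
qed

text \<open>The weak formulation treats the terms differently, one group as an integral over the
  circle and the Raman term through the duality pairing, so each gets its own trilinear form; the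
  combined form \<open>full\<close> drives the mode equations.\<close>

sublocale cub: cubic_form symc Ks s by unfold_locales (rule symc_le Ks_pos s1)+
sublocale ram: cubic_form symr Ks s by unfold_locales (rule symr_le Ks_pos s1)+
sublocale full: cubic_form symf Ks s by unfold_locales (rule symf_le Ks_pos s1)+

lemma full_Tri:
  assumes "l2_weighted s R a"
  shows "full.Tri a a a k = cub.Tri a a a k + ram.Tri a a a k"
proof -
  have "full.term3 a a a k = (\<lambda>\<kappa>. cub.term3 a a a k \<kappa> + ram.term3 a a a k \<kappa>)"
    by (auto simp: full.term3_def cub.term3_def ram.term3_def symf_def distrib_right)
  then show ?thesis
    using cub.csummable_term3[OF assms assms assms, of k] ram.csummable_term3[OF assms assms assms, of k]
    by (simp add: full.Tri_def cub.Tri_def ram.Tri_def add_divide_distrib)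
qed

context
  fixes u :: "real \<Rightarrow> complex"
  assumes u: "u \<in> sobolev s"
begin

private lemma l2: "l2_weighted s (sobolev_norm s u) (fourier u)" by (rule sobolev_imp_l2_weighted[OF u])
private lemma int: "integrable torus u" using u by (simp add: sobolev_def)
private lemma intc: "integrable torus (\<lambda>x. cnj (u x))" using int by simp
private lemma suma: "csummable (fourier u)" by (rule l2_weighted_csummable[OF l2 s1])
private lemma sumc: "csummable (fourier (\<lambda>x. cnj (u x)))"
  using l2_weighted_csummable[of s _ "\<lambda>j. cnj (fourier u (- j))"] l2 s1
  unfolding fourier_cnj l2_weighted_reflect by blast

lemma integrable_abs_sq: "integrable torus (\<lambda>x. complex_of_real ((cmod (u x))\<^sup>2))"
  using integrable_wiener_mult[OF int suma intc] by (simp add: complex_norm_square[symmetric])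

lemma integrable_cubic: "integrable torus (\<lambda>x. complex_of_real ((cmod (u x))\<^sup>2) * u x)"
  using integrable_wiener_mult[OF int suma integrable_abs_sq] by (simp add: mult_ac)

lemma fourier_abs_sq:
  "fourier (\<lambda>x. complex_of_real ((cmod (u x))\<^sup>2)) k =
     1 / complex_of_real (sqrt (2*pi)) * csum (\<lambda>i. fourier u i * cnj (fourier u (- (k - i))))"
  using fourier_wiener_mult[OF int suma intc, of k] by (simp add: complex_norm_square[symmetric] fourier_cnj)

private lemma sqrt_pi: "complex_of_real (sqrt (2*pi)) * complex_of_real (sqrt (2*pi)) = 2 * of_real pi"
  by (simp only: of_real_mult[symmetric] real_sqrt_mult_self) simp

lemma fourier_cubic:
  "(\<i> * of_real \<gamma>\<^sub>1 + \<i> * of_real \<gamma>\<^sub>2 * of_int k) * fourier (\<lambda>x. complex_of_real ((cmod (u x))\<^sup>2) * u x) k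
    = cub.Tri (fourier u) (fourier u) (fourier u) k"
proof -
  let ?c = "1 / complex_of_real (sqrt (2*pi))"
  have int2: "integrable torus (\<lambda>x. cnj (u x) * u x)"
    by (rule integrable_wiener_mult[OF intc sumc int])
  \<comment> \<open>Grouping as \<open>u * (cnj u * u)\<close> puts the conjugated factor second, as
    in \<open>term3\<close>.\<close>
  have "fourier (\<lambda>x. complex_of_real ((cmod (u x))\<^sup>2) * u x) k = fourier (\<lambda>x. u x * (cnj (u x) * u x)) k"
    by (simp only: complex_norm_square mult_ac)
  also have "\<dots> = ?c * csum (\<lambda>i. fourier u i * fourier (\<lambda>x. cnj (u x) * u x) (k - i))"
    by (rule fourier_wiener_mult[OF int suma int2])
  also have "\<dots> = ?c * csum (\<lambda>i. fourier u i * (?c * csum (\<lambda>j. cnj (fourier u (- j)) * fourier u (k - i - j))))"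
    unfolding fourier_wiener_mult[OF intc sumc int] fourier_cnj ..
  also have "\<dots> = ?c * csum (\<lambda>i. ?c * csum (\<lambda>j. fourier u i * cnj (fourier u (- j)) * fourier u (k - i - j)))"
    by (simp add: mult_ac integral_mult_right_zero[symmetric] del: integral_mult_right_zero times_divide_eq_left times_divide_eq_right)
  also have "\<dots> = ?c * ?c * csum (\<lambda>i. csum (\<lambda>j. fourier u i * cnj (fourier u (- j)) * fourier u (k - i - j)))"
    by (simp only: integral_mult_right_zero mult.assoc)
  also have "?c * ?c = 1 / of_real (2 * pi)"
    using sqrt_pi by simp
  finally have *: "fourier (\<lambda>x. complex_of_real ((cmod (u x))\<^sup>2) * u x) k =
    1 / of_real (2 * pi) * csum (\<lambda>i. csum (\<lambda>j. fourier u i * cnj (fourier u (- j)) * fourier u (k - i - j)))" .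
  have "csum (cub.term3 (fourier u) (fourier u) (fourier u) k) = csum (\<lambda>i. csum (\<lambda>j. cub.term3 (fourier u) (fourier u) (fourier u) k (i, j)))"
    by (rule csum_pair(1)[OF cub.csummable_term3[OF l2 l2 l2]])
  also have "\<dots> = csum (\<lambda>i. csum (\<lambda>j. (\<i> * of_real \<gamma>\<^sub>1 + \<i> * of_real \<gamma>\<^sub>2 * of_int k) * (fourier u i * cnj (fourier u (- j)) * fourier u (k - i - j))))"
    by (simp add: cub.term3_def symc_def)
  also have "\<dots> = (\<i> * of_real \<gamma>\<^sub>1 + \<i> * of_real \<gamma>\<^sub>2 * of_int k) * csum (\<lambda>i. csum (\<lambda>j. fourier u i * cnj (fourier u (- j)) * fourier u (k - i - j)))"
    by (simp only: integral_mult_right_zero)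
  finally show ?thesis unfolding cub.Tri_def * by (simp add: mult_ac)
qed

lemma fourier_modulate: "fourier (\<lambda>x. u x * (c * cis (of_int (- n) * x))) k = c * fourier u (k + n)"
proof -
  have "(LINT x|torus. cis (- (of_int k * x)) * (u x * (c * cis (of_int (- n) * x)))) =
      (LINT x|torus. c * (cis (- (of_int (k + n) * x)) * u x))"
  proof (rule Bochner_Integration.integral_cong[OF refl])
    fix x
    have "cis (- (of_int (k + n) * x)) = cis (- (of_int k * x)) * cis (of_int (- n) * x)"
      by (simp add: cis_mult distrib_right)
    then show "cis (- (of_int k * x)) * (u x * (c * cis (of_int (- n) * x))) = c * (cis (- (of_int (k + n) * x)) * u x)"
      by (simp add: mult_ac)
  qed
  then show ?thesis by (simp only: fourier_altdef integral_mult_right_zero) (simp only: mult_ac)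
qed

lemma pairing_raman:
  "- \<i> * of_real \<Gamma> * pairing (dx_abs_sq u)
     (fourier (\<lambda>x. u x * (c / complex_of_real (sqrt (2*pi)) * cis (of_int (- k) * x)))) = c * ram.Tri (fourier u) (fourier u) (fourier u) k"
proof -
  let ?c = "1 / complex_of_real (sqrt (2*pi))"
  have cc: "?c * ?c = 1 / of_real (2 * pi)" using sqrt_pi by simp
  \<comment> \<open>The pairing sums over the frequency \<open>l\<close> of the quadratic factor and
    then over \<open>i\<close>; \<open>h\<close> passes to the pair \<open>(i, j)\<close> with
    \<open>j = l - i\<close> that \<open>term3\<close> uses.\<close>
  define h where "h = (\<lambda>(l::int, i::int). (i, l - i))"
  have "bij h" unfolding h_def by (rule o_bij[of "\<lambda>(i, j). (i + j, i)"]) (auto simp: fun_eq_iff)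
  define f where "f li = ram.term3 (fourier u) (fourier u) (fourier u) k (h li)" for li
  have sf: "csummable f" unfolding f_def csummable_reindex[OF \<open>bij h\<close>] by (rule ram.csummable_term3[OF l2 l2 l2])
  have f: "f (l, i) = of_real \<Gamma> * of_int l * fourier u (k - l) * (fourier u i * cnj (fourier u (- (l - i))))" for l i
    by (simp add: f_def h_def ram.term3_def symr_def mult_ac)
  have eq: "csum (\<lambda>i. f (l, i)) = of_real \<Gamma> * of_int l * fourier u (k - l) * csum (\<lambda>i. fourier u i * cnj (fourier u (- (l - i))))" for l
    unfolding f by (rule integral_mult_right_zero)
  have tm: "dx_abs_sq u l * fourier (\<lambda>x. u x * (c / complex_of_real (sqrt (2*pi)) * cis (of_int (- k) * x))) (- l)
     = (\<i> * c / (of_real \<Gamma> * of_real (2 * pi))) * csum (\<lambda>i. f (l, i))" for l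
  proof -
    have "dx_abs_sq u l * fourier (\<lambda>x. u x * (c / complex_of_real (sqrt (2*pi)) * cis (of_int (- k) * x))) (- l) =
      \<i> * of_int l * (?c * csum (\<lambda>i. fourier u i * cnj (fourier u (- (l - i))))) * (c * ?c * fourier u (k - l))"
      unfolding dx_abs_sq_def fourier_abs_sq fourier_modulate by simp
    also have "\<dots> = (?c * ?c) * \<i> * c * (of_int l * fourier u (k - l) * csum (\<lambda>i. fourier u i * cnj (fourier u (- (l - i)))))"
      by (simp only: mult_ac)
    also have "\<dots> = (\<i> * c / (of_real \<Gamma> * of_real (2 * pi))) * csum (\<lambda>i. f (l, i))"
      unfolding cc eq using Gamma_pos by simp
    finally show ?thesis .
  qed
  have sum: "csummable (\<lambda>l. (\<i> * c / (of_real \<Gamma> * of_real (2 * pi))) * csum (\<lambda>i. f (l, i)))"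
    using csum_pair(2)[OF sf] by (rule integrable_mult_right)
  have "pairing (dx_abs_sq u) (fourier (\<lambda>x. u x * (c / complex_of_real (sqrt (2*pi)) * cis (of_int (- k) * x))))
     = csum (\<lambda>l. (\<i> * c / (of_real \<Gamma> * of_real (2 * pi))) * csum (\<lambda>i. f (l, i)))"
    unfolding pairing_def tm by (rule infsum_eq_csum[OF sum])
  also have "\<dots> = (\<i> * c / (of_real \<Gamma> * of_real (2 * pi))) * csum f"
    by (simp only: integral_mult_right_zero csum_pair(1)[OF sf])
  also have "csum f = csum (ram.term3 (fourier u) (fourier u) (fourier u) k)"
    unfolding f_def by (rule csum_reindex[OF \<open>bij h\<close>])
  finally show ?thesis
    unfolding ram.Tri_def using Gamma_pos by simp
qed

end

end

section \<open>Differential equations for the modes\<close>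

context raman_nls
begin

definition rhs :: "int \<Rightarrow> (int \<Rightarrow> complex) \<Rightarrow> complex" where
  "rhs k a = - \<i> * of_real (\<alpha>\<^sub>1 * of_int k ^ 3 + \<alpha>\<^sub>2 * of_int k ^ 2) * a k + full.Tri a a a k"

lemma
  assumes u: "continuous_in_sobolev s T u"
  shows continuous_on_mode: "continuous_on {0..T} (\<lambda>t. fourier (u t) k)"
    and continuous_on_cub: "continuous_on {0..T} (\<lambda>t. cub.Tri (fourier (u t)) (fourier (u t)) (fourier (u t)) k)"
    and continuous_on_ram: "continuous_on {0..T} (\<lambda>t. ram.Tri (fourier (u t)) (fourier (u t)) (fourier (u t)) k)"
    and continuous_on_full: "continuous_on {0..T} (\<lambda>t. full.Tri (fourier (u t)) (fourier (u t)) (fourier (u t)) k)"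
proof -
  obtain R where R: "\<And>t. t \<in> {0..T} \<Longrightarrow> l2_weighted s R (fourier (u t))"
    using continuous_in_sobolev_bounded[OF u] by blast
  note d = continuous_in_sobolev_increment[OF u]
  show "continuous_on {0..T} (\<lambda>t. cub.Tri (fourier (u t)) (fourier (u t)) (fourier (u t)) k)"
    unfolding continuous_on_def using R d by (intro ballI cub.continuous_on_Tri[of "{0..T}" R]) auto
  show "continuous_on {0..T} (\<lambda>t. ram.Tri (fourier (u t)) (fourier (u t)) (fourier (u t)) k)"
    unfolding continuous_on_def using R d by (intro ballI ram.continuous_on_Tri[of "{0..T}" R]) auto
  show "continuous_on {0..T} (\<lambda>t. full.Tri (fourier (u t)) (fourier (u t)) (fourier (u t)) k)"
    unfolding continuous_on_def using R d by (intro ballI full.continuous_on_Tri[of "{0..T}" R]) auto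
  show "continuous_on {0..T} (\<lambda>t. fourier (u t) k)"
    unfolding continuous_on_def
  proof (rule ballI, subst Lim_null, rule Lim_null_comparison[OF _ d(2)])
    fix t' assume t': "t' \<in> {0..T}"
    have "cmod (fourier (u t) k - fourier (u t') k) \<le> sobolev_seq_norm s (\<lambda>k. fourier (u t) k - fourier (u t') k)"
      if "t \<in> {0..T}" for t
      by (rule l2_weighted_norm_le[OF d(1)[OF that t']]) (use s1 in simp)
    then show "\<forall>\<^sub>F t in at t' within {0..T}. cmod (fourier (u t) k - fourier (u t') k) \<le> sobolev_seq_norm s (\<lambda>k. fourier (u t) k - fourier (u t') k)"
      by (auto simp: eventually_at_filter)
  qed
qed

lemma LINT_mode:
  "(LINT x|torus. f x * (d * (1 / complex_of_real (sqrt (2*pi)) * cis (of_int (- k) * x)))) = d * fourier f k"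
proof -
  have "(LINT x|torus. f x * (d * (1 / complex_of_real (sqrt (2*pi)) * cis (of_int (- k) * x)))) =
    (LINT x|torus. d * (1 / complex_of_real (sqrt (2*pi))) * (cis (- (of_int k * x)) * f x))"
    by (simp add: mult_ac)
  also have "\<dots> = d * (1 / complex_of_real (sqrt (2*pi))) * (LINT x|torus. cis (- (of_int k * x)) * f x)"
    by (rule integral_mult_right_zero)
  finally show ?thesis by (simp only: fourier_altdef mult.assoc)
qed

text \<open>The weak identity is tested with the exponential of frequency \<open>- k\<close> times a
  cut-off at \<open>T'\<close>, which is then sharpened. Test functions must vanish before
  \<open>T\<close>, which is why \<open>T'\<close> stays strictly below \<open>T\<close>.\<close>

lemma mode_integral_equation:
  assumes u: "continuous_in_sobolev s T u"
    and sol: "solution_on_halfopen \<alpha>\<^sub>1 \<alpha>\<^sub>2 \<gamma>\<^sub>1 \<gamma>\<^sub>2 \<Gamma> s' T (u 0) u"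
    and T': "0 < T'" "T' < T"
  shows "fourier (u T') k = fourier (u 0) k + integral {0..T'} (\<lambda>t. rhs k (fourier (u t)))"
proof (rule weak_imp_integral_equation[OF T'(1)])
  define a where "a t = fourier (u t)" for t
  have sub: "{0..T'} \<subseteq> {0..T}" using T' by auto
  note ca = continuous_on_subset[OF continuous_on_mode[OF u, of k, folded a_def] sub]
    and ccub = continuous_on_subset[OF continuous_on_cub[OF u, of k, folded a_def] sub]
    and cram = continuous_on_subset[OF continuous_on_ram[OF u, of k, folded a_def] sub]
    and cfull = continuous_on_subset[OF continuous_on_full[OF u, of k, folded a_def] sub]
  show "continuous_on {0..T'} (\<lambda>t. fourier (u t) k)" using ca by (simp add: a_def)
  show "continuous_on {0..T'} (\<lambda>t. rhs k (fourier (u t)))"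
    unfolding rhs_def a_def[symmetric] by (intro continuous_intros ca cfull)
  fix n :: nat assume n: "n > 0"
  let ?c = "1 / complex_of_real (sqrt (2*pi))"
  let ?\<phi> = "wave ?c 0 (real n) T' (- k)"
  \<comment> \<open>\<open>\<eta>\<close> is the cut-off and \<open>w\<close> is minus its
    derivative.\<close>
  define \<eta> where "\<eta> t = flat 0 (real n * (T' - t))" for t
  define w where "w t = real n * flat 2 (real n * (T' - t))" for t
  have c\<eta>: "continuous_on S \<eta>" and cw: "continuous_on S w" for S
    unfolding \<eta>_def w_def by (intro continuous_intros)+
  have \<phi>: "?\<phi> t x = of_real (\<eta> t) * (?c * cis (of_int (- k) * x))" for t x
    by (simp add: wave_def \<eta>_def)
  have dt: "dt ?\<phi> t x = - of_real (w t) * (?c * cis (of_int (- k) * x))" if "t \<ge> 0" for t x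
    using dt_eqI[where \<phi>="?\<phi>", OF wave_dt that] by (simp add: wave_def w_def numeral_2_eq_2)
  have dx1: "dx ?\<phi> t x = of_real (\<eta> t) * (- \<i> * of_int k) * (?c * cis (of_int (- k) * x))"
    and dx2: "dx (dx ?\<phi>) t x = of_real (\<eta> t) * (- \<i> * of_int k)^2 * (?c * cis (of_int (- k) * x))"
    and dx3: "dx (dx (dx ?\<phi>)) t x = of_real (\<eta> t) * (- \<i> * of_int k)^3 * (?c * cis (of_int (- k) * x))" for t x
    unfolding dx_wave by (simp_all add: wave_def \<eta>_def power2_eq_square power3_eq_cube)
  have us: "u t \<in> sobolev s" if "0 \<le> t" "t < T" for t
    using u that by (auto simp: continuous_in_sobolev_def)
  have z: "\<eta> t = 0" "w t = 0" if "T' < t" for t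
    using that n by (auto simp: \<eta>_def w_def mult_nonneg_nonpos)
  have "test_function T ?\<phi>" using n T' by (intro test_function_wave) auto
  with sol have eq: "- (LINT t|lebesgue_on {0..<T}. LINT x|torus. u t x * dt ?\<phi> t x)
        - (LINT x|torus. u 0 x * ?\<phi> 0 x)
        = (LINT t|lebesgue_on {0..<T}. LINT x|torus.
             u t x * (- of_real \<alpha>\<^sub>1 * dx (dx (dx ?\<phi>)) t x + \<i> * of_real \<alpha>\<^sub>2 * dx (dx ?\<phi>) t x)
             + of_real ((cmod (u t x))\<^sup>2) * u t x *
               (\<i> * of_real \<gamma>\<^sub>1 * ?\<phi> t x - of_real \<gamma>\<^sub>2 * dx ?\<phi> t x))
          - \<i> * of_real \<Gamma> *
            (LINT t|lebesgue_on {0..<T}.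
               pairing (dx_abs_sq (u t)) (fourier (\<lambda>x. u t x * ?\<phi> t x)))"
    (is "- ?I1 - ?I2 = (LINT t|_. ?f t) - _ * (LINT t|_. ?p t)")
    unfolding solution_on_halfopen_def by blast
  have 1: "?I1 = integral {0..T'} (\<lambda>t. - w t *\<^sub>R a t k)"
  proof (rule LINT_halfopen_eq_integral[OF T'])
    show "continuous_on {0..T'} (\<lambda>t. - w t *\<^sub>R a t k)" by (intro continuous_intros cw ca)
    have *: "(LINT x|torus. u t x * dt ?\<phi> t x) = - of_real (w t) * a t k" if "t \<ge> 0" for t
      unfolding dt[OF that] LINT_mode a_def ..
    show "(LINT x|torus. u t x * dt ?\<phi> t x) = - w t *\<^sub>R a t k" if "0 \<le> t" for t
      using *[OF that] by (simp add: scaleR_conv_of_real)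
    show "(LINT x|torus. u t x * dt ?\<phi> t x) = 0" if "T' < t" for t
      using *[of t] that T' z by simp
  qed
  have 2: "?I2 = \<eta> 0 *\<^sub>R a 0 k"
    unfolding \<phi> LINT_mode a_def by (simp add: scaleR_conv_of_real)
  have 3: "(LINT t|lebesgue_on {0..<T}. ?f t)
     = integral {0..T'} (\<lambda>t. \<eta> t *\<^sub>R (- \<i> * of_real (\<alpha>\<^sub>1 * of_int k ^ 3 + \<alpha>\<^sub>2 * of_int k ^ 2) * a t k + cub.Tri (a t) (a t) (a t) k))"
    (is "_ = integral _ ?g")
  proof (rule LINT_halfopen_eq_integral[OF T'])
    show "continuous_on {0..T'} ?g" by (intro continuous_intros c\<eta> ca ccub)
    have *: "?f t = ?g t" if t: "0 \<le> t" "t < T" for t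
    proof -
      let ?d1 = "of_real (\<eta> t) * (- of_real \<alpha>\<^sub>1 * (- \<i> * of_int k)^3 + \<i> * of_real \<alpha>\<^sub>2 * (- \<i> * of_int k)^2)"
      let ?d2 = "of_real (\<eta> t) * (\<i> * of_real \<gamma>\<^sub>1 + \<i> * of_real \<gamma>\<^sub>2 * of_int k)"
      have int1: "integrable torus (u t)" using us[OF t] by (simp add: sobolev_def)
      note int2 = integrable_cubic[OF us[OF t]]
      have m: "integrable torus (\<lambda>x. f x * (d * (?c * cis (of_int (- k) * x))))" if "integrable torus f" for f d
      proof -
        have "integrable torus (\<lambda>x. (d * (?c * cis (of_int (- k) * x))) * f x)"
          by (intro torus_integrable_mult that continuous_intros continuous_cis_mult)
        then show ?thesis by (simp only: mult.commute)
      qed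
      have "?f t = (LINT x|torus. u t x * (?d1 * (?c * cis (of_int (- k) * x)))
         + of_real ((cmod (u t x))\<^sup>2) * u t x * (?d2 * (?c * cis (of_int (- k) * x))))"
        unfolding dx1 dx2 dx3 \<phi> by (intro Bochner_Integration.integral_cong refl) (simp add: algebra_simps)
      also have "\<dots> = ?d1 * a t k + ?d2 * fourier (\<lambda>x. of_real ((cmod (u t x))\<^sup>2) * u t x) k"
        using m[OF int1] m[OF int2] by (simp only: Bochner_Integration.integral_add LINT_mode a_def)
      also have "?d2 * fourier (\<lambda>x. of_real ((cmod (u t x))\<^sup>2) * u t x) k = of_real (\<eta> t) * cub.Tri (a t) (a t) (a t) k"
        unfolding a_def fourier_cubic[OF us[OF t], symmetric] by (rule mult.assoc)
      also have "?d1 = of_real (\<eta> t) * (- \<i> * of_real (\<alpha>\<^sub>1 * of_int k ^ 3 + \<alpha>\<^sub>2 * of_int k ^ 2))"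
        by (simp add: power2_eq_square power3_eq_cube algebra_simps)
      finally show ?thesis by (simp add: scaleR_conv_of_real distrib_left)
    qed
    show "?f t = ?g t" if "0 \<le> t" "t \<le> T'" for t using * that T' by simp
    show "?f t = 0" if "T' < t" "t < T" for t using * that T' z by simp
  qed
  have 4: "- \<i> * of_real \<Gamma> * (LINT t|lebesgue_on {0..<T}. ?p t)
     = integral {0..T'} (\<lambda>t. \<eta> t *\<^sub>R ram.Tri (a t) (a t) (a t) k)"
  proof -
    have "- \<i> * of_real \<Gamma> * (LINT t|lebesgue_on {0..<T}. ?p t)
      = (LINT t|lebesgue_on {0..<T}. - \<i> * of_real \<Gamma> * ?p t)"
      by (rule integral_mult_right_zero[symmetric])
    also have "\<dots> = integral {0..T'} (\<lambda>t. \<eta> t *\<^sub>R ram.Tri (a t) (a t) (a t) k)"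
    proof (rule LINT_halfopen_eq_integral[OF T'])
      show "continuous_on {0..T'} (\<lambda>t. \<eta> t *\<^sub>R ram.Tri (a t) (a t) (a t) k)"
        by (intro continuous_intros c\<eta> cram)
      have *: "- \<i> * of_real \<Gamma> * ?p t = of_real (\<eta> t) * ram.Tri (a t) (a t) (a t) k"
        if "0 \<le> t" "t < T" for t
      proof -
        have "?\<phi> t x = of_real (\<eta> t) / complex_of_real (sqrt (2*pi)) * cis (of_int (- k) * x)" for x
          unfolding \<phi> by simp
        then show ?thesis using pairing_raman[OF us[OF that], of "of_real (\<eta> t)" k] by (simp add: a_def)
      qed
      show "- \<i> * of_real \<Gamma> * ?p t = \<eta> t *\<^sub>R ram.Tri (a t) (a t) (a t) k"
        if "0 \<le> t" "t \<le> T'" for t using *[of t] that T' by (simp add: scaleR_conv_of_real)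
      show "- \<i> * of_real \<Gamma> * ?p t = 0"
        if "T' < t" "t < T" for t using *[of t] that T' z by simp
    qed
    finally show ?thesis .
  qed
  have "integral {0..T'} (\<lambda>t. w t *\<^sub>R a t k) - \<eta> 0 *\<^sub>R a 0 k =
      integral {0..T'} (\<lambda>t. \<eta> t *\<^sub>R (- \<i> * of_real (\<alpha>\<^sub>1 * of_int k ^ 3 + \<alpha>\<^sub>2 * of_int k ^ 2) * a t k + cub.Tri (a t) (a t) (a t) k))
      + integral {0..T'} (\<lambda>t. \<eta> t *\<^sub>R ram.Tri (a t) (a t) (a t) k)"
    using eq unfolding 1 2 3 4[symmetric] by simp
  also have "\<dots> = integral {0..T'} (\<lambda>t. \<eta> t *\<^sub>R (- \<i> * of_real (\<alpha>\<^sub>1 * of_int k ^ 3 + \<alpha>\<^sub>2 * of_int k ^ 2) * a t k + cub.Tri (a t) (a t) (a t) k)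
      + \<eta> t *\<^sub>R ram.Tri (a t) (a t) (a t) k)"
    by (intro Henstock_Kurzweil_Integration.integral_add[symmetric] integrable_continuous_interval continuous_intros c\<eta> ca ccub cram)
  also have "\<dots> = integral {0..T'} (\<lambda>t. \<eta> t *\<^sub>R rhs k (a t))"
  proof (rule Henstock_Kurzweil_Integration.integral_cong)
    fix t assume "t \<in> {0..T'}"
    then have "l2_weighted s (sobolev_norm s (u t)) (a t)"
      using us T' unfolding a_def by (intro sobolev_imp_l2_weighted) auto
    from full_Tri[OF this, of k] show "\<eta> t *\<^sub>R (- \<i> * of_real (\<alpha>\<^sub>1 * of_int k ^ 3 + \<alpha>\<^sub>2 * of_int k ^ 2) * a t k + cub.Tri (a t) (a t) (a t) k)
      + \<eta> t *\<^sub>R ram.Tri (a t) (a t) (a t) k = \<eta> t *\<^sub>R rhs k (a t)"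
      by (simp add: rhs_def scaleR_right_distrib scaleR_right_diff_distrib)
  qed
  finally show "integral {0..T'} (\<lambda>t. (real n * flat 2 (real n * (T' - t))) *\<^sub>R fourier (u t) k) - flat 0 (real n * T') *\<^sub>R fourier (u 0) k
    = integral {0..T'} (\<lambda>t. flat 0 (real n * (T' - t)) *\<^sub>R rhs k (fourier (u t)))"
    by (simp add: w_def \<eta>_def a_def)
qed

lemma mode_has_derivative:
  assumes u: "continuous_in_sobolev s T u"
    and sol: "solution_on_halfopen \<alpha>\<^sub>1 \<alpha>\<^sub>2 \<gamma>\<^sub>1 \<gamma>\<^sub>2 \<Gamma> s' T (u 0) u"
    and T': "T' < T" and t: "t \<in> {0..T'}"
  shows "((\<lambda>t. fourier (u t) k) has_vector_derivative rhs k (fourier (u t))) (at t within {0..T'})"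
proof (rule has_vector_derivative_transform[OF t])
  have c: "continuous_on {0..T'} (\<lambda>t. rhs k (fourier (u t)))"
    unfolding rhs_def using T'
    by (intro continuous_intros continuous_on_subset[OF continuous_on_mode[OF u, of k]]
        continuous_on_subset[OF continuous_on_full[OF u, of k]]) auto
  show "((\<lambda>t. fourier (u 0) k + integral {0..t} (\<lambda>t. rhs k (fourier (u t)))) has_vector_derivative rhs k (fourier (u t))) (at t within {0..T'})"
    using has_vector_derivative_add[OF has_vector_derivative_const integral_has_vector_derivative[OF c t], of "fourier (u 0) k"] by simp
  show "fourier (u t) k = fourier (u 0) k + integral {0..t} (\<lambda>t. rhs k (fourier (u t)))" if "t \<in> {0..T'}" for t
    using mode_integral_equation[OF u sol, of t k] that T' by (cases "t = 0") auto
qed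

end

section \<open>Resonances and small divisors\<close>

text \<open>Near \<open>- c\<close> the distance \<open>d\<close> of \<open>c\<close> to the
  integers is a lower bound; far away the left side grows linearly as well. Both regimes are merged
  through \<open><n> <= |n + c| + (1 + |c|)\<close> and
  \<open>1 + |c| <= (1 + |c|) / d * |n + c|\<close>.\<close>

lemma nonint_gap:
  assumes "c \<notin> \<int>" shows "\<exists>\<delta>>0. \<forall>n::int. \<delta> * bracket n \<le> \<bar>of_int n + c\<bar>"
proof -
  define d where "d = min (c - of_int \<lfloor>c\<rfloor>) (of_int \<lfloor>c\<rfloor> + 1 - c)"
  have "c \<noteq> of_int \<lfloor>c\<rfloor>" using assms by (metis Ints_of_int)
  then have d: "d > 0" unfolding d_def by linarith
  have gap: "d \<le> \<bar>of_int n + c\<bar>" for n :: int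
  proof (cases "- n \<le> \<lfloor>c\<rfloor>")
    case True
    then have "real_of_int (- n) \<le> of_int \<lfloor>c\<rfloor>" by linarith
    then show ?thesis unfolding d_def by linarith
  next
    case False
    then have "real_of_int (- n) \<ge> of_int \<lfloor>c\<rfloor> + 1" by linarith
    then show ?thesis unfolding d_def by linarith
  qed
  define \<delta> where "\<delta> = 1 / (1 + (1 + \<bar>c\<bar>) / d)"
  have "\<delta> * bracket n \<le> \<bar>of_int n + c\<bar>" for n :: int
  proof -
    have "bracket n \<le> \<bar>of_int n + c\<bar> + (1 + \<bar>c\<bar>)" by (simp add: bracket_def)
    also have "1 + \<bar>c\<bar> = (1 + \<bar>c\<bar>) / d * d" using d by simp
    also have "\<dots> \<le> (1 + \<bar>c\<bar>) / d * \<bar>of_int n + c\<bar>"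
      using d by (intro mult_left_mono gap) auto
    finally have "bracket n \<le> (1 + (1 + \<bar>c\<bar>) / d) * \<bar>of_int n + c\<bar>" by (simp add: distrib_right)
    moreover have "1 + (1 + \<bar>c\<bar>) / d > 0" using d by (simp add: add_pos_pos)
    ultimately show ?thesis by (simp add: \<delta>_def pos_divide_le_eq mult.commute)
  qed
  moreover have "\<delta> > 0" unfolding \<delta>_def using d by (simp add: add_pos_pos)
  ultimately show ?thesis by blast
qed

text \<open>
  In a triple \<open>i + j + l = k\<close> each of the factors \<open>F\<close> below is the reciprocal of a sum of two of the
  frequencies, hence large only if the third frequency is comparable to \<open>k\<close>.
\<close>

lemma gain_pair:
  fixes k ba bb Fa Fb :: real
  assumes "k \<ge> 1" "ba \<ge> 1" "bb \<ge> 1" "0 \<le> Fa" "Fa \<le> 1" "0 \<le> Fb" "Fb \<le> 1" "k * Fa \<le> ba" "k * Fb \<le> bb"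
  shows "k * Fa * Fb \<le> k powr - (1/4) * (ba * bb powr (1/4))"
    and "Fa \<le> k powr - (1/4) * (ba * bb powr (1/4))"
    and "Fb \<le> k powr - (1/4) * (ba * bb powr (1/4))"
proof -
  have root: "F \<le> k powr - (1/4) * b powr (1/4)" if "0 \<le> F" "F \<le> 1" "k * F \<le> b" "b \<ge> 1" for F b
  proof (cases "F = 0")
    case False
    have "F = F powr 1" using that by simp
    also have "\<dots> \<le> F powr (1/4)" using that False by (intro powr_mono') auto
    also have "\<dots> \<le> (b / k) powr (1/4)"
      using that assms(1) by (intro powr_mono2) (auto simp: field_simps)
    also have "\<dots> = k powr - (1/4) * b powr (1/4)"
      using that assms(1) by (simp add: powr_divide powr_minus field_simps)
    finally show ?thesis .
  qed simp
  have ba14: "1 \<le> bb powr (1/4)" using assms by (intro ge_one_powr_ge_zero) auto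
  have "k * Fa * Fb \<le> ba * (k powr - (1/4) * bb powr (1/4))"
    using assms by (intro mult_mono root) auto
  then show "k * Fa * Fb \<le> k powr - (1/4) * (ba * bb powr (1/4))" by (simp add: mult_ac)
  have "Fb \<le> k powr - (1/4) * bb powr (1/4)" using assms by (intro root) auto
  also have "\<dots> = k powr - (1/4) * (1 * bb powr (1/4))" by simp
  also have "\<dots> \<le> k powr - (1/4) * (ba * bb powr (1/4))"
    using assms(2) by (intro mult_left_mono mult_right_mono) auto
  finally show "Fb \<le> k powr - (1/4) * (ba * bb powr (1/4))" .
  have "Fa \<le> k powr - (1/4) * ba powr (1/4)" using assms by (intro root) auto
  also have "\<dots> \<le> k powr - (1/4) * (ba * bb powr (1/4))"
  proof (intro mult_left_mono)
    have "ba powr (1/4) \<le> ba powr 1" using assms by (intro powr_mono) auto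
    also have "\<dots> \<le> ba * bb powr (1/4)" using ba14 assms by simp
    finally show "ba powr (1/4) \<le> ba * bb powr (1/4)" .
  qed auto
  finally show "Fa \<le> k powr - (1/4) * (ba * bb powr (1/4))" .
qed

text \<open>Each ordered pair reduces to \<open>gain_pair\<close>, the factor of the remaining
  frequency being at most 1. The second product, without \<open>k\<close> and \<open>F3\<close>,
  serves the part of the symbol that grows with \<open>i + j\<close> and cancels that
  factor.\<close>

lemma gain_triple:
  fixes k b1 b2 b3 F1 F2 F3 :: real
  assumes "k \<ge> 1" "b1 \<ge> 1" "b2 \<ge> 1" "b3 \<ge> 1"
    "0 \<le> F1 \<and> F1 \<le> 1 \<and> k * F1 \<le> b1" "0 \<le> F2 \<and> F2 \<le> 1 \<and> k * F2 \<le> b2" "0 \<le> F3 \<and> F3 \<le> 1 \<and> k * F3 \<le> b3"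
    and xy: "(x, y) \<in> {(b1, b2), (b2, b1), (b1, b3), (b3, b1), (b2, b3), (b3, b2)}"
  shows "k * F1 * F2 * F3 \<le> k powr - (1/4) * (x * y powr (1/4)) \<and> F1 * F2 \<le> k powr - (1/4) * (x * y powr (1/4))"
proof -
  have *: "k * Fa * Fb * Fc \<le> X \<and> Fa * Fb \<le> X \<and> Fa * Fc \<le> X \<and> Fb * Fc \<le> X"
    if "ba \<ge> 1" "bb \<ge> 1" "0 \<le> Fa \<and> Fa \<le> 1 \<and> k * Fa \<le> ba" "0 \<le> Fb \<and> Fb \<le> 1 \<and> k * Fb \<le> bb" "0 \<le> Fc \<and> Fc \<le> 1"
      and X: "X = k powr - (1/4) * (ba * bb powr (1/4))" for Fa ba Fb bb Fc X
  proof -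
    have small: "F * G \<le> X" if "F \<le> X" "0 \<le> F" "0 \<le> G" "G \<le> 1" for F G
      using that mult_left_mono[of G 1 F] by simp
    note g = gain_pair[of k ba bb Fa Fb, folded X]
    show ?thesis using that(1-5) assms(1) g by (auto intro: small)
  qed
  show ?thesis
    using xy assms(1-7) *[of b1 b2 F1 F2 F3, OF _ _ _ _ _ refl] *[of b2 b1 F2 F1 F3, OF _ _ _ _ _ refl]
      *[of b1 b3 F1 F3 F2, OF _ _ _ _ _ refl] *[of b3 b1 F3 F1 F2, OF _ _ _ _ _ refl]
      *[of b2 b3 F2 F3 F1, OF _ _ _ _ _ refl] *[of b3 b2 F3 F2 F1, OF _ _ _ _ _ refl]
    by (auto simp: mult_ac)
qed

definition pair_bounded :: "real \<Rightarrow> int \<Rightarrow> (int \<Rightarrow> int \<Rightarrow> int \<Rightarrow> real) \<Rightarrow> bool" where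
  "pair_bounded M k R \<longleftrightarrow> M \<ge> 0 \<and> (\<forall>i j l. i + j + l = k \<longrightarrow> 0 \<le> R i j l \<and>
     (\<forall>(x, y)\<in>{(i, j), (j, i), (i, l), (l, i), (j, l), (l, j)}. R i j l \<le> M * (bracket x * bracket y powr (1/4))))"

lemma pair_bounded_swap:
  assumes "pair_bounded M k R" shows "pair_bounded M k (\<lambda>i j l. R j i l)"
  unfolding pair_bounded_def
proof (intro conjI[OF conjunct1[OF assms[unfolded pair_bounded_def]]] allI impI)
  fix i j l :: int assume "i + j + l = k"
  then have "j + i + l = k" by simp
  from assms[unfolded pair_bounded_def, THEN conjunct2, rule_format, OF this]
  show "0 \<le> R j i l \<and> (\<forall>(x, y)\<in>{(i, j), (j, i), (i, l), (l, i), (j, l), (l, j)}. R j i l \<le> M * (bracket x * bracket y powr (1/4)))"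
    by auto
qed

lemma pair_bounded_swap13:
  assumes "pair_bounded M k R" shows "pair_bounded M k (\<lambda>i j l. R l j i)"
  unfolding pair_bounded_def
proof (intro conjI[OF conjunct1[OF assms[unfolded pair_bounded_def]]] allI impI)
  fix i j l :: int assume "i + j + l = k"
  then have "l + j + i = k" by simp
  from assms[unfolded pair_bounded_def, THEN conjunct2, rule_format, OF this]
  show "0 \<le> R l j i \<and> (\<forall>(x, y)\<in>{(i, j), (j, i), (i, l), (l, i), (j, l), (l, j)}. R l j i \<le> M * (bracket x * bracket y powr (1/4)))"
    by auto
qed

text \<open>\<open>f\<close> has only \<open>s - 1\<close> derivatives to offer. The weight
  \<open><k>^(s-1)\<close> is charged to the largest of the three frequencies. If that is
  \<open>i\<close>, then \<open>f\<close> carries it; if it is \<open>j\<close> or \<open>l\<close>,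
  the full power allowed by \<open>R\<close> is charged to the same factor, which then uses exactly
  its \<open>s\<close> derivatives. In every case two factors are in l2, the third is in l1 with
  weight 1/4, and \<open>conv3_le\<close> applies. The cases \<open>i\<close> and \<open>j\<close>
  give the same product, hence a repeated summand in the proof.\<close>

lemma weighted_triple_le:
  assumes R: "pair_bounded M k R" and s: "s \<ge> 1"
    and f: "l2_weighted (s - 1) A f" and g: "l2_weighted s B g" and h: "l2_weighted s C h"
  shows "nsum (\<lambda>i. nsum (\<lambda>j. ennreal (R i j (k - i - j) * (cmod (f i) * cmod (g j) * cmod (h (k - i - j))))))
    \<le> ennreal (3 powr s * embed_const * bracket k powr (1 - s) * M * A * B * C)"
proof -
  define F where "F i = ennreal (bracket (of_int i) powr (s - 1) * cmod (f i))" for i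
  define G where "G i = ennreal (bracket (of_int i) powr s * cmod (g i))" for i
  define H where "H i = ennreal (bracket (of_int i) powr s * cmod (h i))" for i
  define g' where "g' i = ennreal (bracket (of_int i) powr (1/4) * cmod (g i))" for i
  define h' where "h' i = ennreal (bracket (of_int i) powr (1/4) * cmod (h i))" for i
  have nn: "M \<ge> 0" "A \<ge> 0" "B \<ge> 0" "C \<ge> 0" using R f g h by (auto simp: l2_weighted_def pair_bounded_def)
  define K where "K = bracket k powr (1 - s) * 3 powr (s - 1) * M"
  have K: "K \<ge> 0" using nn by (simp add: K_def)
  have "ennreal (R i j (k - i - j) * (cmod (f i) * cmod (g j) * cmod (h (k - i - j))))
    \<le> ennreal K * (F i * G j * h' (k - i - j) + F i * G j * h' (k - i - j) + F i * g' j * H (k - i - j))" for i j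
  proof -
    define l where "l = k - i - j"
    have k: "i + j + l = k" by (simp add: l_def)
    have R0: "0 \<le> R i j l" and R1: "R i j l \<le> M * (bracket j * bracket l powr (1/4))"
      and R2: "R i j l \<le> M * (bracket l * bracket j powr (1/4))"
      using R[unfolded pair_bounded_def, THEN conjunct2, rule_format, OF k] by auto
    define x y z where "x = cmod (f i)" and "y = cmod (g j)" and "z = cmod (h l)"
    have xyz: "x \<ge> 0" "y \<ge> 0" "z \<ge> 0" by (auto simp: x_def y_def z_def)
    have max: "bracket k powr (s - 1) \<le> 3 powr (s - 1) * (bracket i powr (s - 1) + bracket j powr (s - 1) + bracket l powr (s - 1))"
    proof -
      define N where "N = max (bracket i) (max (bracket j) (bracket l))"
      have N: "bracket i \<le> N" "bracket j \<le> N" "bracket l \<le> N" "N \<ge> 1"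
        by (auto simp: N_def le_max_iff_disj)
      have "bracket k \<le> 3 * N"
        using bracket_add3_le[of i j l] N k by (simp flip: k)
      then have "bracket k powr (s - 1) \<le> (3 * N) powr (s - 1)"
        using s by (intro powr_mono2) auto
      also have "\<dots> = 3 powr (s - 1) * N powr (s - 1)" using N by (simp add: powr_mult)
      also have "\<dots> \<le> 3 powr (s - 1) * (bracket i powr (s - 1) + bracket j powr (s - 1) + bracket l powr (s - 1))"
        by (intro mult_left_mono) (auto simp: N_def max_def)
      finally show ?thesis .
    qed
    have pow: "bracket j * bracket j powr (s - 1) = bracket j powr s" for j :: real
      using powr_add[of "bracket j" 1 "s - 1"] by simp
    have up: "bracket j \<le> bracket j powr s" "1 \<le> bracket j powr (s - 1)" for j :: real
      using s powr_mono[of 1 s "bracket j"] by (auto intro: ge_one_powr_ge_zero)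
    have b1: "bracket i powr (s - 1) * (R i j l * (x * y * z)) \<le>
       M * ((bracket i powr (s - 1) * x) * (bracket j powr s * y) * (bracket l powr (1/4) * z))"
    proof -
      have "R i j l \<le> M * (bracket j powr s * bracket l powr (1/4))"
        by (rule order_trans[OF R1]) (intro mult_left_mono mult_right_mono up nn, auto)
      then have "bracket i powr (s - 1) * (R i j l * (x * y * z)) \<le>
         bracket i powr (s - 1) * ((M * (bracket j powr s * bracket l powr (1/4))) * (x * y * z))"
        using xyz by (intro mult_left_mono mult_right_mono) auto
      then show ?thesis by (simp add: mult_ac)
    qed
    have b2: "bracket j powr (s - 1) * (R i j l * (x * y * z)) \<le>
       M * ((bracket i powr (s - 1) * x) * (bracket j powr s * y) * (bracket l powr (1/4) * z))"
    proof -
      have "bracket j powr (s - 1) * (R i j l * (x * y * z)) \<le>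
        bracket j powr (s - 1) * ((M * (bracket j * bracket l powr (1/4))) * ((bracket i powr (s - 1) * x) * y * z))"
        using xyz R1 R0 nn up(2)[of i] by (intro mult_left_mono mult_mono) (auto simp: mult_le_cancel_right1)
      also have "\<dots> = M * ((bracket i powr (s - 1) * x) * ((bracket j * bracket j powr (s - 1)) * y) * (bracket l powr (1/4) * z))"
        by (simp add: mult_ac)
      finally show ?thesis unfolding pow .
    qed
    have b3: "bracket l powr (s - 1) * (R i j l * (x * y * z)) \<le>
       M * ((bracket i powr (s - 1) * x) * (bracket j powr (1/4) * y) * (bracket l powr s * z))"
    proof -
      have "bracket l powr (s - 1) * (R i j l * (x * y * z)) \<le>
        bracket l powr (s - 1) * ((M * (bracket l * bracket j powr (1/4))) * ((bracket i powr (s - 1) * x) * y * z))"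
        using xyz R2 R0 nn up(2)[of i] by (intro mult_left_mono mult_mono) (auto simp: mult_le_cancel_right1)
      also have "\<dots> = M * ((bracket i powr (s - 1) * x) * (bracket j powr (1/4) * y) * ((bracket l * bracket l powr (s - 1)) * z))"
        by (simp add: mult_ac)
      finally show ?thesis unfolding pow .
    qed
    let ?P = "(bracket i powr (s - 1) * x) * (bracket j powr s * y) * (bracket l powr (1/4) * z)"
    let ?Q = "(bracket i powr (s - 1) * x) * (bracket j powr (1/4) * y) * (bracket l powr s * z)"
    have "R i j l * (x * y * z) = bracket k powr (1 - s) * (bracket k powr (s - 1) * (R i j l * (x * y * z)))"
    proof -
      have "bracket k \<noteq> 0" using bracket_pos[of k] by linarith
      then show ?thesis by (simp add: mult.assoc[symmetric] powr_add[symmetric])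
    qed
    also have "\<dots> \<le> bracket k powr (1 - s) *
       (3 powr (s - 1) * (bracket i powr (s - 1) + bracket j powr (s - 1) + bracket l powr (s - 1)) * (R i j l * (x * y * z)))"
      using xyz R0 by (intro mult_left_mono mult_right_mono max) auto
    also have "\<dots> = bracket k powr (1 - s) * (3 powr (s - 1) * (bracket i powr (s - 1) * (R i j l * (x * y * z))
       + bracket j powr (s - 1) * (R i j l * (x * y * z)) + bracket l powr (s - 1) * (R i j l * (x * y * z))))"
      by (simp add: algebra_simps)
    also have "\<dots> \<le> bracket k powr (1 - s) * (3 powr (s - 1) * (M * ?P + M * ?P + M * ?Q))"
      by (intro mult_left_mono add_mono b1 b2 b3) auto
    also have "\<dots> = K * (?P + ?P + ?Q)" by (simp add: K_def algebra_simps)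
    finally have "ennreal (R i j l * (x * y * z)) \<le> ennreal (K * (?P + ?P + ?Q))" by (rule ennreal_leI)
    also have "\<dots> = ennreal K * (F i * G j * h' l + F i * G j * h' l + F i * g' j * H l)"
      using K xyz unfolding F_def G_def H_def g'_def h'_def x_def[symmetric] y_def[symmetric] z_def[symmetric]
      by (simp only: ennreal_mult ennreal_plus mult_nonneg_nonneg powr_ge_zero add_nonneg_nonneg)
    finally show ?thesis by (simp add: x_def y_def z_def l_def)
  qed
  then have "nsum (\<lambda>i. nsum (\<lambda>j. ennreal (R i j (k - i - j) * (cmod (f i) * cmod (g j) * cmod (h (k - i - j))))))
    \<le> nsum (\<lambda>i. nsum (\<lambda>j. ennreal K * (F i * G j * h' (k - i - j) + F i * G j * h' (k - i - j) + F i * g' j * H (k - i - j))))"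
    by (intro nsum_mono)
  also have "\<dots> = ennreal K * (conv3 F G h' k + conv3 F G h' k + conv3 F g' H k)"
    by (simp only: nsum_cmult nsum_add conv3_def)
  also have "\<dots> \<le> ennreal K * (ennreal (A * B * (embed_const * C)) + ennreal (A * B * (embed_const * C)) + ennreal (A * C * (embed_const * B)))"
  proof (intro mult_left_mono add_mono)
    have F2: "nsum (\<lambda>k. (F k)\<^sup>2) \<le> ennreal (A\<^sup>2)" using f by (simp add: l2_weighted_def F_def)
    have G2: "nsum (\<lambda>k. (G k)\<^sup>2) \<le> ennreal (B\<^sup>2)" using g by (simp add: l2_weighted_def G_def)
    have H2: "nsum (\<lambda>k. (H k)\<^sup>2) \<le> ennreal (C\<^sup>2)" using h by (simp add: l2_weighted_def H_def)
    have g1: "nsum g' \<le> ennreal (embed_const * B)" unfolding g'_def by (rule l2_weighted_l1(1)[OF g s])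
    have h1: "nsum h' \<le> ennreal (embed_const * C)" unfolding h'_def by (rule l2_weighted_l1(1)[OF h s])
    show "conv3 F G h' k \<le> ennreal (A * B * (embed_const * C))"
      using nn by (intro conv3_le F2 G2 h1) auto
    then show "conv3 F G h' k \<le> ennreal (A * B * (embed_const * C))" .
    show "conv3 F g' H k \<le> ennreal (A * C * (embed_const * B))"
      unfolding conv3_commute23[of F g'] using nn by (intro conv3_le F2 H2 g1) auto
  qed auto
  also have "\<dots> = ennreal (K * (A * B * (embed_const * C) + A * B * (embed_const * C) + A * C * (embed_const * B)))"
    using K nn by (simp only: ennreal_mult ennreal_plus mult_nonneg_nonneg embed_const_nonneg add_nonneg_nonneg)
  also have "K * (A * B * (embed_const * C) + A * B * (embed_const * C) + A * C * (embed_const * B)) =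
    (3 powr (s - 1) * 3) * embed_const * bracket k powr (1 - s) * M * A * B * C"
    by (simp add: K_def)
  also have "(3::real) powr (s - 1) * 3 = 3 powr s"
    using powr_add[of "3::real" "s - 1" 1] by simp
  finally show ?thesis .
qed

lemma nsum_l2_pair:
  assumes a: "l2_weighted s A a" and b: "l2_weighted s B b" and s: "s \<ge> 1"
  shows "nsum (\<lambda>j. ennreal (bracket j * (cmod (a j) * cmod (b j)))) \<le> ennreal (A * B)"
proof (rule ennreal_le_of_square)
  have nn: "A \<ge> 0" "B \<ge> 0" using a b by (auto simp: l2_weighted_def)
  then show "A * B \<ge> 0" by simp
  let ?f = "\<lambda>j::int. (wt s a j)"
  let ?g = "\<lambda>j::int. (wt s b j)"
  have "ennreal (bracket j * (cmod (a j) * cmod (b j))) \<le> ?f j * ?g j" for j :: int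
  proof -
    have 1: "bracket j \<le> bracket j powr s" using powr_mono[OF s, of "bracket j"] by simp
    have 2: "1 \<le> bracket j powr s" using s by (intro ge_one_powr_ge_zero) auto
    have "bracket j * (cmod (a j) * (1 * cmod (b j))) \<le> bracket j powr s * (cmod (a j) * (bracket j powr s * cmod (b j)))"
      by (intro mult_mono 1 mult_right_mono 2 order_refl mult_nonneg_nonneg) auto
    then show ?thesis by (simp add: ennreal_mult[symmetric] mult_ac ennreal_leI)
  qed
  then have "nsum (\<lambda>j. ennreal (bracket j * (cmod (a j) * cmod (b j)))) \<le> nsum (\<lambda>j. ?f j * ?g j)"
    by (rule nsum_mono)
  then have "(nsum (\<lambda>j. ennreal (bracket j * (cmod (a j) * cmod (b j)))))\<^sup>2 \<le> (nsum (\<lambda>j. ?f j * ?g j))\<^sup>2"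
    by (rule power_mono) simp
  also have "\<dots> \<le> nsum (\<lambda>j. (?f j)\<^sup>2) * nsum (\<lambda>j. (?g j)\<^sup>2)" by (rule nsum_CS)
  also have "\<dots> \<le> ennreal (A\<^sup>2) * ennreal (B\<^sup>2)"
    using a b by (intro mult_mono) (auto simp: l2_weighted_def)
  also have "\<dots> = ennreal ((A * B)\<^sup>2)" by (simp add: ennreal_mult power_mult_distrib)
  finally show "(nsum (\<lambda>j. ennreal (bracket j * (cmod (a j) * cmod (b j)))))\<^sup>2 \<le> ennreal ((A * B)\<^sup>2)" .
qed

lemma nsum_l2_pair_weight:
  fixes v :: "int \<Rightarrow> complex"
  assumes a: "l2_weighted s A a" and b: "l2_weighted s B b" and s: "s \<ge> 1"
    and v: "\<And>j. cmod (v j) \<le> K * bracket j" and K: "K \<ge> 0"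
  shows "nsum (\<lambda>j. ennreal (cmod (v j * (a j * cnj (b j))))) \<le> ennreal (K * (A * B))"
proof -
  have "nsum (\<lambda>j. ennreal (cmod (v j * (a j * cnj (b j)))))
      \<le> nsum (\<lambda>j. ennreal K * ennreal (bracket j * (cmod (a j) * cmod (b j))))"
  proof (rule nsum_mono)
    fix j
    have "cmod (v j * (a j * cnj (b j))) \<le> K * bracket j * (cmod (a j) * cmod (b j))"
      unfolding norm_mult complex_mod_cnj by (intro mult_right_mono v) auto
    then show "ennreal (cmod (v j * (a j * cnj (b j)))) \<le> ennreal K * ennreal (bracket j * (cmod (a j) * cmod (b j)))"
      using K by (simp add: ennreal_mult[symmetric] mult.assoc ennreal_leI)
  qed
  also have "\<dots> \<le> ennreal K * ennreal (A * B)"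
    unfolding nsum_cmult by (intro mult_left_mono nsum_l2_pair[OF a b s]) auto
  finally show ?thesis using K a b by (simp add: ennreal_mult l2_weighted_def)
qed

section \<open>The resonant multiplier and its real part\<close>

context raman_nls
begin

lemma abs_diff_le_bracket: "\<bar>real_of_int (k - j)\<bar> \<le> bracket k * bracket j"
proof -
  have "0 \<le> \<bar>real_of_int k\<bar> * \<bar>real_of_int j\<bar>" by simp
  then have "\<bar>real_of_int k\<bar> + \<bar>real_of_int j\<bar> \<le> (1 + \<bar>real_of_int k\<bar>) * (1 + \<bar>real_of_int j\<bar>)"
    by (simp add: distrib_left distrib_right)
  moreover have "\<bar>real_of_int (k - j)\<bar> \<le> \<bar>real_of_int k\<bar> + \<bar>real_of_int j\<bar>" by simp
  ultimately show ?thesis unfolding bracket_def by linarith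
qed

text \<open>
  The interactions with \<open>i = k\<close> or \<open>i + j = 0\<close> do not oscillate. Together they multiply the mode \<open>k\<close> by
  \<open>nu k a\<close>; the last term in \<open>bil\<close> corrects for counting \<open>i = k, j = - k\<close> twice.
\<close>

definition vnu :: "int \<Rightarrow> int \<Rightarrow> complex" where
  "vnu k j = 2 * symc k 0 + of_real \<Gamma> * of_int (k - j)"

definition bil :: "int \<Rightarrow> (int \<Rightarrow> complex) \<Rightarrow> (int \<Rightarrow> complex) \<Rightarrow> complex" where
  "bil k a b = 1 / of_real (2 * pi) * (csum (\<lambda>j. vnu k j * (a j * cnj (b j))) - symc k 0 * (a k * cnj (b k)))"

definition nu :: "int \<Rightarrow> (int \<Rightarrow> complex) \<Rightarrow> complex" where
  "nu k a = bil k a a"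

lemma cmod_vnu: "cmod (vnu k j) \<le> 3 * Ks * bracket k * bracket j"
proof -
  have c: "cmod (symc k 0) \<le> Ks * bracket k * bracket j"
  proof -
    have "cmod (symc k 0) \<le> Ks * bracket k * 1" using symc_le[of k 0] by simp
    also have "\<dots> \<le> Ks * bracket k * bracket j" using Ks_pos by (intro mult_left_mono) auto
    finally show ?thesis .
  qed
  have "\<Gamma> * \<bar>real_of_int (k - j)\<bar> \<le> Ks * (bracket k * bracket j)"
    using Gamma_pos by (intro mult_mono abs_diff_le_bracket) (auto simp: Ks_def)
  moreover have "cmod (of_real \<Gamma> * of_int (k - j)) = \<Gamma> * \<bar>real_of_int (k - j)\<bar>"
    unfolding norm_mult norm_of_int norm_of_real using Gamma_pos by simp
  moreover have "cmod (vnu k j) \<le> 2 * cmod (symc k 0) + cmod (of_real \<Gamma> * of_int (k - j))"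
    unfolding vnu_def by (rule order_trans[OF norm_triangle_ineq]) (simp add: norm_mult)
  ultimately show ?thesis using c by (simp add: mult.assoc)
qed

lemma
  assumes a: "l2_weighted s A a" and b: "l2_weighted s B b"
  shows csummable_bil: "csummable (\<lambda>j. vnu k j * (a j * cnj (b j)))"
    and cmod_bil: "cmod (bil k a b) \<le> Ks * bracket k * (A * B)"
proof -
  have nn: "A \<ge> 0" "B \<ge> 0" using a b by (auto simp: l2_weighted_def)
  have K: "3 * Ks * bracket k \<ge> 0" using Ks_pos by simp
  have 1: "nsum (\<lambda>j. ennreal (cmod (vnu k j * (a j * cnj (b j))))) \<le> ennreal (3 * Ks * bracket k * (A * B))"
    by (rule nsum_l2_pair_weight[OF a b s1 cmod_vnu K])
  then show "csummable (\<lambda>j. vnu k j * (a j * cnj (b j)))" by (rule csummableI)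
  have "ennreal (cmod (csum (\<lambda>j. vnu k j * (a j * cnj (b j))))) \<le> ennreal (3 * Ks * bracket k * (A * B))"
    using cmod_csum_le 1 by (rule order_trans)
  then have 2: "cmod (csum (\<lambda>j. vnu k j * (a j * cnj (b j)))) \<le> 3 * Ks * bracket k * (A * B)"
    using K nn by (simp add: ennreal_le_iff)
  have p: "cmod (c k) \<le> C" if "l2_weighted s C c" for c C
    by (rule l2_weighted_norm_le[OF that]) (use s1 in simp)
  have "cmod (symc k 0 * (a k * cnj (b k))) \<le> (Ks * bracket k) * (A * B)"
    unfolding norm_mult complex_mod_cnj
    using symc_le[of k 0] p[OF a] p[OF b] nn Ks_pos by (intro mult_mono) auto
  with 2 have 3: "cmod (csum (\<lambda>j. vnu k j * (a j * cnj (b j))) - symc k 0 * (a k * cnj (b k)))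
     \<le> 4 * (Ks * bracket k * (A * B))"
    using norm_triangle_ineq4[of "csum (\<lambda>j. vnu k j * (a j * cnj (b j)))" "symc k 0 * (a k * cnj (b k))"]
    by linarith
  have "cmod (bil k a b) = 1 / (2 * pi) * cmod (csum (\<lambda>j. vnu k j * (a j * cnj (b j))) - symc k 0 * (a k * cnj (b k)))"
    unfolding bil_def norm_mult by (simp add: norm_divide)
  \<comment> \<open>The two preceding bounds add up to the factor 3 + 1 = 4, which is below
    \<open>2 * pi\<close>.\<close>
  also have "\<dots> \<le> 1 / 4 * (4 * (Ks * bracket k * (A * B)))"
    using pi_gt3 by (intro mult_mono 3) (auto simp: field_simps)
  finally show "cmod (bil k a b) \<le> Ks * bracket k * (A * B)" by simp
qed

text \<open>Polarisation, the reason for giving \<open>bil\<close> two arguments: it bounds the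
  increment of the quadratic \<open>nu\<close> linearly in \<open>a - b\<close>.\<close>

lemma nu_diff:
  assumes a: "l2_weighted s A a" and b: "l2_weighted s B b"
  shows "nu k a - nu k b = bil k (\<lambda>i. a i - b i) a + bil k b (\<lambda>i. a i - b i)"
proof -
  have d: "l2_weighted s (2 * (A + B)) (\<lambda>i. a i - b i)"
    using l2_weighted_add[OF a, of B "\<lambda>i. - b i"] b by (simp add: l2_weighted_uminus)
  note int = csummable_bil[OF a a, of k] csummable_bil[OF b b, of k] csummable_bil[OF d a, of k] csummable_bil[OF b d, of k]
  define t0 t1 t2 where "t0 = (\<lambda>j. vnu k j * (b j * cnj (b j)))" and "t1 = (\<lambda>j. vnu k j * ((a j - b j) * cnj (a j)))"
    and "t2 = (\<lambda>j. vnu k j * (b j * cnj (a j - b j)))"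
  have "(\<lambda>j. vnu k j * (a j * cnj (a j))) = (\<lambda>j. t0 j + (t1 j + t2 j))"
    by (auto simp: t0_def t1_def t2_def algebra_simps)
  then have "csum (\<lambda>j. vnu k j * (a j * cnj (a j))) = csum t0 + (csum t1 + csum t2)"
    using int by (simp add: t0_def t1_def t2_def)
  then have "nu k a = 1 / of_real (2 * pi) * ((csum t0 + (csum t1 + csum t2)) - symc k 0 * (a k * cnj (a k)))"
    by (simp only: nu_def bil_def)
  then show ?thesis
    unfolding nu_def[of k b] bil_def t0_def[symmetric] t1_def[symmetric] t2_def[symmetric]
    by (simp add: add_divide_distrib diff_divide_distrib algebra_simps)
qed

lemma tendsto_nu:
  assumes a: "\<And>t. t \<in> S \<Longrightarrow> l2_weighted s R (a t)"
    and d: "\<And>t. t \<in> S \<Longrightarrow> l2_weighted s (sobolev_seq_norm s (\<lambda>i. a t i - a t' i)) (\<lambda>i. a t i - a t' i)"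
    and lim: "((\<lambda>t. sobolev_seq_norm s (\<lambda>i. a t i - a t' i)) \<longlongrightarrow> 0) (at t' within S)"
    and t': "t' \<in> S"
  shows "((\<lambda>t. nu k (a t)) \<longlongrightarrow> nu k (a t')) (at t' within S)"
proof -
  define N where "N t = sobolev_seq_norm s (\<lambda>i. a t i - a t' i)" for t
  have "cmod (nu k (a t) - nu k (a t')) \<le> 2 * Ks * bracket k * R * N t" if t: "t \<in> S" for t
  proof -
    note d' = d[OF t, folded N_def] and at = a[OF t] and at' = a[OF t']
    have "cmod (nu k (a t) - nu k (a t')) \<le> Ks * bracket k * (N t * R) + Ks * bracket k * (R * N t)"
      unfolding nu_diff[OF at at'] by (intro order_trans[OF norm_triangle_ineq] add_mono cmod_bil d' at at')
    then show ?thesis by (simp add: mult_ac)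
  qed
  then have "eventually (\<lambda>t. cmod (nu k (a t) - nu k (a t')) \<le> 2 * Ks * bracket k * R * N t) (at t' within S)"
    by (auto simp: eventually_at_filter)
  moreover have "((\<lambda>t. 2 * Ks * bracket k * R * N t) \<longlongrightarrow> 0) (at t' within S)"
    using tendsto_mult_left[OF lim, of "2 * Ks * bracket k * R"] by (simp add: N_def)
  ultimately have "((\<lambda>t. nu k (a t) - nu k (a t')) \<longlongrightarrow> 0) (at t' within S)"
    by (rule Lim_null_comparison)
  then show ?thesis by (simp add: Lim_null[symmetric])
qed

text \<open>The summands \<open>(k - j) |a_j|^2\<close> are negative for \<open>j > k\<close>.
  Adding \<open><j> |a_j|^2\<close> makes all of them nonnegative when \<open>k >= 0\<close>, at a
  total cost of at most \<open>R^2\<close>; then only the summand \<open>j = 0\<close> is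
  kept.\<close>

lemma Re_nu_ge:
  assumes a: "l2_weighted s R a" and k: "k \<ge> 0"
  shows "Re (nu k a) \<ge> \<Gamma> / (2 * pi) * (of_int k * (cmod (a 0))\<^sup>2 - R\<^sup>2)"
proof -
  let ?A = "\<lambda>j. (cmod (a j))\<^sup>2"
  have Rs: "Re (symc k 0) = 0" by (simp add: symc_def)
  have re: "Re (vnu k j * (a j * cnj (a j))) = \<Gamma> * (of_int (k - j) * ?A j)" for j
    by (simp add: vnu_def Rs complex_norm_square[symmetric] symc_def flip: of_real_power)
  have int1: "integrable (count_space UNIV) (\<lambda>j. of_int (k - j) * ?A j)"
    using integrable_Re[OF csummable_bil[OF a a, of k]] Gamma_pos unfolding re by simp
  have pr: "nsum (\<lambda>j. ennreal (bracket j * ?A j)) \<le> ennreal (R\<^sup>2)"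
    using nsum_l2_pair[OF a a s1] by (simp add: power2_eq_square)
  have int2: "integrable (count_space UNIV) (\<lambda>j::int. bracket j * ?A j)"
    using pr by (auto simp: integrable_iff_bounded abs_mult intro: le_less_trans[OF _ ennreal_less_top])
  have "ennreal (LINT j|count_space UNIV. bracket j * ?A j) \<le> ennreal (R\<^sup>2)"
    using pr nn_integral_eq_integral[OF int2] by simp
  then have S: "(LINT j|count_space UNIV. bracket j * ?A j) \<le> R\<^sup>2"
    by (simp add: ennreal_le_iff)
  define g where "g j = of_int (k - j) * ?A j + bracket j * ?A j" for j :: int
  have intg: "integrable (count_space UNIV) g" unfolding g_def using int1 int2 by simp
  have g0: "g j \<ge> 0" for j
  proof -
    have "g j = (of_int (k - j) + bracket j) * ?A j" by (simp add: g_def distrib_right)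
    also have "\<dots> \<ge> 0" using k by (intro mult_nonneg_nonneg) (auto simp: bracket_def)
    finally show ?thesis .
  qed
  have "ennreal (g 0) \<le> nsum (\<lambda>j. ennreal (g j))" by (rule nn_integral_ge_point) auto
  also have "\<dots> = ennreal (LINT j|count_space UNIV. g j)" using g0 by (intro nn_integral_eq_integral intg) auto
  finally have "g 0 \<le> (LINT j|count_space UNIV. g j)"
    using g0 by (subst (asm) ennreal_le_iff) (auto intro: integral_nonneg_AE)
  moreover have "of_int k * ?A 0 \<le> g 0" by (simp add: g_def bracket_def)
  moreover have "(LINT j|count_space UNIV. g j) = (LINT j|count_space UNIV. of_int (k - j) * ?A j) + (LINT j|count_space UNIV. bracket j * ?A j)"
    unfolding g_def using int1 int2 by simp
  ultimately have *: "of_int k * ?A 0 - R\<^sup>2 \<le> (LINT j|count_space UNIV. of_int (k - j) * ?A j)"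
    using S by linarith
  have "Re (symc k 0 * (a k * cnj (a k))) = 0"
    by (simp add: Rs complex_norm_square[symmetric] flip: of_real_power)
  then have "Re (nu k a) = 1 / (2 * pi) * Re (csum (\<lambda>j. vnu k j * (a j * cnj (a j))))"
    unfolding nu_def bil_def by (simp flip: of_real_mult)
  also have "Re (csum (\<lambda>j. vnu k j * (a j * cnj (a j)))) = (LINT j|count_space UNIV. \<Gamma> * (of_int (k - j) * ?A j))"
    unfolding re[symmetric] by (rule integral_Re[symmetric]) (rule csummable_bil[OF a a])
  also have "\<dots> = \<Gamma> * (LINT j|count_space UNIV. of_int (k - j) * ?A j)" by simp
  finally have "Re (nu k a) = \<Gamma> / (2 * pi) * (LINT j|count_space UNIV. of_int (k - j) * ?A j)" by simp
  then show ?thesis using mult_left_mono[OF *, of "\<Gamma> / (2 * pi)"] Gamma_pos by simp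
qed

text \<open>With \<open>l = k - i - j\<close> the condition \<open>i \<noteq> k\<close> reads
  \<open>j + l \<noteq> 0\<close>. The third factor of the phase, which contains
  \<open>i + l\<close>, never vanishes by non-integrality, so \<open>i + l = 0\<close> is not
  excluded.\<close>

definition nonres :: "int \<Rightarrow> int \<times> int \<Rightarrow> bool" where
  "nonres k = (\<lambda>(i, j). i \<noteq> k \<and> i + j \<noteq> 0)"

definition nrterm :: "int \<Rightarrow> (int \<Rightarrow> complex) \<Rightarrow> int \<times> int \<Rightarrow> complex" where
  "nrterm k a \<kappa> = (if nonres k \<kappa> then full.term3 a a a k \<kappa> else 0)"

lemma csummable_if: "csummable f \<Longrightarrow> csummable (\<lambda>\<kappa>. if P \<kappa> then f \<kappa> else 0)"
  by (rule Bochner_Integration.integrable_bound) auto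

lemma csum_pair_single:
  fixes f :: "int \<times> int \<Rightarrow> complex"
  assumes "csummable f"
  shows "csum (\<lambda>\<kappa>. if fst \<kappa> = k then f \<kappa> else 0) = csum (\<lambda>j. f (k, j))"
    and "csum (\<lambda>\<kappa>. if fst \<kappa> + snd \<kappa> = 0 then f \<kappa> else 0) = csum (\<lambda>i. f (i, - i))"
    and "csum (\<lambda>\<kappa>. if fst \<kappa> = k \<and> fst \<kappa> + snd \<kappa> = 0 then f \<kappa> else 0) = f (k, - k)"
proof -
  have c: "csum (\<lambda>j. if P then F j else 0) = (if P then csum F else 0)" for P and F :: "int \<Rightarrow> complex"
    by simp
  have "csum (\<lambda>\<kappa>. if fst \<kappa> = k then f \<kappa> else 0) = csum (\<lambda>i. csum (\<lambda>j. if i = k then f (i, j) else 0))"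
    using csum_pair(1)[OF csummable_if[OF assms, of "\<lambda>\<kappa>. fst \<kappa> = k"]] by simp
  also have "\<dots> = csum (\<lambda>i. if i = k then csum (\<lambda>j. f (k, j)) else 0)"
    by (rule Bochner_Integration.integral_cong) auto
  finally show "csum (\<lambda>\<kappa>. if fst \<kappa> = k then f \<kappa> else 0) = csum (\<lambda>j. f (k, j))"
    unfolding csum_single .
  have j: "(if i + j = 0 then f (i, j) else 0) = (if j = - i then f (i, - i) else 0)" for i j
  proof -
    have "i + j = 0 \<longleftrightarrow> j = - i" by auto
    then show ?thesis by auto
  qed
  have "csum (\<lambda>\<kappa>. if fst \<kappa> + snd \<kappa> = 0 then f \<kappa> else 0) = csum (\<lambda>i. csum (\<lambda>j. if i + j = 0 then f (i, j) else 0))"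
    using csum_pair(1)[OF csummable_if[OF assms, of "\<lambda>\<kappa>. fst \<kappa> + snd \<kappa> = 0"]] by simp
  then show "csum (\<lambda>\<kappa>. if fst \<kappa> + snd \<kappa> = 0 then f \<kappa> else 0) = csum (\<lambda>i. f (i, - i))"
    unfolding j csum_single .
  have "(if fst \<kappa> = k \<and> fst \<kappa> + snd \<kappa> = 0 then f \<kappa> else 0) = (if \<kappa> = (k, - k) then f (k, - k) else 0)" for \<kappa>
    by (cases \<kappa>) (auto simp: add_eq_0_iff)
  then show "csum (\<lambda>\<kappa>. if fst \<kappa> = k \<and> fst \<kappa> + snd \<kappa> = 0 then f \<kappa> else 0) = f (k, - k)"
    using csum_single[of "(k, - k)" "f (k, - k)"] by simp
qed

text \<open>Inclusion and exclusion over the two resonant lines, which meet only in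
  \<open>(k, - k)\<close>. There the quadratic factor has frequency 0 and the Raman symbol vanishes,
  so the correction involves \<open>symc k 0\<close> alone.\<close>

lemma resonance_decomposition:
  assumes a: "l2_weighted s R a"
  shows "full.Tri a a a k = nu k a * a k + 1 / of_real (2 * pi) * csum (nrterm k a)"
proof -
  let ?f = "full.term3 a a a k"
  have sf: "csummable ?f" by (rule full.csummable_term3[OF a a a])
  define g1 g2 g3 where "g1 \<kappa> = (if fst \<kappa> = k then ?f \<kappa> else 0)"
    and "g2 \<kappa> = (if fst \<kappa> + snd \<kappa> = 0 then ?f \<kappa> else 0)"
    and "g3 \<kappa> = (if fst \<kappa> = k \<and> fst \<kappa> + snd \<kappa> = 0 then ?f \<kappa> else 0)" for \<kappa>
  have sm: "csummable g1" "csummable g2" "csummable g3" "csummable (nrterm k a)"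
    unfolding g1_def g2_def g3_def nrterm_def by (intro csummable_if sf)+
  have "?f \<kappa> + g3 \<kappa> = nrterm k a \<kappa> + g1 \<kappa> + g2 \<kappa>" for \<kappa>
    by (cases \<kappa>) (auto simp: g1_def g2_def g3_def nrterm_def nonres_def)
  then have "csum (\<lambda>\<kappa>. ?f \<kappa> + g3 \<kappa>) = csum (\<lambda>\<kappa>. nrterm k a \<kappa> + g1 \<kappa> + g2 \<kappa>)" by simp
  then have 1: "csum ?f + csum g3 = csum (nrterm k a) + csum g1 + csum g2"
    using sf sm by simp
  have sym: "symf k m = symc k 0 + of_real \<Gamma> * of_int m" for m
    by (simp add: symf_def symr_def symc_def)
  have "csum g1 = csum (\<lambda>j. ?f (k, j))" unfolding g1_def by (rule csum_pair_single(1)[OF sf])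
  also have "\<dots> = csum (\<lambda>j. ?f (k, - j))"
    by (rule csum_reindex[symmetric]) (rule involuntory_imp_bij, simp)
  also have "(\<lambda>j. ?f (k, - j)) = (\<lambda>j. a k * (symf k (k - j) * (a j * cnj (a j))))"
    by (auto simp: full.term3_def mult_ac)
  finally have g1: "csum g1 = csum (\<lambda>j. a k * (symf k (k - j) * (a j * cnj (a j))))" .
  have "csum g2 = csum (\<lambda>i. ?f (i, - i))" unfolding g2_def by (rule csum_pair_single(2)[OF sf])
  also have "(\<lambda>i. ?f (i, - i)) = (\<lambda>j. a k * (symf k 0 * (a j * cnj (a j))))"
    by (auto simp: full.term3_def mult_ac)
  finally have g2: "csum g2 = csum (\<lambda>j. a k * (symf k 0 * (a j * cnj (a j))))" .
  have g3: "csum g3 = a k * (symf k 0 * (a k * cnj (a k)))"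
    unfolding g3_def csum_pair_single(3)[OF sf] by (simp add: full.term3_def mult_ac)
  have sg: "csummable (\<lambda>j. a k * (symf k (k - j) * (a j * cnj (a j))))"
    "csummable (\<lambda>j. a k * (symf k 0 * (a j * cnj (a j))))"
  proof -
    have b: "bracket k \<le> bracket k * bracket j" for j :: int
      using mult_left_mono[of 1 "bracket j" "bracket k"] by simp
    have v: "cmod (symf k (k - j)) \<le> (2 * Ks * bracket k) * bracket j" for j
    proof -
      have "cmod (symf k (k - j)) \<le> Ks * (bracket k * bracket j + bracket k * bracket j)"
        using Ks_pos by (intro order_trans[OF symf_le] mult_left_mono add_mono b abs_diff_le_bracket) auto
      then show ?thesis by (simp add: mult_ac)
    qed
    have v0: "cmod (symf k 0) \<le> (2 * Ks * bracket k) * bracket j" for j :: int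
    proof -
      have "cmod (symf k 0) \<le> Ks * (bracket k * bracket j)"
        using Ks_pos by (intro order_trans[OF symf_le] mult_left_mono) (auto simp: b)
      also have "\<dots> \<le> 2 * (Ks * (bracket k * bracket j))" using Ks_pos by simp
      finally show ?thesis by (simp add: mult_ac)
    qed
    have K: "2 * Ks * bracket k \<ge> 0" using Ks_pos by simp
    show "csummable (\<lambda>j. a k * (symf k (k - j) * (a j * cnj (a j))))"
      by (intro integrable_mult_right csummableI[OF nsum_l2_pair_weight[OF a a s1 v K]])
    show "csummable (\<lambda>j. a k * (symf k 0 * (a j * cnj (a j))))"
      by (intro integrable_mult_right csummableI[OF nsum_l2_pair_weight[OF a a s1 v0 K]])
  qed
  have "csum g1 + csum g2 = csum (\<lambda>j. a k * (vnu k j * (a j * cnj (a j))))"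
    unfolding g1 g2 using sg
    by (subst Bochner_Integration.integral_add[symmetric]) (auto simp: vnu_def sym algebra_simps intro!: Bochner_Integration.integral_cong)
  also have "\<dots> = a k * csum (\<lambda>j. vnu k j * (a j * cnj (a j)))"
    by (rule integral_mult_right_zero)
  finally have X: "csum ?f = csum (nrterm k a) + a k * csum (\<lambda>j. vnu k j * (a j * cnj (a j))) - a k * (symc k 0 * (a k * cnj (a k)))"
    using 1 g3 by (simp add: sym algebra_simps)
  show ?thesis unfolding full.Tri_def nu_def bil_def X
    by (simp add: add_divide_distrib diff_divide_distrib algebra_simps)
qed

section \<open>Dispersion relation, phase and divided symbol\<close>

definition omega :: "int \<Rightarrow> real" where
  "omega k = \<alpha>\<^sub>1 * of_int k ^ 3 + \<alpha>\<^sub>2 * of_int k ^ 2"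

text \<open>The resonance function of the interaction. The plus sign at \<open>omega (- j)\<close>
  comes from the conjugated factor, whose mode has frequency \<open>- j\<close>.\<close>

definition phase :: "int \<Rightarrow> int \<Rightarrow> int \<Rightarrow> real" where
  "phase i j l = omega (i + j + l) - omega i + omega (- j) - omega l"

lemma phase_eq:
  "phase i j l = 3 * \<alpha>\<^sub>1 * (of_int (j + l) * of_int (i + j) * (of_int (i + l) + 2 * \<alpha>\<^sub>2 / (3 * \<alpha>\<^sub>1)))"
  using alpha1 by (simp add: phase_def omega_def field_simps power2_eq_square power3_eq_cube)

text \<open>
  The symbol divided by the phase, that is, what integration by parts in time leaves of the symbol.
\<close>

definition ratio :: "int \<Rightarrow> int \<Rightarrow> int \<Rightarrow> real" where
  "ratio i j l = (if j + l \<noteq> 0 \<and> i + j \<noteq> 0 then cmod (symf (i + j + l) (i + j)) / \<bar>phase i j l\<bar> else 0)"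

lemma phase_nonzero:
  assumes "j + l \<noteq> 0" "i + j \<noteq> 0" shows "phase i j l \<noteq> 0"
proof -
  have "of_int (i + l) + 2 * \<alpha>\<^sub>2 / (3 * \<alpha>\<^sub>1) \<noteq> 0"
  proof
    assume "of_int (i + l) + 2 * \<alpha>\<^sub>2 / (3 * \<alpha>\<^sub>1) = 0"
    then have "2 * \<alpha>\<^sub>2 / (3 * \<alpha>\<^sub>1) = of_int (- (i + l))" by simp
    then show False using nonint by (metis Ints_of_int)
  qed
  then show ?thesis unfolding phase_eq using alpha1 assms by (simp del: of_int_add)
qed

text \<open>Off the resonances \<open>p\<close> and \<open>q\<close> are at least 1, and
  non-integrality bounds the third factor of the phase below by a multiple of
  \<open>S = <i + l>\<close>. Since \<open>k\<close> is one frequency plus the sum of the other two,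
  \<open>k / p <= <i>\<close>, \<open>k / S <= <j>\<close> and \<open>k / q <= <l>\<close>, which is
  the input of \<open>gain_triple\<close>. The 3 in \<open>C\<close> adds up the parts
  \<open>2 k\<close> and \<open>q\<close> of the symbol bound.\<close>

lemma ratio_bounded: "\<exists>C\<ge>0. \<forall>k::int. k \<ge> 1 \<longrightarrow> pair_bounded (C * of_int k powr - (1/4)) k ratio"
proof -
  obtain \<delta> where \<delta>: "\<delta> > 0" "\<And>n::int. \<delta> * bracket n \<le> \<bar>of_int n + 2 * \<alpha>\<^sub>2 / (3 * \<alpha>\<^sub>1)\<bar>"
    using nonint_gap[OF nonint] by blast
  define D where "D = 3 * \<bar>\<alpha>\<^sub>1\<bar> * \<delta>"
  have D: "D > 0" using alpha1 \<delta>(1) by (simp add: D_def)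
  define C where "C = 3 * Ks / D"
  have C: "C \<ge> 0" using D Ks_pos by (simp add: C_def)
  have "pair_bounded (C * of_int k powr - (1/4)) k ratio" if k: "k \<ge> 1" for k :: int
    unfolding pair_bounded_def
  proof (intro conjI[OF mult_nonneg_nonneg[OF C powr_ge_zero]] allI impI)
    fix i j l :: int assume ijl: "i + j + l = k"
    let ?F = "\<lambda>b G. 0 \<le> G \<and> G \<le> (1::real) \<and> of_int k * G \<le> bracket (of_int b)"
    show "0 \<le> ratio i j l \<and> (\<forall>(x, y)\<in>{(i, j), (j, i), (i, l), (l, i), (j, l), (l, j)}.
       ratio i j l \<le> C * of_int k powr - (1/4) * (bracket x * bracket y powr (1/4)))"
    proof (cases "j + l \<noteq> 0 \<and> i + j \<noteq> 0")
      case False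
      then show ?thesis using C by (auto simp: ratio_def)
    next
      case True
      define p q S where "p = \<bar>real_of_int (j + l)\<bar>" and "q = \<bar>real_of_int (i + j)\<bar>" and "S = bracket (of_int (i + l))"
      have pq: "p \<ge> 1" "q \<ge> 1" "S \<ge> 1" using True by (auto simp: p_def q_def S_def)
      have F: "?F b (1 / r)" if "r \<ge> 1" "of_int k \<le> r * bracket (of_int b)" for r b
        using that by (auto simp: field_simps)
      \<comment> \<open>Used to read \<open>k <= p * <i>\<close> off \<open>k = i + (j + l)\<close>,
        and likewise for the other two splittings.\<close>
      have le: "x + y \<le> y' * (1 + x')" if "\<bar>x\<bar> \<le> x'" "\<bar>y\<bar> \<le> y'" "y' \<ge> 1" for x y x' y' :: real
      proof -
        have "x' \<ge> 0" using that(1) by linarith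
        then have "x' \<le> y' * x'" using mult_right_mono[OF that(3), of x'] by simp
        then show ?thesis using that by (simp add: distrib_left)
      qed
      have F1: "?F i (1 / p)"
      proof (rule F[OF pq(1)])
        have "real_of_int k = of_int i + of_int (j + l)" by (simp flip: ijl)
        also have "\<dots> \<le> p * (1 + \<bar>real_of_int i\<bar>)" by (rule le) (use pq in \<open>auto simp: p_def\<close>)
        finally show "of_int k \<le> p * bracket i" by (simp add: bracket_def)
      qed
      have F2: "?F j (1 / S)"
      proof (rule F[OF pq(3)])
        have "real_of_int k = of_int j + of_int (i + l)" by (simp flip: ijl)
        also have "\<dots> \<le> S * (1 + \<bar>real_of_int j\<bar>)" by (rule le) (use pq in \<open>auto simp: S_def bracket_def\<close>)
        finally show "of_int k \<le> S * bracket j" by (simp add: bracket_def)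
      qed
      have F3: "?F l (1 / q)"
      proof (rule F[OF pq(2)])
        have "real_of_int k = of_int l + of_int (i + j)" by (simp flip: ijl)
        also have "\<dots> \<le> q * (1 + \<bar>real_of_int l\<bar>)" by (rule le) (use pq in \<open>auto simp: q_def\<close>)
        finally show "of_int k \<le> q * bracket l" by (simp add: bracket_def)
      qed
      have ph: "D * (p * q * S) \<le> \<bar>phase i j l\<bar>"
      proof -
        have "D * (p * q * S) = 3 * \<bar>\<alpha>\<^sub>1\<bar> * (p * q * (\<delta> * S))" by (simp add: D_def)
        also have "\<dots> \<le> 3 * \<bar>\<alpha>\<^sub>1\<bar> * (p * q * \<bar>of_int (i + l) + 2 * \<alpha>\<^sub>2 / (3 * \<alpha>\<^sub>1)\<bar>)"
          unfolding S_def using pq by (intro mult_left_mono \<delta>(2)) auto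
        also have "\<dots> = \<bar>phase i j l\<bar>" unfolding phase_eq abs_mult p_def q_def by simp
        finally show ?thesis .
      qed
      have "cmod (symf k (i + j)) \<le> Ks * (bracket k + q)" using symf_le[of k "i + j"] by (simp add: q_def)
      also have "\<dots> \<le> Ks * (2 * of_int k + q)"
        using k Ks_pos by (intro mult_left_mono) (auto simp: bracket_def)
      finally have sy: "cmod (symf k (i + j)) \<le> Ks * (2 * of_int k + q)" .
      have "ratio i j l \<le> Ks * (2 * of_int k + q) / (D * (p * q * S))"
        unfolding ratio_def ijl using True sy ph D pq Ks_pos k
        by (auto intro!: frac_le mult_pos_pos simp: norm_ge_zero)
      also have "\<dots> = Ks / D * (2 * (of_int k * (1 / p) * (1 / S) * (1 / q)) + (1 / p) * (1 / S))"
        using pq D by (simp add: field_simps)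
      finally have r: "ratio i j l \<le> Ks / D * (2 * (of_int k * (1 / p) * (1 / S) * (1 / q)) + (1 / p) * (1 / S))" .
      have "ratio i j l \<le> C * of_int k powr - (1/4) * (bracket (of_int x) * bracket (of_int y) powr (1/4))"
        if "(x, y) \<in> {(i, j), (j, i), (i, l), (l, i), (j, l), (l, j)}" for x y
      proof -
        let ?B = "of_int k powr - (1/4) * (bracket (of_int x) * bracket (of_int y) powr (1/4))"
        have "of_int k * (1 / p) * (1 / S) * (1 / q) \<le> ?B \<and> (1 / p) * (1 / S) \<le> ?B"
          by (rule gain_triple[OF _ _ _ _ F1 F2 F3]) (use k that in auto)
        then have "Ks / D * (2 * (of_int k * (1 / p) * (1 / S) * (1 / q)) + (1 / p) * (1 / S)) \<le> Ks / D * (2 * ?B + ?B)"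
          using D Ks_pos by (intro mult_left_mono add_mono) auto
        with r have "ratio i j l \<le> Ks / D * (2 * ?B + ?B)" by (rule order_trans)
        then show ?thesis by (simp add: C_def mult_ac)
      qed
      then show ?thesis by (auto simp: ratio_def)
    qed
  qed
  then show ?thesis using C by blast
qed

end

section \<open>Integration by parts in time\<close>

lemma cmod_osc_integral_le:
  fixes Q Q' :: "real \<Rightarrow> complex"
  assumes "\<Phi> \<noteq> 0" "t0 \<ge> 0"
    and Q: "\<And>t. t \<in> {0..t0} \<Longrightarrow> (Q has_vector_derivative Q' t) (at t within {0..t0})"
    and Q': "continuous_on {0..t0} Q'"
  shows "cmod (integral {0..t0} (\<lambda>t. cis (\<Phi> * t) * Q t)) \<le>
    (cmod (Q 0) + cmod (Q t0) + integral {0..t0} (\<lambda>t. cmod (Q' t))) / \<bar>\<Phi>\<bar>"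
proof -
  have cQ: "continuous_on {0..t0} Q"
    unfolding continuous_on_eq_continuous_within using has_vector_derivative_continuous[OF Q] by blast
  define G where "G t = cis (\<Phi> * t) / (\<i> * of_real \<Phi>)" for t
  have G: "(G has_vector_derivative cis (\<Phi> * t)) (at t within S)" for t S
    unfolding G_def[abs_def] by (rule has_vector_derivative_cis_antideriv[OF assms(1)])
  have "((\<lambda>t. G t * Q' t + cis (\<Phi> * t) * Q t) has_integral G t0 * Q t0 - G 0 * Q 0) {0..t0}"
    using assms(2) by (intro fundamental_theorem_of_calculus has_vector_derivative_mult G Q) auto
  then have "integral {0..t0} (\<lambda>t. G t * Q' t + cis (\<Phi> * t) * Q t) = G t0 * Q t0 - G 0 * Q 0"
    by (rule integral_unique)
  moreover have cG: "continuous_on {0..t0} G"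
    unfolding continuous_on_eq_continuous_within using has_vector_derivative_continuous[OF G] by blast
  then have "integral {0..t0} (\<lambda>t. G t * Q' t + cis (\<Phi> * t) * Q t) =
    integral {0..t0} (\<lambda>t. G t * Q' t) + integral {0..t0} (\<lambda>t. cis (\<Phi> * t) * Q t)"
    by (intro Henstock_Kurzweil_Integration.integral_add integrable_continuous_interval continuous_intros cQ Q' continuous_cis_mult)
  ultimately have eq: "integral {0..t0} (\<lambda>t. cis (\<Phi> * t) * Q t) = (G t0 * Q t0 - G 0 * Q 0) - integral {0..t0} (\<lambda>t. G t * Q' t)"
    by (simp add: algebra_simps)
  have nG: "cmod (G t) = 1 / \<bar>\<Phi>\<bar>" for t by (simp add: G_def norm_divide norm_mult)
  have "cmod (integral {0..t0} (\<lambda>t. G t * Q' t)) \<le> integral {0..t0} (\<lambda>t. 1 / \<bar>\<Phi>\<bar> * cmod (Q' t))"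
    using assms(1)
    by (intro integral_norm_bound_integral)
      (auto intro!: integrable_continuous_interval continuous_intros cG Q' simp: norm_mult nG)
  also have "\<dots> = 1 / \<bar>\<Phi>\<bar> * integral {0..t0} (\<lambda>t. cmod (Q' t))"
    by (rule integral_mult_right)
  finally have "cmod (integral {0..t0} (\<lambda>t. G t * Q' t)) \<le> 1 / \<bar>\<Phi>\<bar> * integral {0..t0} (\<lambda>t. cmod (Q' t))" .
  moreover have "cmod (G t0 * Q t0 - G 0 * Q 0) \<le> 1 / \<bar>\<Phi>\<bar> * cmod (Q t0) + 1 / \<bar>\<Phi>\<bar> * cmod (Q 0)"
    by (rule order_trans[OF norm_triangle_ineq4]) (simp add: norm_mult nG)
  ultimately have "cmod (integral {0..t0} (\<lambda>t. cis (\<Phi> * t) * Q t)) \<le>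
    (1 / \<bar>\<Phi>\<bar> * cmod (Q t0) + 1 / \<bar>\<Phi>\<bar> * cmod (Q 0)) + 1 / \<bar>\<Phi>\<bar> * integral {0..t0} (\<lambda>t. cmod (Q' t))"
    unfolding eq using norm_triangle_ineq4[of "G t0 * Q t0 - G 0 * Q 0" "integral {0..t0} (\<lambda>t. G t * Q' t)"]
    by linarith
  then show ?thesis by (simp add: add_divide_distrib)
qed

text \<open>The oscillation is lost once absolute values stand inside the time integral, so sum and
  integral are exchanged first; the uniform bound \<open>C\<close> on a compact interval makes
  Fubini applicable.\<close>

lemma cmod_integral_csum_le:
  fixes f :: "real \<Rightarrow> 'k::countable \<Rightarrow> complex"
  assumes c: "\<And>\<kappa>. continuous_on {0..t0} (\<lambda>t. f t \<kappa>)" and cs: "continuous_on {0..t0} (\<lambda>t. csum (f t))"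
    and b: "\<And>t. t \<in> {0..t0} \<Longrightarrow> nsum (\<lambda>\<kappa>. ennreal (cmod (f t \<kappa>))) \<le> ennreal C"
  shows "ennreal (cmod (integral {0..t0} (\<lambda>t. csum (f t)))) \<le> nsum (\<lambda>\<kappa>. ennreal (cmod (integral {0..t0} (\<lambda>t. f t \<kappa>))))"
proof -
  let ?M = "lebesgue_on {0..t0}"
  have fin: "finite_measure ?M"
    by (rule finite_measureI) (simp add: emeasure_restrict_space space_restrict_space emeasure_lborel_Icc_eq)
  interpret pair_sigma_finite "count_space (UNIV :: 'k set)" ?M
    using fin by (intro pair_sigma_finite.intro sigma_finite_measure_count_space finite_measure.axioms)
  have int: "integrable ?M (\<lambda>t. f t \<kappa>)" for \<kappa>
    by (intro continuous_imp_integrable_real c)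
  have I: "integrable (count_space UNIV \<Otimes>\<^sub>M ?M) (case_prod (\<lambda>\<kappa> t. f t \<kappa>))"
  proof (rule Fubini_integrable)
    show "(\<lambda>(\<kappa>, t). f t \<kappa>) \<in> borel_measurable (count_space UNIV \<Otimes>\<^sub>M ?M)"
      using int by (intro measurable_pair_measure_countable1) auto
    show "AE \<kappa> in count_space UNIV. integrable ?M (\<lambda>t. case (\<kappa>, t) of (\<kappa>, t) \<Rightarrow> f t \<kappa>)"
      using int by simp
    have "nsum (\<lambda>\<kappa>. ennreal (LINT t|?M. cmod (f t \<kappa>))) = nsum (\<lambda>\<kappa>. \<integral>\<^sup>+t. ennreal (cmod (f t \<kappa>)) \<partial>?M)"
      by (intro nn_integral_cong nn_integral_eq_integral[symmetric] integrable_norm int) auto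
    also have "\<dots> = (\<integral>\<^sup>+t. nsum (\<lambda>\<kappa>. ennreal (cmod (f t \<kappa>))) \<partial>?M)"
      using int by (intro nn_integral_count_space_nn_integral[symmetric]) auto
    also have "\<dots> \<le> (\<integral>\<^sup>+t. ennreal C \<partial>?M)"
      using b by (intro nn_integral_mono) (auto simp: space_restrict_space)
    also have "\<dots> < \<infinity>"
      using finite_measure.emeasure_finite[OF fin, of "space ?M"] by (simp add: ennreal_mult_less_top less_top)
    finally show "integrable (count_space UNIV) (\<lambda>\<kappa>. LINT t|?M. norm (case (\<kappa>, t) of (\<kappa>, t) \<Rightarrow> f t \<kappa>))"
      by (simp add: integrable_iff_bounded)
  qed
  have "integral {0..t0} (\<lambda>t. csum (f t)) = (LINT t|?M. csum (f t))"
    by (intro lebesgue_integral_eq_integral[symmetric] continuous_imp_integrable_real cs) auto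
  also have "\<dots> = csum (\<lambda>\<kappa>. LINT t|?M. f t \<kappa>)" by (rule Fubini_integral[OF I])
  also have "\<dots> = csum (\<lambda>\<kappa>. integral {0..t0} (\<lambda>t. f t \<kappa>))"
    by (intro Bochner_Integration.integral_cong refl lebesgue_integral_eq_integral int) auto
  finally show ?thesis using cmod_csum_le by simp
qed

section \<open>Weighted sums with one rough factor\<close>

context raman_nls
begin

text \<open>Majorant of a trilinear product in which one factor, in any of the three slots, is
  replaced by a rough sequence \<open>y\<close>, as after a product rule.\<close>

definition Y3 :: "(int \<Rightarrow> complex) \<Rightarrow> (int \<Rightarrow> complex) \<Rightarrow> int \<Rightarrow> int \<Rightarrow> int \<Rightarrow> real" where
  "Y3 y a i j l = cmod (y i) * cmod (a (- j)) * cmod (a l) + cmod (a i) * cmod (y (- j)) * cmod (a l)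
     + cmod (a i) * cmod (a (- j)) * cmod (y l)"

lemma nsum_ratio_le:
  assumes R: "pair_bounded M k ratio" and y: "l2_weighted (s - 1) A y" and a: "l2_weighted s B a"
  shows "nsum (\<lambda>(i, j). ennreal (ratio i j (k - i - j) * Y3 y a i j (k - i - j)))
    \<le> ennreal (3 * (3 powr s * embed_const * bracket k powr (1 - s) * M * A * B * B))"
proof -
  define K where "K = 3 powr s * embed_const * bracket k powr (1 - s) * M * A * B * B"
  have K: "K \<ge> 0" using R y a by (simp add: K_def l2_weighted_def pair_bounded_def)
  have a': "l2_weighted s B (\<lambda>j. cnj (a (- j)))" and y': "l2_weighted (s - 1) A (\<lambda>j. cnj (y (- j)))"
    using a y by (simp_all only: l2_weighted_reflect)
  have 1: "nsum (\<lambda>i. nsum (\<lambda>j. ennreal (ratio i j (k - i - j) * (cmod (y i) * cmod (a (- j)) * cmod (a (k - i - j)))))) \<le> ennreal K"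
    using weighted_triple_le[OF R s1 y a' a] by (simp add: K_def)
  have 2: "nsum (\<lambda>i. nsum (\<lambda>j. ennreal (ratio i j (k - i - j) * (cmod (a i) * cmod (y (- j)) * cmod (a (k - i - j)))))) \<le> ennreal K"
  proof -
    have "nsum (\<lambda>i. nsum (\<lambda>j. ennreal (ratio i j (k - i - j) * (cmod (a i) * cmod (y (- j)) * cmod (a (k - i - j))))))
      = nsum (\<lambda>j. nsum (\<lambda>i. ennreal (ratio i j (k - j - i) * (cmod (y (- j)) * cmod (a i) * cmod (a (k - j - i))))))"
      by (subst nsum_swap) (simp add: mult_ac diff_diff_eq add.commute)
    also have "\<dots> \<le> ennreal K"
      using weighted_triple_le[OF pair_bounded_swap[OF R] s1 y' a a] by (simp add: K_def)
    finally show ?thesis .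
  qed
  have 3: "nsum (\<lambda>i. nsum (\<lambda>j. ennreal (ratio i j (k - i - j) * (cmod (a i) * cmod (a (- j)) * cmod (y (k - i - j)))))) \<le> ennreal K"
  proof -
    have "nsum (\<lambda>i. nsum (\<lambda>j. ennreal (ratio i j (k - i - j) * (cmod (a i) * cmod (a (- j)) * cmod (y (k - i - j))))))
      = nsum (\<lambda>j. nsum (\<lambda>i. ennreal (ratio i j (k - j - i) * (cmod (a i) * cmod (a (- j)) * cmod (y (k - j - i))))))"
      by (subst nsum_swap) (simp add: diff_diff_eq add.commute)
    \<comment> \<open>Reflecting \<open>i\<close> to \<open>k - j - i\<close> at fixed
      \<open>j\<close> brings the rough factor from the third slot into the first, where
      \<open>weighted_triple_le\<close> expects it.\<close>
    also have "\<dots> = nsum (\<lambda>j. nsum (\<lambda>i. ennreal (ratio (k - j - i) j i * (cmod (a (k - j - i)) * cmod (a (- j)) * cmod (y i)))))"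
    proof (rule nn_integral_cong)
      fix j :: int
      show "nsum (\<lambda>i. ennreal (ratio i j (k - j - i) * (cmod (a i) * cmod (a (- j)) * cmod (y (k - j - i)))))
        = nsum (\<lambda>i. ennreal (ratio (k - j - i) j i * (cmod (a (k - j - i)) * cmod (a (- j)) * cmod (y i))))"
        using nsum_reflect[of "\<lambda>i. ennreal (ratio i j (k - j - i) * (cmod (a i) * cmod (a (- j)) * cmod (y (k - j - i))))" "k - j"]
        by simp
    qed
    also have "\<dots> = nsum (\<lambda>i. nsum (\<lambda>j. ennreal (ratio (k - i - j) j i * (cmod (y i) * cmod (a (- j)) * cmod (a (k - i - j))))))"
      by (subst nsum_swap) (simp add: mult_ac diff_diff_eq add.commute)
    also have "\<dots> \<le> ennreal K"
      using weighted_triple_le[OF pair_bounded_swap13[OF R] s1 y a' a] by (simp add: K_def)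
    finally show ?thesis .
  qed
  have r0: "ratio i j l \<ge> 0" for i j l by (simp add: ratio_def)
  have "nsum (\<lambda>(i, j). ennreal (ratio i j (k - i - j) * Y3 y a i j (k - i - j))) =
    nsum (\<lambda>i. nsum (\<lambda>j. ennreal (ratio i j (k - i - j) * (cmod (y i) * cmod (a (- j)) * cmod (a (k - i - j))))
     + ennreal (ratio i j (k - i - j) * (cmod (a i) * cmod (y (- j)) * cmod (a (k - i - j))))
     + ennreal (ratio i j (k - i - j) * (cmod (a i) * cmod (a (- j)) * cmod (y (k - i - j))))))"
    using r0 by (subst nsum_pair) (simp add: Y3_def distrib_left ennreal_plus[symmetric] del: ennreal_plus)
  also have "\<dots> \<le> ennreal K + ennreal K + ennreal K"
    unfolding nsum_add by (intro add_mono 1 2 3)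
  also have "\<dots> = ennreal (3 * K)" using K by (simp add: ennreal_plus[symmetric] del: ennreal_plus)
  finally show ?thesis by (simp add: K_def)
qed

definition triple_const :: "real \<Rightarrow> real \<Rightarrow> int \<Rightarrow> real" where
  "triple_const R M k =
     3 * (3 powr s * embed_const * bracket k powr (1 - s) * M * (2 * (R + full.Ctri * R * R * R)) * R * R)"

text \<open>A rough majorant for two purposes: the second summand bounds the time derivative of a
  mode freed from its linear oscillation, the first absorbs a factor \<open>k\<close>. Both cost one
  derivative.\<close>

definition ybound :: "(int \<Rightarrow> complex) \<Rightarrow> int \<Rightarrow> complex" where
  "ybound a i = of_real (bracket i * cmod (a i) + cmod (full.Tri a a a i))"

lemma l2_weighted_ybound:
  assumes a: "l2_weighted s R a"
  shows "l2_weighted (s - 1) (2 * (R + full.Ctri * R * R * R)) (ybound a)"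
proof -
  have 1: "l2_weighted (s - 1) R (\<lambda>i::int. complex_of_real (bracket i * cmod (a i)))"
  proof -
    have "bracket k powr (s - 1) * cmod (complex_of_real (bracket k * cmod (a k))) = bracket k powr s * cmod (a k)" for k :: int
      using powr_add[of "bracket k" "s - 1" 1] by (simp add: norm_mult)
    then show ?thesis using a by (simp only: l2_weighted_def)
  qed
  have 2: "l2_weighted (s - 1) (full.Ctri * R * R * R) (\<lambda>i. complex_of_real (cmod (full.Tri a a a i)))"
    using full.l2_weighted_Tri[OF a a a] by (simp add: l2_weighted_def)
  show ?thesis using l2_weighted_add[OF 1 2] by (simp add: ybound_def[abs_def])
qed

end

text \<open>What the estimate needs to know about a solution, detached from function spaces, so that
  the resulting bounds visibly depend on \<open>R\<close>, \<open>t0\<close>, \<open>m\<close> and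
  the coefficients of the equation alone.\<close>

locale mode_system = raman_nls +
  fixes a :: "real \<Rightarrow> int \<Rightarrow> complex" and R t0 m :: real
  assumes t0: "t0 > 0" and m: "m > 0"
    and l2: "t \<in> {0..t0} \<Longrightarrow> l2_weighted s R (a t)"
    and deriv: "t \<in> {0..t0} \<Longrightarrow> ((\<lambda>t. a t k) has_vector_derivative rhs k (a t)) (at t within {0..t0})"
    and cont_Tri: "continuous_on {0..t0} (\<lambda>t. full.Tri (a t) (a t) (a t) k)"
    and cont_nu: "continuous_on {0..t0} (\<lambda>t. nu k (a t))"
    and low: "t \<in> {0..t0} \<Longrightarrow> m \<le> cmod (a t 0)"
begin

lemma R_nonneg: "R \<ge> 0" using l2[of 0] t0 by (simp add: l2_weighted_def)

text \<open>Half of the growth constant \<open>\<Gamma> * m^2 / (2 * pi)\<close>: the other half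
  absorbs the error \<open>R^2\<close> of \<open>Re_nu_ge\<close> once
  \<open>2 * R^2 <= k * m^2\<close>.\<close>

definition rate :: real where "rate = \<Gamma> * m\<^sup>2 / (4 * pi)"

lemma rate_pos: "rate > 0" using Gamma_pos m by (simp add: rate_def)

lemma Re_nu_rate:
  assumes "t \<in> {0..t0}" "k \<ge> 0" "2 * R\<^sup>2 \<le> of_int k * m\<^sup>2"
  shows "rate * of_int k \<le> Re (nu k (a t))"
proof -
  have "m\<^sup>2 \<le> (cmod (a t 0))\<^sup>2" using low[OF assms(1)] m by (intro power_mono) auto
  then have "of_int k * m\<^sup>2 \<le> of_int k * (cmod (a t 0))\<^sup>2" using assms(2) by (intro mult_left_mono) auto
  with assms(3) have "of_int k * m\<^sup>2 / 2 \<le> of_int k * (cmod (a t 0))\<^sup>2 - R\<^sup>2" by linarith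
  then have "\<Gamma> / (2 * pi) * (of_int k * m\<^sup>2 / 2) \<le> \<Gamma> / (2 * pi) * (of_int k * (cmod (a t 0))\<^sup>2 - R\<^sup>2)"
    using Gamma_pos by (intro mult_left_mono) auto
  also have "\<dots> \<le> Re (nu k (a t))" by (rule Re_nu_ge[OF l2[OF assms(1)] assms(2)])
  finally show ?thesis by (simp add: rate_def mult_ac)
qed

definition nurate :: real where "nurate = 2 * Ks * R\<^sup>2"

lemma cmod_nu_le:
  assumes "t \<in> {0..t0}" "k \<ge> 1" shows "cmod (nu k (a t)) \<le> nurate * of_int k"
proof -
  have "cmod (nu k (a t)) \<le> Ks * bracket k * (R * R)"
    unfolding nu_def by (rule cmod_bil[OF l2[OF assms(1)] l2[OF assms(1)]])
  also have "\<dots> \<le> Ks * (2 * of_int k) * (R * R)"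
    using assms(2) Ks_pos by (intro mult_left_mono mult_right_mono) (auto simp: bracket_def)
  finally show ?thesis by (simp add: nurate_def power2_eq_square mult_ac)
qed

lemma cont_a: "continuous_on {0..t0} (\<lambda>t. a t k)"
  unfolding continuous_on_eq_continuous_within using has_vector_derivative_continuous[OF deriv] by blast

text \<open>
  \<open>Z\<close> removes the linear oscillation from the modes, and \<open>E\<close> is the integrating factor of the
  resonant growth, so that only nonresonant interactions contribute to \<open>(E k * Z k)'\<close>.
\<close>

definition Z :: "int \<Rightarrow> real \<Rightarrow> complex" where "Z i t = cis (omega i * t) * a t i"
definition W :: "int \<Rightarrow> real \<Rightarrow> complex" where "W i t = cis (omega i * t) * full.Tri (a t) (a t) (a t) i"

lemma Z_deriv: "t \<in> {0..t0} \<Longrightarrow> (Z i has_vector_derivative W i t) (at t within {0..t0})"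
proof -
  assume t: "t \<in> {0..t0}"
  have "(Z i has_vector_derivative (cis (omega i * t) * rhs i (a t) + \<i> * of_real (omega i) * cis (omega i * t) * a t i)) (at t within {0..t0})"
    unfolding Z_def[abs_def] by (intro has_vector_derivative_mult has_vector_derivative_cis deriv t)
  moreover have "cis (omega i * t) * rhs i (a t) + \<i> * of_real (omega i) * cis (omega i * t) * a t i = W i t"
    by (simp add: W_def rhs_def omega_def algebra_simps)
  ultimately show ?thesis by simp
qed

lemma cont_Z: "continuous_on {0..t0} (Z i)"
  unfolding Z_def[abs_def] by (intro continuous_intros continuous_cis_mult cont_a)

lemma cont_W: "continuous_on {0..t0} (W i)"
  unfolding W_def[abs_def] by (intro continuous_intros continuous_cis_mult cont_Tri)

lemma norm_Z: "cmod (Z i t) = cmod (a t i)" by (simp add: Z_def norm_mult)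
lemma norm_W: "cmod (W i t) = cmod (full.Tri (a t) (a t) (a t) i)" by (simp add: W_def norm_mult)

definition E :: "int \<Rightarrow> real \<Rightarrow> complex" where "E k t = exp (- integral {0..t} (\<lambda>t. nu k (a t)))"

lemma E_deriv: "t \<in> {0..t0} \<Longrightarrow> (E k has_vector_derivative - nu k (a t) * E k t) (at t within {0..t0})"
proof -
  assume t: "t \<in> {0..t0}"
  have "((\<lambda>t. - integral {0..t} (\<lambda>t. nu k (a t))) has_vector_derivative - nu k (a t)) (at t within {0..t0})"
    by (intro has_vector_derivative_minus integral_has_vector_derivative cont_nu t)
  then have "((exp \<circ> (\<lambda>t. - integral {0..t} (\<lambda>t. nu k (a t)))) has_vector_derivative
      (- nu k (a t)) * exp (- integral {0..t} (\<lambda>t. nu k (a t)))) (at t within {0..t0})"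
    by (rule field_vector_diff_chain_within) (auto intro!: DERIV_exp has_field_derivative_at_within)
  then show ?thesis by (simp add: E_def[abs_def] o_def)
qed

lemma cont_E: "continuous_on {0..t0} (E k)"
  unfolding continuous_on_eq_continuous_within using has_vector_derivative_continuous[OF E_deriv] by blast

lemma norm_E_le:
  assumes t: "t \<in> {0..t0}" and k: "k \<ge> 0" "2 * R\<^sup>2 \<le> of_int k * m\<^sup>2"
  shows "cmod (E k t) \<le> exp (- (rate * of_int k * t))"
proof -
  have c: "continuous_on {0..t} (\<lambda>t. nu k (a t))"
    using t by (intro continuous_on_subset[OF cont_nu]) auto
  have hi: "((\<lambda>t. nu k (a t)) has_integral integral {0..t} (\<lambda>t. nu k (a t))) {0..t}"
    by (intro integrable_integral integrable_continuous_interval c)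
  have "rate * of_int k * t = integral {0..t} (\<lambda>_. rate * of_int k)" using t by simp
  also have "\<dots> \<le> integral {0..t} (\<lambda>t. Re (nu k (a t)))"
    using t k by (intro integral_le integrable_continuous_interval continuous_intros c Re_nu_rate) auto
  also have "\<dots> = Re (integral {0..t} (\<lambda>t. nu k (a t)))"
    using has_integral_linear[OF hi bounded_linear_Re] by (intro integral_unique) (simp add: o_def)
  finally show ?thesis unfolding E_def norm_exp_eq_Re by simp
qed

text \<open>The slowly varying amplitude of one interaction: by \<open>cis_phase_Q\<close> the
  integrand is \<open>Q\<close> times a pure oscillation, and the derivative of \<open>Q\<close>
  contains no dispersive term.\<close>

definition Q :: "int \<Rightarrow> int \<Rightarrow> int \<Rightarrow> real \<Rightarrow> complex" where
  "Q k i j t = E k t * (symf k (i + j) * (Z i t * cnj (Z (- j) t) * Z (k - i - j) t))"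

definition Q' :: "int \<Rightarrow> int \<Rightarrow> int \<Rightarrow> real \<Rightarrow> complex" where
  "Q' k i j t = E k t * (symf k (i + j) * (Z i t * cnj (Z (- j) t) * W (k - i - j) t
      + (Z i t * cnj (W (- j) t) + W i t * cnj (Z (- j) t)) * Z (k - i - j) t))
    + (- nu k (a t) * E k t) * (symf k (i + j) * (Z i t * cnj (Z (- j) t) * Z (k - i - j) t))"

lemma has_vector_derivative_cnj_comp:
  "(f has_vector_derivative f') F \<Longrightarrow> ((\<lambda>t. cnj (f t)) has_vector_derivative cnj f') F"
  by (rule bounded_linear.has_vector_derivative[OF bounded_linear_cnj])

lemma Q_deriv: "t \<in> {0..t0} \<Longrightarrow> (Q k i j has_vector_derivative Q' k i j t) (at t within {0..t0})"
  unfolding Q_def[abs_def] Q'_def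
  by (intro has_vector_derivative_mult has_vector_derivative_mult_right has_vector_derivative_cnj_comp E_deriv Z_deriv)

lemma cont_Q': "continuous_on {0..t0} (Q' k i j)"
  unfolding Q'_def[abs_def] by (intro continuous_intros cont_E cont_Z cont_W cont_nu)

lemma cis_phase_Q:
  "cis (phase i j (k - i - j) * t) * Q k i j t = E k t * (cis (omega k * t) * full.term3 (a t) (a t) (a t) k (i, j))"
proof -
  let ?l = "k - i - j"
  have "cis (phase i j ?l * t) * (cis (omega i * t) * cis (- (omega (- j) * t)) * cis (omega ?l * t)) = cis (omega k * t)"
    by (simp add: cis_mult phase_def algebra_simps)
  moreover have "cis (phase i j ?l * t) * Q k i j t = E k t * (
     (cis (phase i j ?l * t) * (cis (omega i * t) * cis (- (omega (- j) * t)) * cis (omega ?l * t)))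
     * full.term3 (a t) (a t) (a t) k (i, j))"
    by (simp add: Q_def Z_def full.term3_def cis_cnj mult_ac)
  ultimately show ?thesis by simp
qed

abbreviation Yt :: "int \<Rightarrow> real \<Rightarrow> int \<Rightarrow> int \<Rightarrow> real" where
  "Yt k t i j \<equiv> Y3 (ybound (a t)) (a t) i j (k - i - j)"

lemma norm_ybound: "cmod (ybound b i) = bracket i * cmod (b i) + cmod (full.Tri b b b i)"
  unfolding ybound_def by (simp only: norm_of_real) simp

text \<open>Since \<open>k\<close> is the sum of the three frequencies, a factor \<open>k\<close>
  can be charged to one of them, which makes that factor rough. The other summands are those of the
  product rule.\<close>

lemma triple_le_Yt:
  assumes "k \<ge> 0"
  shows "of_int k * (cmod (a t i) * cmod (a t (- j)) * cmod (a t (k - i - j)))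
    + (cmod (a t i) * cmod (a t (- j)) * cmod (full.Tri (a t) (a t) (a t) (k - i - j))
      + cmod (a t i) * cmod (full.Tri (a t) (a t) (a t) (- j)) * cmod (a t (k - i - j))
      + cmod (full.Tri (a t) (a t) (a t) i) * cmod (a t (- j)) * cmod (a t (k - i - j))) \<le> Yt k t i j"
proof -
  let ?l = "k - i - j"
  have "of_int k \<le> bracket i + bracket (- j) + bracket ?l"
    by (simp add: bracket_def)
  then have "of_int k * (cmod (a t i) * cmod (a t (- j)) * cmod (a t ?l))
    \<le> (bracket i + bracket (- j) + bracket ?l) * (cmod (a t i) * cmod (a t (- j)) * cmod (a t ?l))"
    by (intro mult_right_mono) auto
  then show ?thesis unfolding Y3_def norm_ybound by (simp add: algebra_simps)
qed

text \<open>For the boundary values the damping is just bounded by 1, and \<open>1 / k\<close> is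
  gained by charging \<open>k\<close> to one factor. In the derivative, the term from
  \<open>E\<close> has an extra size \<open>k\<close> that is charged in the same way, so it costs
  no more than the product-rule terms; there the exponential is kept for the time integral.\<close>

lemma norm_Q_le:
  assumes "t \<in> {0..t0}" "k \<ge> 1" "2 * R\<^sup>2 \<le> of_int k * m\<^sup>2"
  shows "cmod (Q k i j t) \<le> cmod (symf k (i + j)) * (Yt k t i j / of_int k)"
    and "cmod (Q' k i j t) \<le> cmod (symf k (i + j)) * ((nurate + 1) * exp (- (rate * of_int k * t)) * Yt k t i j)"
proof -
  let ?l = "k - i - j"
  define P where "P = cmod (a t i) * cmod (a t (- j)) * cmod (a t ?l)"
  define D where "D = cmod (a t i) * cmod (a t (- j)) * cmod (full.Tri (a t) (a t) (a t) ?l)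
      + cmod (a t i) * cmod (full.Tri (a t) (a t) (a t) (- j)) * cmod (a t ?l)
      + cmod (full.Tri (a t) (a t) (a t) i) * cmod (a t (- j)) * cmod (a t ?l)"
  have nn: "P \<ge> 0" "D \<ge> 0" by (auto simp: P_def D_def)
  have Y: "of_int k * P + D \<le> Yt k t i j"
    unfolding P_def D_def by (rule triple_le_Yt) (use assms in simp)
  have k: "real_of_int k \<ge> 1" using assms by simp
  have e: "cmod (E k t) \<le> exp (- (rate * of_int k * t))" using assms by (intro norm_E_le) auto
  have "exp (- (rate * of_int k * t)) \<le> 1" using rate_pos k assms(1) by simp
  with e have e1: "cmod (E k t) \<le> 1" by (rule order_trans)
  have "of_int k * P \<le> Yt k t i j" using Y nn by linarith
  then have P: "P \<le> Yt k t i j / of_int k" using k by (simp add: pos_le_divide_eq mult.commute)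
  have "cmod (Q k i j t) = cmod (symf k (i + j)) * (cmod (E k t) * P)"
    by (simp add: Q_def norm_mult norm_Z P_def)
  also have "\<dots> \<le> cmod (symf k (i + j)) * (1 * (Yt k t i j / of_int k))"
    using nn by (intro mult_left_mono mult_mono e1 P) auto
  finally show "cmod (Q k i j t) \<le> cmod (symf k (i + j)) * (Yt k t i j / of_int k)" by simp
  have nr: "nurate \<ge> 0" using Ks_pos by (simp add: nurate_def)
  have "cmod (Q' k i j t) \<le> cmod (E k t) * (cmod (symf k (i + j)) * D)
     + cmod (nu k (a t)) * cmod (E k t) * (cmod (symf k (i + j)) * P)"
  proof -
    let ?A = "Z i t * cnj (Z (- j) t) * W ?l t" and ?B = "Z i t * cnj (W (- j) t) * Z ?l t" and ?C = "W i t * cnj (Z (- j) t) * Z ?l t"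
    have "cmod (?A + (?B + ?C)) \<le> cmod ?A + (cmod ?B + cmod ?C)"
      by (intro order_trans[OF norm_triangle_ineq] add_left_mono norm_triangle_ineq)
    also have "\<dots> = D" by (simp add: norm_mult norm_Z norm_W D_def)
    finally have "cmod (?A + (?B + ?C)) \<le> D" .
    then have "cmod (E k t * (symf k (i + j) * (?A + (?B + ?C)))) \<le> cmod (E k t) * (cmod (symf k (i + j)) * D)"
      unfolding norm_mult by (intro mult_left_mono) auto
    moreover have "cmod ((- nu k (a t) * E k t) * (symf k (i + j) * (Z i t * cnj (Z (- j) t) * Z ?l t)))
      = cmod (nu k (a t)) * cmod (E k t) * (cmod (symf k (i + j)) * P)"
      by (simp add: norm_mult norm_Z P_def)
    moreover have "Q' k i j t = E k t * (symf k (i + j) * (?A + (?B + ?C)))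
      + (- nu k (a t) * E k t) * (symf k (i + j) * (Z i t * cnj (Z (- j) t) * Z ?l t))"
      by (simp add: Q'_def distrib_right)
    ultimately show ?thesis using norm_triangle_ineq[of "E k t * (symf k (i + j) * (?A + (?B + ?C)))"
      "(- nu k (a t) * E k t) * (symf k (i + j) * (Z i t * cnj (Z (- j) t) * Z ?l t))"] by simp
  qed
  also have "\<dots> = cmod (symf k (i + j)) * (cmod (E k t) * (D + cmod (nu k (a t)) * P))"
    by (simp add: algebra_simps)
  also have "\<dots> \<le> cmod (symf k (i + j)) * (exp (- (rate * of_int k * t)) * ((nurate + 1) * Yt k t i j))"
  proof (intro mult_left_mono mult_mono e)
    have "cmod (nu k (a t)) * P \<le> nurate * of_int k * P"
      using assms nn by (intro mult_right_mono cmod_nu_le) auto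
    also have "\<dots> \<le> nurate * Yt k t i j"
      using nr Y nn by (simp add: mult.assoc mult_left_mono)
    finally have "cmod (nu k (a t)) * P \<le> nurate * Yt k t i j" .
    moreover have "0 \<le> real_of_int k * P" using k nn by simp
    ultimately show "D + cmod (nu k (a t)) * P \<le> (nurate + 1) * Yt k t i j"
      using Y by (simp add: distrib_right)
  qed (use nn in auto)
  finally show "cmod (Q' k i j t) \<le> cmod (symf k (i + j)) * ((nurate + 1) * exp (- (rate * of_int k * t)) * Yt k t i j)"
    by (simp add: mult_ac)
qed

end

section \<open>Summing the oscillatory integrals\<close>

lemma integral_exp_decay_le:
  fixes c T :: real
  assumes "c > 0" "T \<ge> 0"
  shows "integral {0..T} (\<lambda>t. exp (- (c * t))) \<le> 1 / c"
proof -
  have "((\<lambda>t. exp (- (c * t))) has_integral (- exp (- (c * T)) / c) - (- exp (- (c * 0)) / c)) {0..T}"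
  proof (rule fundamental_theorem_of_calculus[OF assms(2)])
    show "((\<lambda>t. - exp (- (c * t)) / c) has_vector_derivative exp (- (c * t))) (at t within {0..T})" for t
      unfolding has_real_derivative_iff_has_vector_derivative[symmetric]
      using assms(1) by (auto intro!: derivative_eq_intros)
  qed
  then have "integral {0..T} (\<lambda>t. exp (- (c * t))) = (- exp (- (c * T)) / c) - (- exp (- (c * 0)) / c)"
    by (rule integral_unique)
  also have "\<dots> \<le> 1 / c" using assms(1) by simp
  finally show ?thesis .
qed

lemma ennreal_integral_eq_nn_integral:
  fixes h :: "real \<Rightarrow> real"
  assumes "continuous_on {0..T} h" "\<And>t. t \<in> {0..T} \<Longrightarrow> h t \<ge> 0"
  shows "ennreal (integral {0..T} h) = (\<integral>\<^sup>+t. ennreal (h t) \<partial>lebesgue_on {0..T})"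
proof -
  have int: "integrable (lebesgue_on {0..T}) h" by (intro continuous_imp_integrable_real assms)
  have "(\<integral>\<^sup>+t. ennreal (h t) \<partial>lebesgue_on {0..T}) = ennreal (LINT t|lebesgue_on {0..T}. h t)"
    using assms(2) by (intro nn_integral_eq_integral int AE_I2) (simp add: space_restrict_space)
  also have "(LINT t|lebesgue_on {0..T}. h t) = integral {0..T} h"
    by (intro lebesgue_integral_eq_integral int) auto
  finally show ?thesis by simp
qed

context mode_system
begin

lemma cont_Yt: "continuous_on {0..t0} (\<lambda>t. Yt k t i j)"
  unfolding Y3_def norm_ybound by (intro continuous_intros cont_a cont_Tri)

lemma Yt_nonneg: "Yt k t i j \<ge> 0" by (simp add: Y3_def)

lemma ratio_nonneg: "ratio i j l \<ge> 0" by (simp add: ratio_def)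

definition osc :: "int \<Rightarrow> real \<Rightarrow> int \<times> int \<Rightarrow> complex" where
  "osc k t \<kappa> = E k t * (cis (omega k * t) * nrterm k (a t) \<kappa>)"

lemma cont_osc: "continuous_on {0..t0} (\<lambda>t. osc k t \<kappa>)"
proof (cases \<kappa>)
  case (Pair i j)
  have "continuous_on {0..t0} (\<lambda>t. nrterm k (a t) (i, j))"
    by (cases "nonres k (i, j)")
      (auto simp: nrterm_def full.term3_def intro!: continuous_intros cont_a)
  then show ?thesis unfolding osc_def Pair by (intro continuous_intros cont_E continuous_cis_mult)
qed

text \<open>One integration by parts per interaction turns the symbol into \<open>ratio\<close>. The
  time integral is kept as a nonnegative integral so that the sum over interactions can later be
  drawn inside it.\<close>

lemma cmod_integral_osc_le:
  assumes k: "k \<ge> 1" "2 * R\<^sup>2 \<le> of_int k * m\<^sup>2"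
  shows "ennreal (cmod (integral {0..t0} (\<lambda>t. osc k t (i, j)))) \<le>
    ennreal (1 / of_int k) * ennreal (ratio i j (k - i - j) * Yt k 0 i j)
    + ennreal (1 / of_int k) * ennreal (ratio i j (k - i - j) * Yt k t0 i j)
    + (\<integral>\<^sup>+t. ennreal ((nurate + 1) * exp (- (rate * of_int k * t))) * ennreal (ratio i j (k - i - j) * Yt k t i j) \<partial>lebesgue_on {0..t0})"
proof (cases "nonres k (i, j)")
  case False
  then show ?thesis by (simp add: osc_def nrterm_def)
next
  case True
  let ?l = "k - i - j"
  let ?h = "\<lambda>t. (nurate + 1) * exp (- (rate * of_int k * t)) * (ratio i j ?l * Yt k t i j)"
  have nz: "j + ?l \<noteq> 0" "i + j \<noteq> 0" using True by (auto simp: nonres_def)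
  have ph: "phase i j ?l \<noteq> 0" by (rule phase_nonzero[OF nz])
  have r: "ratio i j ?l = cmod (symf k (i + j)) / \<bar>phase i j ?l\<bar>" using nz by (simp add: ratio_def)
  have nr: "nurate \<ge> 0" using Ks_pos by (simp add: nurate_def)
  have h0: "?h t \<ge> 0" for t using nr Yt_nonneg ratio_nonneg by simp
  have ch: "continuous_on {0..t0} ?h" by (intro continuous_intros cont_Yt)
  have kp: "real_of_int k > 0" using k by simp
  have mm: "ennreal (1 / of_int k * (ratio i j ?l * Yt k t i j)) = ennreal (1 / of_int k) * ennreal (ratio i j ?l * Yt k t i j)" for t
    using kp Yt_nonneg ratio_nonneg by (intro ennreal_mult) auto
  have "(\<lambda>t. osc k t (i, j)) = (\<lambda>t. cis (phase i j ?l * t) * Q k i j t)"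
    using True by (auto simp: osc_def nrterm_def cis_phase_Q)
  then have "cmod (integral {0..t0} (\<lambda>t. osc k t (i, j))) \<le>
     (cmod (Q k i j 0) + cmod (Q k i j t0) + integral {0..t0} (\<lambda>t. cmod (Q' k i j t))) / \<bar>phase i j ?l\<bar>"
    using cmod_osc_integral_le[OF ph _ Q_deriv cont_Q', of k i j] t0 by simp
  also have "\<dots> \<le> (cmod (symf k (i + j)) * (Yt k 0 i j / of_int k) + cmod (symf k (i + j)) * (Yt k t0 i j / of_int k)
     + integral {0..t0} (\<lambda>t. cmod (symf k (i + j)) * ((nurate + 1) * exp (- (rate * of_int k * t)) * Yt k t i j))) / \<bar>phase i j ?l\<bar>"
    using t0 k
    by (intro divide_right_mono add_mono norm_Q_le integral_le integrable_continuous_interval continuous_intros cont_Q' cont_Yt) auto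
  also have "\<dots> = 1 / of_int k * (ratio i j ?l * Yt k 0 i j) + 1 / of_int k * (ratio i j ?l * Yt k t0 i j)
     + 1 / \<bar>phase i j ?l\<bar> * integral {0..t0} (\<lambda>t. cmod (symf k (i + j)) * ((nurate + 1) * exp (- (rate * of_int k * t)) * Yt k t i j))"
    unfolding r by (simp add: add_divide_distrib mult_ac)
  also have "1 / \<bar>phase i j ?l\<bar> * integral {0..t0} (\<lambda>t. cmod (symf k (i + j)) * ((nurate + 1) * exp (- (rate * of_int k * t)) * Yt k t i j))
    = integral {0..t0} (\<lambda>t. 1 / \<bar>phase i j ?l\<bar> * (cmod (symf k (i + j)) * ((nurate + 1) * exp (- (rate * of_int k * t)) * Yt k t i j)))"
    by (rule integral_mult_right[symmetric])
  also have "(\<lambda>t. 1 / \<bar>phase i j ?l\<bar> * (cmod (symf k (i + j)) * ((nurate + 1) * exp (- (rate * of_int k * t)) * Yt k t i j))) = ?h"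
    unfolding r by (simp add: mult_ac)
  finally have "ennreal (cmod (integral {0..t0} (\<lambda>t. osc k t (i, j)))) \<le>
    ennreal (1 / of_int k * (ratio i j ?l * Yt k 0 i j) + 1 / of_int k * (ratio i j ?l * Yt k t0 i j) + integral {0..t0} ?h)"
    by (rule ennreal_leI)
  also have "\<dots> = ennreal (1 / of_int k * (ratio i j ?l * Yt k 0 i j)) + ennreal (1 / of_int k * (ratio i j ?l * Yt k t0 i j)) + ennreal (integral {0..t0} ?h)"
  proof -
    have "0 \<le> 1 / of_int k * (ratio i j ?l * Yt k t i j)" for t
      using kp Yt_nonneg ratio_nonneg by simp
    moreover have "0 \<le> integral {0..t0} ?h"
      using h0 by (intro Henstock_Kurzweil_Integration.integral_nonneg integrable_continuous_interval ch) auto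
    ultimately show ?thesis by (simp only: ennreal_plus add_nonneg_nonneg)
  qed
  also have "ennreal (integral {0..t0} ?h) = (\<integral>\<^sup>+t. ennreal (?h t) \<partial>lebesgue_on {0..t0})"
    by (rule ennreal_integral_eq_nn_integral[OF ch h0])
  also have "\<dots> = (\<integral>\<^sup>+t. ennreal ((nurate + 1) * exp (- (rate * of_int k * t))) * ennreal (ratio i j ?l * Yt k t i j) \<partial>lebesgue_on {0..t0})"
    using nr Yt_nonneg ratio_nonneg by (intro nn_integral_cong ennreal_mult) auto
  finally show ?thesis by (simp only: mm)
qed

text \<open>The 2 counts the boundary terms at 0 and \<open>t0\<close>, and
  \<open>(nurate + 1) / rate\<close> comes from integrating the damping. Each carries
  \<open>1 / k\<close>, and at every fixed time the interactions sum to at most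
  \<open>B\<close>.\<close>

lemma cmod_integral_csum_osc_le:
  assumes k: "k \<ge> 1" "2 * R\<^sup>2 \<le> of_int k * m\<^sup>2" and M: "pair_bounded M k ratio"
    and c: "continuous_on {0..t0} (\<lambda>t. csum (osc k t))"
  defines "B \<equiv> triple_const R M k"
  shows "cmod (integral {0..t0} (\<lambda>t. csum (osc k t))) \<le> B * (2 + (nurate + 1) / rate) / of_int k"
proof -
  have kp: "real_of_int k > 0" using k by simp
  have nr: "nurate \<ge> 0" using Ks_pos by (simp add: nurate_def)
  have B0: "B \<ge> 0" using M R_nonneg full.Ctri_nonneg by (simp add: B_def triple_const_def pair_bounded_def)
  define r where "r t = (\<lambda>(i, j). ennreal (ratio i j (k - i - j) * Yt k t i j))" for t
  have r: "nsum (r t) \<le> ennreal B" if "t \<in> {0..t0}" for t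
    unfolding r_def B_def triple_const_def by (rule nsum_ratio_le[OF M l2_weighted_ybound[OF l2[OF that]] l2[OF that]])
  have b: "nsum (\<lambda>\<kappa>. ennreal (cmod (osc k t \<kappa>))) \<le> ennreal (full.Ctri * R * R * R)" if t: "t \<in> {0..t0}" for t
  proof -
    have "exp (- (rate * of_int k * t)) \<le> 1" using rate_pos kp t by simp
    moreover have "cmod (E k t) \<le> exp (- (rate * of_int k * t))"
      by (rule norm_E_le[OF t _ k(2)]) (use k in simp)
    ultimately have e: "cmod (E k t) \<le> 1" by (rule order_trans[rotated])
    have "cmod (osc k t \<kappa>) \<le> cmod (full.term3 (a t) (a t) (a t) k \<kappa>)" for \<kappa>
      using e by (simp add: osc_def norm_mult nrterm_def mult_left_le_one_le)
    then have "nsum (\<lambda>\<kappa>. ennreal (cmod (osc k t \<kappa>))) \<le> nsum (\<lambda>\<kappa>. ennreal (cmod (full.term3 (a t) (a t) (a t) k \<kappa>)))"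
      by (intro nsum_mono ennreal_leI)
    also have "\<dots> \<le> ennreal (full.Ctri * R * R * R)"
      by (rule full.nsum_cmod_term3_le[OF l2[OF t] l2[OF t] l2[OF t]])
    finally show ?thesis .
  qed
  have meas: "(\<lambda>t. r t \<kappa>) \<in> borel_measurable (lebesgue_on {0..t0})" for \<kappa>
  proof (cases \<kappa>)
    case (Pair i j)
    have "continuous_on {0..t0} (\<lambda>t. ratio i j (k - i - j) * Yt k t i j)"
      by (intro continuous_intros cont_Yt)
    then have "(\<lambda>t. ratio i j (k - i - j) * Yt k t i j) \<in> borel_measurable (lebesgue_on {0..t0})"
      by (intro continuous_imp_measurable_on_sets_lebesgue) auto
    then show ?thesis by (simp add: r_def Pair)
  qed
  let ?e = "\<lambda>t. (nurate + 1) * exp (- (rate * of_int k * t))"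
  have em: "(\<lambda>t. ennreal (?e t)) \<in> borel_measurable (lebesgue_on {0..t0})"
  proof -
    have "?e \<in> borel_measurable (lebesgue_on {0..t0})"
      by (intro continuous_imp_measurable_on_sets_lebesgue continuous_intros) auto
    then show ?thesis by simp
  qed
  \<comment> \<open>Tonelli: the damping does not depend on the interaction, so at each time the sum
    is at most \<open>B\<close>, and only the exponential is left to integrate.\<close>
  have "nsum (\<lambda>\<kappa>. \<integral>\<^sup>+t. ennreal (?e t) * r t \<kappa> \<partial>lebesgue_on {0..t0})
    = (\<integral>\<^sup>+t. nsum (\<lambda>\<kappa>. ennreal (?e t) * r t \<kappa>) \<partial>lebesgue_on {0..t0})"
    by (rule nn_integral_count_space_nn_integral[symmetric]) (auto intro!: borel_measurable_times_ennreal em meas)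
  also have "\<dots> \<le> (\<integral>\<^sup>+t. ennreal (?e t * B) \<partial>lebesgue_on {0..t0})"
  proof (rule nn_integral_mono)
    fix t assume "t \<in> space (lebesgue_on {0..t0})"
    then have t: "t \<in> {0..t0}" by (simp add: space_restrict_space)
    have "nsum (\<lambda>\<kappa>. ennreal (?e t) * r t \<kappa>) = ennreal (?e t) * nsum (r t)" by (rule nsum_cmult)
    also have "\<dots> \<le> ennreal (?e t) * ennreal B" by (intro mult_left_mono r t) auto
    also have "\<dots> = ennreal (?e t * B)" using nr B0 by (intro ennreal_mult[symmetric]) auto
    finally show "nsum (\<lambda>\<kappa>. ennreal (?e t) * r t \<kappa>) \<le> ennreal (?e t * B)" .
  qed
  also have "(\<integral>\<^sup>+t. ennreal (?e t * B) \<partial>lebesgue_on {0..t0}) = ennreal (integral {0..t0} (\<lambda>t. ?e t * B))"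
    using nr B0 by (intro ennreal_integral_eq_nn_integral[symmetric] continuous_intros) auto
  also have "integral {0..t0} (\<lambda>t. ?e t * B) = (nurate + 1) * B * integral {0..t0} (\<lambda>t. exp (- (rate * of_int k * t)))"
  proof -
    have "(\<lambda>t. ?e t * B) = (\<lambda>t. ((nurate + 1) * B) * exp (- (rate * of_int k * t)))" by (simp add: mult_ac)
    then show ?thesis by (simp only: integral_mult_right)
  qed
  also have "ennreal ((nurate + 1) * B * integral {0..t0} (\<lambda>t. exp (- (rate * of_int k * t)))) \<le> ennreal ((nurate + 1) * B * (1 / (rate * of_int k)))"
    using rate_pos kp t0 nr B0 by (intro ennreal_leI mult_left_mono integral_exp_decay_le) auto
  finally have third: "nsum (\<lambda>\<kappa>. \<integral>\<^sup>+t. ennreal (?e t) * r t \<kappa> \<partial>lebesgue_on {0..t0})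
    \<le> ennreal ((nurate + 1) * B * (1 / (rate * of_int k)))" .
  have "ennreal (cmod (integral {0..t0} (\<lambda>t. csum (osc k t)))) \<le> nsum (\<lambda>\<kappa>. ennreal (cmod (integral {0..t0} (\<lambda>t. osc k t \<kappa>))))"
    by (rule cmod_integral_csum_le[OF cont_osc c b])
  also have "\<dots> \<le> nsum (\<lambda>\<kappa>. ennreal (1 / of_int k) * r 0 \<kappa> + ennreal (1 / of_int k) * r t0 \<kappa>
      + (\<integral>\<^sup>+t. ennreal (?e t) * r t \<kappa> \<partial>lebesgue_on {0..t0}))"
  proof (rule nsum_mono)
    fix \<kappa> :: "int \<times> int"
    obtain i j where \<kappa>: "\<kappa> = (i, j)" by (cases \<kappa>)
    show "ennreal (cmod (integral {0..t0} (\<lambda>t. osc k t \<kappa>))) \<le> ennreal (1 / of_int k) * r 0 \<kappa> + ennreal (1 / of_int k) * r t0 \<kappa>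
      + (\<integral>\<^sup>+t. ennreal (?e t) * r t \<kappa> \<partial>lebesgue_on {0..t0})"
      unfolding \<kappa> r_def prod.case by (rule cmod_integral_osc_le[OF k])
  qed
  also have "\<dots> = ennreal (1 / of_int k) * nsum (r 0) + ennreal (1 / of_int k) * nsum (r t0)
      + nsum (\<lambda>\<kappa>. \<integral>\<^sup>+t. ennreal (?e t) * r t \<kappa> \<partial>lebesgue_on {0..t0})"
    by (simp only: nsum_add nsum_cmult)
  also have "\<dots> \<le> ennreal (1 / of_int k) * ennreal B + ennreal (1 / of_int k) * ennreal B + ennreal ((nurate + 1) * B * (1 / (rate * of_int k)))"
    using t0 by (intro add_mono mult_left_mono r third) auto
  also have "\<dots> = ennreal (1 / of_int k * B + 1 / of_int k * B + (nurate + 1) * B * (1 / (rate * of_int k)))"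
  proof -
    have nn: "0 \<le> 1 / real_of_int k" "0 \<le> 1 / real_of_int k * B" "0 \<le> (nurate + 1) * B * (1 / (rate * of_int k))"
      using kp B0 nr rate_pos by auto
    show ?thesis
      unfolding ennreal_mult[OF nn(1) B0, symmetric] using nn by (simp only: ennreal_plus add_nonneg_nonneg)
  qed
  also have "1 / of_int k * B + 1 / of_int k * B + (nurate + 1) * B * (1 / (rate * of_int k)) = B * (2 + (nurate + 1) / rate) / of_int k"
    using rate_pos kp by (simp add: field_simps)
  finally show ?thesis
    using kp B0 nr rate_pos by (subst (asm) ennreal_le_iff) auto
qed

lemma mode_decay:
  assumes k: "k \<ge> 1" "2 * R\<^sup>2 \<le> of_int k * m\<^sup>2" and M: "pair_bounded M k ratio"
  shows "cmod (a 0 k) \<le> exp (- (rate * of_int k * t0)) * R + triple_const R M k * (2 + (nurate + 1) / rate) / of_int k"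
proof -
  have csum: "1 / of_real (2 * pi) * csum (osc k t) = E k t * W k t + - nu k (a t) * E k t * Z k t" if "t \<in> {0..t0}" for t
  proof -
    have "csum (osc k t) = E k t * (cis (omega k * t) * csum (nrterm k (a t)))"
      unfolding osc_def by (simp only: integral_mult_right_zero)
    then have "1 / of_real (2 * pi) * csum (osc k t) = E k t * (cis (omega k * t) * (1 / of_real (2 * pi) * csum (nrterm k (a t))))"
      by simp
    also have "1 / of_real (2 * pi) * csum (nrterm k (a t)) = full.Tri (a t) (a t) (a t) k - nu k (a t) * a t k"
      unfolding resonance_decomposition[OF l2[OF that]] by simp
    finally show ?thesis by (simp add: W_def Z_def algebra_simps)
  qed
  have cEW: "continuous_on {0..t0} (\<lambda>t. E k t * W k t + - nu k (a t) * E k t * Z k t)"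
    by (intro continuous_intros cont_E cont_W cont_Z cont_nu)
  \<comment> \<open>Continuity of the infinite sum does not follow termwise; it comes from the
    identity with finitely many continuous functions.\<close>
  have c: "continuous_on {0..t0} (\<lambda>t. csum (osc k t))"
  proof -
    have "csum (osc k t) = of_real (2 * pi) * (E k t * W k t + - nu k (a t) * E k t * Z k t)" if "t \<in> {0..t0}" for t
      unfolding csum[OF that, symmetric] by simp
    moreover have "continuous_on {0..t0} (\<lambda>t. of_real (2 * pi) * (E k t * W k t + - nu k (a t) * E k t * Z k t))"
      by (intro continuous_intros cEW cont_E cont_W cont_Z cont_nu)
    ultimately show ?thesis by (intro continuous_on_eq[where g="\<lambda>t. csum (osc k t)"]) auto
  qed
  have "((\<lambda>t. E k t * W k t + - nu k (a t) * E k t * Z k t) has_integral E k t0 * Z k t0 - E k 0 * Z k 0) {0..t0}"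
    using t0 by (intro fundamental_theorem_of_calculus has_vector_derivative_mult E_deriv Z_deriv) auto
  then have "integral {0..t0} (\<lambda>t. E k t * W k t + - nu k (a t) * E k t * Z k t) = E k t0 * Z k t0 - a 0 k"
    by (simp add: integral_unique E_def Z_def)
  moreover have "integral {0..t0} (\<lambda>t. 1 / of_real (2 * pi) * csum (osc k t)) = integral {0..t0} (\<lambda>t. E k t * W k t + - nu k (a t) * E k t * Z k t)"
    by (rule Henstock_Kurzweil_Integration.integral_cong) (rule csum)
  ultimately have "a 0 k = E k t0 * Z k t0 - 1 / of_real (2 * pi) * integral {0..t0} (\<lambda>t. csum (osc k t))"
    by (simp only: integral_mult_right) simp
  then have "cmod (a 0 k) \<le> cmod (E k t0 * Z k t0) + cmod (1 / of_real (2 * pi) * integral {0..t0} (\<lambda>t. csum (osc k t)))"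
    by (simp only: norm_triangle_ineq4)
  also have "\<dots> \<le> exp (- (rate * of_int k * t0)) * R + 1 * cmod (integral {0..t0} (\<lambda>t. csum (osc k t)))"
  proof (intro add_mono)
    have "cmod (a t0 k) \<le> R" using t0 s1 by (intro l2_weighted_norm_le[OF l2]) auto
    then show "cmod (E k t0 * Z k t0) \<le> exp (- (rate * of_int k * t0)) * R"
      unfolding norm_mult norm_Z using t0 k(1) by (intro mult_mono norm_E_le k(2)) auto
    show "cmod (1 / of_real (2 * pi) * integral {0..t0} (\<lambda>t. csum (osc k t))) \<le> 1 * cmod (integral {0..t0} (\<lambda>t. csum (osc k t)))"
      unfolding norm_mult using pi_gt3 by (intro mult_right_mono) (auto simp: norm_divide)
  qed
  also have "1 * cmod (integral {0..t0} (\<lambda>t. csum (osc k t))) \<le>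
triple_const R M k * (2 + (nurate + 1) / rate) / of_int k"
    using cmod_integral_csum_osc_le[OF k M c] by simp
  finally show ?thesis by simp
qed

end

section \<open>Uniform smoothing and norm inflation\<close>

lemma tendsto_decay_bound:
  assumes c: "c > 0" and t: "t > 0"
  shows "(\<lambda>n. bracket (real n) powr s * (exp (- (c * real n * t)) * R) + bracket (real n) * (K * real n powr - (1/4) / real n)) \<longlonglongrightarrow> 0"
proof -
  have "(\<lambda>n. (1 + real n) powr s * exp (- (d * real n))) \<longlonglongrightarrow> 0" if "d > 0" for d
    using that by real_asymp
  from this[of "c * t"] have "(\<lambda>n. (1 + real n) powr s * exp (- ((c * t) * real n))) \<longlonglongrightarrow> 0"
    using c t by simp
  then have "(\<lambda>n. (1 + real n) powr s * exp (- ((c * t) * real n)) * R) \<longlonglongrightarrow> 0 * R"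
    by (intro tendsto_mult tendsto_const)
  moreover have "(\<lambda>n. (1 + real n) * (real n powr - (1/4) / real n)) \<longlonglongrightarrow> 0"
    by real_asymp
  then have "(\<lambda>n. K * ((1 + real n) * (real n powr - (1/4) / real n))) \<longlonglongrightarrow> K * 0"
    by (intro tendsto_mult tendsto_const)
  ultimately have "(\<lambda>n. (1 + real n) powr s * exp (- ((c * t) * real n)) * R + K * ((1 + real n) * (real n powr - (1/4) / real n))) \<longlonglongrightarrow> 0 * R + K * 0"
    by (rule tendsto_add)
  then show ?thesis by (simp add: bracket_def mult_ac)
qed

text \<open>The squares are the terms of a convergent series. This disposes of the contribution of
  \<open>ustar 0\<close> to a high mode.\<close>

lemma l2_weighted_tendsto_0:
  assumes "l2_weighted s R a" shows "(\<lambda>n. bracket (real n) powr s * cmod (a (int n))) \<longlonglongrightarrow> 0"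
proof -
  let ?f = "\<lambda>k::int. (bracket k powr s * cmod (a k))\<^sup>2"
  have "nsum (\<lambda>k. ennreal (norm (?f k))) < \<infinity>"
    using assms by (auto simp: l2_weighted_def ennreal_power intro: le_less_trans[OF _ ennreal_less_top])
  then have "Infinite_Set_Sum.abs_summable_on ?f UNIV"
    by (simp add: abs_summable_on_def integrable_iff_bounded)
  then have "Infinite_Set_Sum.abs_summable_on ?f (range int)"
    by (rule abs_summable_on_subset) auto
  then have "Infinite_Set_Sum.abs_summable_on (\<lambda>n. ?f (int n)) UNIV"
    by (subst abs_summable_on_reindex_iff) auto
  then have "summable (\<lambda>n. norm (?f (int n)))"
    by (simp add: abs_summable_on_nat_iff')
  then have "(\<lambda>n. norm (?f (int n))) \<longlonglongrightarrow> 0" by (rule summable_LIMSEQ_zero)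
  then have "(\<lambda>n. sqrt (norm (?f (int n)))) \<longlonglongrightarrow> sqrt 0" by (rule tendsto_real_sqrt)
  then show ?thesis by (simp add: abs_mult)
qed

context raman_nls
begin

lemma continuous_on_nu:
  assumes u: "continuous_in_sobolev s T u"
  shows "continuous_on {0..T} (\<lambda>t. nu k (fourier (u t)))"
proof -
  obtain R where R: "\<And>t. t \<in> {0..T} \<Longrightarrow> l2_weighted s R (fourier (u t))"
    using continuous_in_sobolev_bounded[OF u] by blast
  then show ?thesis unfolding continuous_on_def
    using continuous_in_sobolev_increment[OF u] by (intro ballI tendsto_nu[of "{0..T}" R]) auto
qed

text \<open>The sequence and the threshold precede the solution in the order of quantifiers, and the
  contradiction rests on this uniformity. The exponent \<open>s'\<close> is arbitrary because a
  solution on a closed interval supplies only some exponent above 1/2.\<close>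

lemma uniform_smoothing:
  assumes R: "R \<ge> 0" and m: "m > 0" and \<tau>: "\<tau> > 0"
  shows "\<exists>\<delta>. \<delta> \<longlonglongrightarrow> 0 \<and> (\<exists>N. \<forall>n\<ge>N. \<forall>u s'. continuous_in_sobolev s \<tau> u \<longrightarrow>
     solution_on_halfopen \<alpha>\<^sub>1 \<alpha>\<^sub>2 \<gamma>\<^sub>1 \<gamma>\<^sub>2 \<Gamma> s' \<tau> (u 0) u \<longrightarrow> (\<forall>t\<in>{0..\<tau>}. l2_weighted s R (fourier (u t))) \<longrightarrow>
     m \<le> cmod (fourier (u 0) 0) \<longrightarrow> bracket (real n) powr s * cmod (fourier (u 0) (int n)) \<le> \<delta> n)"
proof -
  obtain C where C: "C \<ge> 0" "\<And>k::int. k \<ge> 1 \<Longrightarrow> pair_bounded (C * of_int k powr - (1/4)) k ratio"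
    using ratio_bounded by blast
  define D where "D = full.Ctri * R * R * R"
  have D: "D \<ge> 0" using full.Ctri_nonneg R by (simp add: D_def)
  \<comment> \<open>\<open>t0\<close> stays strictly below \<open>\<tau>\<close>, where the integral
    equation is available, and is short enough for mode 0 to move by at most \<open>m / 2\<close>.
    Dividing by \<open>D + 1\<close> covers \<open>D = 0\<close>.\<close>
  define t0 where "t0 = min (\<tau> / 2) (m / (2 * (D + 1)))"
  have t0: "t0 > 0" "t0 < \<tau>" "D * t0 \<le> m / 2"
  proof -
    show "t0 > 0" "t0 < \<tau>" using \<tau> m D by (auto simp: t0_def)
    have "t0 \<le> m / (2 * (D + 1))" by (simp add: t0_def)
    then have "(D + 1) * t0 \<le> (D + 1) * (m / (2 * (D + 1)))" using D by (intro mult_left_mono) auto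
    also have "\<dots> = m / 2" using D by (simp add: field_simps)
    finally show "D * t0 \<le> m / 2" using \<open>t0 > 0\<close> by (simp add: distrib_right)
  qed
  define r where "r = \<Gamma> * (m / 2)\<^sup>2 / (4 * pi)"
  have r: "r > 0" using Gamma_pos m by (simp add: r_def)
  define K where "K = 3 * (3 powr s * embed_const * C * (2 * (R + full.Ctri * R * R * R)) * R * R) * (2 + (2 * Ks * R\<^sup>2 + 1) / r)"
  define \<delta> where "\<delta> n = bracket (real n) powr s * (exp (- (r * real n * t0)) * R) + bracket (real n) * (K * real n powr - (1/4) / real n)" for n
  have lim: "\<delta> \<longlonglongrightarrow> 0" unfolding \<delta>_def[abs_def] by (rule tendsto_decay_bound[OF r t0(1)])
  \<comment> \<open>From this index on half of the growth rate absorbs the error \<open>R^2\<close>,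
    mode 0 being at least \<open>m / 2\<close> on \<open>{0..t0}\<close>.\<close>
  obtain N0 :: nat where N0: "real N0 \<ge> 2 * R\<^sup>2 / (m / 2)\<^sup>2" using real_arch_simple by blast
  define N where "N = Suc N0"
  have N: "real N \<ge> 2 * R\<^sup>2 / (m / 2)\<^sup>2" "N \<ge> 1" using N0 by (auto simp: N_def)
  have "bracket (real n) powr s * cmod (fourier (u 0) (int n)) \<le> \<delta> n"
    if n: "n \<ge> N" and u: "continuous_in_sobolev s \<tau> u"
      and sol: "solution_on_halfopen \<alpha>\<^sub>1 \<alpha>\<^sub>2 \<gamma>\<^sub>1 \<gamma>\<^sub>2 \<Gamma> s' \<tau> (u 0) u"
      and l2: "\<forall>t\<in>{0..\<tau>}. l2_weighted s R (fourier (u t))" and low: "m \<le> cmod (fourier (u 0) 0)" for n u s'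
  proof -
    define a where "a t = fourier (u t)" for t
    have sub: "{0..t0} \<subseteq> {0..\<tau>}" using t0 by auto
    have l2': "l2_weighted s R (a t)" if "t \<in> {0..t0}" for t using l2 that sub by (auto simp: a_def)
    interpret mode_system \<alpha>\<^sub>1 \<alpha>\<^sub>2 \<gamma>\<^sub>1 \<gamma>\<^sub>2 \<Gamma> s a R t0 "m / 2"
    proof unfold_locales
      show "t0 > 0" "m / 2 > 0" using t0 m by auto
      show "l2_weighted s R (a t)" if "t \<in> {0..t0}" for t by (rule l2'[OF that])
      show "((\<lambda>t. a t k) has_vector_derivative rhs k (a t)) (at t within {0..t0})" if "t \<in> {0..t0}" for t k
        unfolding a_def by (rule mode_has_derivative[OF u sol t0(2) that])
      show "continuous_on {0..t0} (\<lambda>t. full.Tri (a t) (a t) (a t) k)" for k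
        unfolding a_def by (rule continuous_on_subset[OF continuous_on_full[OF u] sub])
      show "continuous_on {0..t0} (\<lambda>t. nu k (a t))" for k
        unfolding a_def by (rule continuous_on_subset[OF continuous_on_nu[OF u] sub])
      \<comment> \<open>For \<open>k = 0\<close> the dispersive part of \<open>rhs\<close> vanishes,
        so mode 0 moves with speed at most \<open>D\<close>.\<close>
      show "m / 2 \<le> cmod (a t 0)" if t: "t \<in> {0..t0}" for t
      proof (cases "t = 0")
        case True
        then show ?thesis using low m by (simp add: a_def)
      next
        case False
        then have t': "0 < t" "t < \<tau>" using t t0 by auto
        have c: "continuous_on {0..t} (\<lambda>t. rhs 0 (fourier (u t)))"
          unfolding rhs_def using t'
          by (intro continuous_intros continuous_on_subset[OF continuous_on_mode[OF u]] continuous_on_subset[OF continuous_on_full[OF u]]) auto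
        have "norm (integral {0..t} (\<lambda>t. rhs 0 (fourier (u t)))) \<le> D * (t - 0)"
        proof (rule integral_bound[OF _ c])
          fix x assume x: "x \<in> {0..t}"
          then have lx: "l2_weighted s R (fourier (u x))" using l2 t' by auto
          have "bracket (of_int 0) powr (s - 1) * cmod (full.Tri (fourier (u x)) (fourier (u x)) (fourier (u x)) 0) \<le> D"
            unfolding D_def by (rule l2_weighted_pointwise[OF full.l2_weighted_Tri[OF lx lx lx]])
          then show "norm (rhs 0 (fourier (u x))) \<le> D" by (simp add: rhs_def bracket_def)
        qed (use t' in auto)
        also have "D * (t - 0) \<le> D * t0" using t D by (intro mult_left_mono) auto
        also have "\<dots> \<le> m / 2" by (rule t0(3))
        finally have "norm (integral {0..t} (\<lambda>t. rhs 0 (fourier (u t)))) \<le> m / 2" .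
        moreover have "a 0 0 = a t 0 - integral {0..t} (\<lambda>t. rhs 0 (fourier (u t)))"
          using mode_integral_equation[OF u sol t', of 0] by (simp add: a_def)
        then have "cmod (a 0 0) \<le> cmod (a t 0) + norm (integral {0..t} (\<lambda>t. rhs 0 (fourier (u t))))"
          by (simp add: norm_triangle_ineq4)
        ultimately show ?thesis using low by (simp add: a_def)
      qed
    qed
    have rr: "rate = r" by (simp add: rate_def r_def)
    have n1: "real n \<ge> 1" "int n \<ge> 1" using n N(2) by auto
    have "2 * R\<^sup>2 = 2 * R\<^sup>2 / (m / 2)\<^sup>2 * (m / 2)\<^sup>2" using m by simp
    also have "\<dots> \<le> real n * (m / 2)\<^sup>2" using N(1) n by (intro mult_right_mono) auto
    finally have k2: "2 * R\<^sup>2 \<le> of_int (int n) * (m / 2)\<^sup>2" by simp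
    define X where "X = real n powr - (1/4)"
    have "cmod (a 0 (int n)) \<le> exp (- (r * real n * t0)) * R +
      3 * (3 powr s * embed_const * bracket (real n) powr (1 - s) * (C * X) * (2 * (R + full.Ctri * R * R * R)) * R * R)
      * (2 + (2 * Ks * R\<^sup>2 + 1) / r) / real n"
      using mode_decay[OF n1(2) k2 C(2)[OF n1(2)]] by (simp add: rr nurate_def X_def triple_const_def)
    also have "\<dots> = exp (- (r * real n * t0)) * R + bracket (real n) powr (1 - s) * (K * X / real n)"
      by (simp add: K_def mult_ac)
    finally have "bracket (real n) powr s * cmod (a 0 (int n)) \<le>
       bracket (real n) powr s * (exp (- (r * real n * t0)) * R + bracket (real n) powr (1 - s) * (K * X / real n))"
      by (intro mult_left_mono) auto
    also have "\<dots> = bracket (real n) powr s * (exp (- (r * real n * t0)) * R) + (bracket (real n) powr s * bracket (real n) powr (1 - s)) * (K * X / real n)"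
      by (simp add: distrib_left)
    \<comment> \<open>The weight \<open>s\<close> meets the factor \<open>1 - s\<close> from
      \<open>triple_const\<close> and leaves one power of \<open>n\<close>, which the division by
      \<open>n\<close> compensates; only the small-divisor gain \<open>n^(-1/4)\<close>
      survives.\<close>
    also have "bracket (real n) powr s * bracket (real n) powr (1 - s) = bracket (real n)"
      by (simp add: powr_add[symmetric])
    finally show ?thesis by (simp add: \<delta>_def a_def X_def)
  qed
  then show ?thesis using lim by blast
qed

end

section \<open>The analytic perturbation with two modes\<close>

definition trig2 :: "complex \<Rightarrow> complex \<Rightarrow> int \<Rightarrow> real \<Rightarrow> complex" where
  "trig2 c b n x = 1 / complex_of_real (sqrt (2*pi)) * (c * cis (of_int 0 * x) + b * cis (of_int n * x))"

lemma continuous_trig2: "continuous_on UNIV (trig2 c b n)"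
  unfolding trig2_def[abs_def] by (intro continuous_intros continuous_cis_mult)

lemma fourier_trig2: "fourier (trig2 c b n) k = (if k = 0 then c else 0) + (if k = n then b else 0)"
proof -
  have int: "integrable torus (\<lambda>x. cis (- (of_int k * x)) * cis (of_int m * x))" for m
    by (intro torus_integrable_continuous continuous_intros continuous_cis_mult continuous_on_cis)
  define S where "S = complex_of_real (sqrt (2*pi))"
  have S: "S \<noteq> 0" by (simp add: S_def)
  have "(LINT x|torus. cis (- (of_int k * x)) * trig2 c b n x) =
    (LINT x|torus. (1 / S * c) * (cis (- (of_int k * x)) * cis (of_int 0 * x)) + (1 / S * b) * (cis (- (of_int k * x)) * cis (of_int n * x)))"
    by (intro Bochner_Integration.integral_cong refl) (simp only: trig2_def S_def distrib_left mult_ac)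
  also have "\<dots> = (1 / S * c) * (LINT x|torus. cis (- (of_int k * x)) * cis (of_int 0 * x)) + (1 / S * b) * (LINT x|torus. cis (- (of_int k * x)) * cis (of_int n * x))"
    by (subst Bochner_Integration.integral_add) (auto simp only: integral_mult_right_zero intro!: integrable_mult_right int)
  finally have "fourier (trig2 c b n) k = (1 / S * c) * fourier (\<lambda>x. cis (of_int 0 * x)) k + (1 / S * b) * fourier (\<lambda>x. cis (of_int n * x)) k"
    unfolding fourier_altdef S_def[symmetric] by (simp only: distrib_left mult_ac)
  then show ?thesis unfolding fourier_cis S_def[symmetric] using S by simp
qed

lemma periodic_trig2: "periodic (trig2 c b n)"
  by (simp add: periodic_def trig2_def cis_period)

lemma real_analytic_trig2: "real_analytic (trig2 c b n)"
  unfolding real_analytic_def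
\<comment> \<open>The exponential series converges everywhere, so the radius 1 is an arbitrary
  choice.\<close>
proof (intro allI exI[of _ 1] conjI impI)
  fix x0 :: real
  let ?S = "1 / complex_of_real (sqrt (2*pi))"
  let ?z = "\<i> * of_int n :: complex"
  define A where "A j = ?S * (c * (if j = 0 then 1 else 0) + b * cis (of_int n * x0) * (?z ^ j /\<^sub>R fact j))" for j :: nat
  have "(\<lambda>j. A j * of_real (x - x0) ^ j) sums trig2 c b n x" for x
  proof -
    have "(\<lambda>j. (?z * of_real (x - x0)) ^ j /\<^sub>R fact j) sums exp (?z * of_real (x - x0))"
      by (rule exp_converges)
    then have e1: "(\<lambda>j. b * cis (of_int n * x0) * ((?z * of_real (x - x0)) ^ j /\<^sub>R fact j)) sums (b * cis (of_int n * x0) * exp (?z * of_real (x - x0)))"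
      by (rule sums_mult)
    have "(\<lambda>j::nat. if j = 0 then c else 0) sums c" by (rule sums_single)
    from sums_mult[OF sums_add[OF this e1], of ?S] have "(\<lambda>j. ?S * ((if j = 0 then c else 0) + b * cis (of_int n * x0) * ((?z * of_real (x - x0)) ^ j /\<^sub>R fact j)))
      sums (?S * (c + b * cis (of_int n * x0) * exp (?z * of_real (x - x0))))"
      .
    moreover have "cis (of_int n * x0) * exp (?z * of_real (x - x0)) = cis (of_int n * x)"
    proof -
      have "exp (?z * of_real (x - x0)) = cis (of_int n * (x - x0))"
        by (simp add: cis_conv_exp mult_ac)
      then show ?thesis by (simp add: cis_mult algebra_simps)
    qed
    then have "?S * (c + b * cis (of_int n * x0) * exp (?z * of_real (x - x0))) = trig2 c b n x"
      by (simp add: trig2_def mult.assoc)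
    moreover have "A j * of_real (x - x0) ^ j = ?S * ((if j = 0 then c else 0) + b * cis (of_int n * x0) * ((?z * of_real (x - x0)) ^ j /\<^sub>R fact j))" for j
      unfolding A_def power_mult_distrib by (simp add: scaleR_conv_of_real algebra_simps)
    ultimately show ?thesis by simp
  qed
  then show "\<exists>A. \<forall>x. \<bar>x - x0\<bar> < 1 \<longrightarrow> (\<lambda>j. A j * of_real (x - x0) ^ j) sums trig2 c b n x" by blast
qed simp

lemma nsum_single: "nsum (\<lambda>k. if k = n then x else 0) = x"
proof -
  have "nsum (\<lambda>k. if k = n then x else 0) = nsum (\<lambda>k. x * indicator {n} k)"
    by (intro nn_integral_cong) auto
  then show ?thesis by simp
qed

lemma l2_weighted_single:
  fixes n :: int
  shows "l2_weighted s (bracket n powr s * cmod b) (\<lambda>k. if k = n then b else 0)"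
proof -
  have "(\<lambda>k. (ennreal (bracket (of_int k) powr s * cmod (if k = n then b else 0)))\<^sup>2) =
    (\<lambda>k. if k = n then ennreal ((bracket (of_int n) powr s * cmod b)\<^sup>2) else 0)"
    by (auto simp: ennreal_power)
  then show ?thesis unfolding l2_weighted_def by (simp only: nsum_single) simp
qed

text \<open>The eighths leave room for the factor 2 of \<open>l2_weighted_add\<close>, which
  produces the bound \<open>\<epsilon> / 2\<close>.\<close>

lemma sobolev_trig2:
  assumes "\<epsilon> > 0" "cmod c \<le> \<epsilon> / 8" "bracket n powr s * cmod b \<le> \<epsilon> / 8"
  shows "trig2 c b n \<in> sobolev s" "sobolev_norm s (trig2 c b n) \<le> \<epsilon>"
proof -
  have "l2_weighted s (\<epsilon> / 8) (\<lambda>k. if k = 0 then c else 0)"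
    by (rule l2_weighted_mono[OF l2_weighted_single[of s 0 c]]) (use assms in \<open>simp add: bracket_def\<close>)
  moreover have "l2_weighted s (\<epsilon> / 8) (\<lambda>k. if k = n then b else 0)"
    by (rule l2_weighted_mono[OF l2_weighted_single[of s n b] assms(3)])
  ultimately have "l2_weighted s (2 * (\<epsilon> / 8 + \<epsilon> / 8)) (fourier (trig2 c b n))"
    unfolding fourier_trig2[abs_def] by (rule l2_weighted_add)
  then have *: "l2_weighted s \<epsilon> (fourier (trig2 c b n))"
    by (rule l2_weighted_mono) (use assms in simp)
  show "trig2 c b n \<in> sobolev s"
    using l2_weighted_summable(1)[OF *]
    by (simp add: sobolev_def sobolev_seq_def periodic_trig2 torus_integrable_continuous[OF continuous_trig2])
  show "sobolev_norm s (trig2 c b n) \<le> \<epsilon>"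
    unfolding sobolev_norm_def by (rule l2_weighted_summable(3)[OF *])
qed

theorem theorem1p7:
  fixes \<alpha>\<^sub>1 \<alpha>\<^sub>2 \<gamma>\<^sub>1 \<gamma>\<^sub>2 \<Gamma> s T \<epsilon> \<tau> :: real
    and ustar :: "real \<Rightarrow> real \<Rightarrow> complex"
  assumes "\<Gamma> > 0" and "\<alpha>\<^sub>1 \<noteq> 0" and "2 * \<alpha>\<^sub>2 / (3 * \<alpha>\<^sub>1) \<notin> \<int>"
    and "s \<ge> 1" and "T > 0"
    and "continuous_in_sobolev s T ustar"
    and "solution_on_closed \<alpha>\<^sub>1 \<alpha>\<^sub>2 \<gamma>\<^sub>1 \<gamma>\<^sub>2 \<Gamma> T ustar"
    and "\<epsilon> > 0" and "0 < \<tau>" and "\<tau> \<le> T"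
  shows "\<exists>\<phi>. real_analytic \<phi> \<and> \<phi> \<in> sobolev s \<and> sobolev_norm s \<phi> \<le> \<epsilon> \<and>
    (let is_sol = (\<lambda>u. continuous_in_sobolev s \<tau> u \<and>
                       solution_on_closed \<alpha>\<^sub>1 \<alpha>\<^sub>2 \<gamma>\<^sub>1 \<gamma>\<^sub>2 \<Gamma> \<tau> u \<and>
                       (AE x in lebesgue. u 0 x = ustar 0 x + \<phi> x))
     in (\<nexists>u. is_sol u) \<or>
        ((\<exists>u. is_sol u) \<and>
         (\<forall>u. is_sol u \<longrightarrow>
            (SUP t\<in>{0..\<tau>}. sobolev_norm s (\<lambda>x. u t x - ustar t x)) \<ge> 1 / \<epsilon>)))"
proof (rule ccontr)
  assume neg: "\<not> ?thesis"
  interpret raman_nls \<alpha>\<^sub>1 \<alpha>\<^sub>2 \<gamma>\<^sub>1 \<gamma>\<^sub>2 \<Gamma> s by unfold_locales (fact assms)+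
  obtain Rs where Rs: "\<And>t. t \<in> {0..T} \<Longrightarrow> l2_weighted s Rs (fourier (ustar t))"
    using continuous_in_sobolev_bounded[OF assms(6)] by blast
  have sob: "ustar t \<in> sobolev s" if "t \<in> {0..T}" for t
    using assms(6) that by (simp add: continuous_in_sobolev_def)
  have intstar: "integrable torus (ustar t)" if "t \<in> {0..T}" for t
    using sob[OF that] by (simp add: sobolev_def)
  define as where "as = fourier (ustar 0)"
  \<comment> \<open>A shift is made only if mode 0 of \<open>ustar 0\<close> vanishes. In both cases
    the shifted mode 0 is nonzero and the same for all \<open>n >= 1\<close>, so one lower bound
    serves the whole family.\<close>
  define c where "c = (if as 0 = 0 then complex_of_real (\<epsilon> / 8) else 0)"
  have c: "cmod c \<le> \<epsilon> / 8" "as 0 + c \<noteq> 0" using assms(8) by (auto simp: c_def)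
  \<comment> \<open>Normalised so that mode \<open>n\<close> of the perturbation has the same
    weighted size \<open>\<epsilon> / 8\<close> for every \<open>n\<close>: small, yet not tending
    to 0.\<close>
  define b where "b n = complex_of_real (\<epsilon> / 8 * bracket (real n) powr - s)" for n :: nat
  have b: "bracket (real n) powr s * cmod (b n) = \<epsilon> / 8" for n
  proof -
    have "bracket (real n) \<noteq> 0" using bracket_pos[of "real n"] by linarith
    then have "bracket (real n) powr s * bracket (real n) powr - s = 1"
      by (simp add: powr_add[symmetric])
    then show ?thesis using assms(8) by (simp add: b_def norm_mult)
  qed
  define \<phi> where "\<phi> n = trig2 c (b n) (int n)" for n
  have \<phi>: "real_analytic (\<phi> n)" "\<phi> n \<in> sobolev s" "sobolev_norm s (\<phi> n) \<le> \<epsilon>" for n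
    unfolding \<phi>_def using assms(8) c(1) b[of n] by (auto intro!: real_analytic_trig2 sobolev_trig2)
  define is_sol where "is_sol n u \<longleftrightarrow> continuous_in_sobolev s \<tau> u \<and>
     solution_on_closed \<alpha>\<^sub>1 \<alpha>\<^sub>2 \<gamma>\<^sub>1 \<gamma>\<^sub>2 \<Gamma> \<tau> u \<and> (AE x in lebesgue. u 0 x = ustar 0 x + \<phi> n x)" for n u
  \<comment> \<open>If both alternatives fail for \<open>\<phi> n\<close>, a solution exists and at
    least one stays closer to \<open>ustar\<close> than \<open>1 / \<epsilon>\<close>.\<close>
  have "\<exists>u. is_sol n u \<and> (SUP t\<in>{0..\<tau>}. sobolev_norm s (\<lambda>x. u t x - ustar t x)) < 1 / \<epsilon>" for n
  proof (rule ccontr)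
    assume none: "\<not> ?thesis"
    have "let is_sol = is_sol n in (\<nexists>u. is_sol u) \<or>
        ((\<exists>u. is_sol u) \<and>
         (\<forall>u. is_sol u \<longrightarrow>
            (SUP t\<in>{0..\<tau>}. sobolev_norm s (\<lambda>x. u t x - ustar t x)) \<ge> 1 / \<epsilon>))"
      using none unfolding Let_def by (meson not_le)
    with \<phi>[of n] neg show False unfolding is_sol_def[abs_def] by blast
  qed
  then obtain u where u: "\<And>n. is_sol n (u n)"
    and sup: "\<And>n. (SUP t\<in>{0..\<tau>}. sobolev_norm s (\<lambda>x. u n t x - ustar t x)) < 1 / \<epsilon>"
    by metis
  define R where "R = 2 * (1 / \<epsilon> + Rs)"
  have Rs0: "Rs \<ge> 0" using Rs[of 0] assms(5) by (simp add: l2_weighted_def)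
  have R: "R \<ge> 0" using Rs0 assms(8) by (simp add: R_def)
  have bound: "l2_weighted s R (fourier (u n t))" if t: "t \<in> {0..\<tau>}" for n t
  proof -
    have cu: "continuous_in_sobolev s \<tau> (u n)" using u by (simp add: is_sol_def)
    obtain Ru where Ru: "\<And>t. t \<in> {0..\<tau>} \<Longrightarrow> l2_weighted s Ru (fourier (u n t))"
      using continuous_in_sobolev_bounded[OF cu] by blast
    have T: "t \<in> {0..T}" if "t \<in> {0..\<tau>}" for t using that assms(10) by auto
    have d: "fourier (\<lambda>x. u n t x - ustar t x) = (\<lambda>k. fourier (u n t) k - fourier (ustar t) k)" if "t \<in> {0..\<tau>}" for t
      using cu that intstar[OF T[OF that]]
      by (intro ext fourier_diff) (auto simp: continuous_in_sobolev_def sobolev_def)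
    have d2: "l2_weighted s (2 * (Ru + Rs)) (\<lambda>k. fourier (u n t) k - fourier (ustar t) k)" if "t \<in> {0..\<tau>}" for t
      using l2_weighted_add[OF Ru[OF that], of Rs "\<lambda>k. - fourier (ustar t) k"] Rs[OF T[OF that]]
      by (simp add: l2_weighted_uminus)
    \<comment> \<open>A supremum of reals controls the single times only if the family is bounded,
      so boundedness is established before \<open>sup\<close> is used.\<close>
    have "bdd_above ((\<lambda>t. sobolev_norm s (\<lambda>x. u n t x - ustar t x)) ` {0..\<tau>})"
      unfolding sobolev_norm_def using l2_weighted_summable(3)[OF d2] d
      by (intro bdd_aboveI2[of _ _ "2 * (Ru + Rs)"]) auto
    then have "sobolev_norm s (\<lambda>x. u n t x - ustar t x) \<le> (SUP t\<in>{0..\<tau>}. sobolev_norm s (\<lambda>x. u n t x - ustar t x))"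
      by (rule cSUP_upper[OF t])
    then have "sobolev_seq_norm s (\<lambda>k. fourier (u n t) k - fourier (ustar t) k) \<le> 1 / \<epsilon>"
      using sup[of n] by (simp add: sobolev_norm_def d[OF t])
    then have "l2_weighted s (1 / \<epsilon>) (\<lambda>k. fourier (u n t) k - fourier (ustar t) k)"
      by (rule l2_weighted_mono[OF l2_weighted_summable(2)[OF d2[OF t]]])
    from l2_weighted_add[OF this Rs[OF T[OF t]]] show ?thesis by (simp add: R_def)
  qed
  have init: "fourier (u n 0) k = as k + ((if k = 0 then c else 0) + (if k = int n then b n else 0))" for n k
  proof -
    have i: "integrable torus (u n 0)" "integrable torus (ustar 0)" "integrable torus (\<phi> n)"
      using u[of n] assms(9) intstar[of 0] assms(5) \<phi>(2)[of n] by (auto simp: is_sol_def continuous_in_sobolev_def sobolev_def)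
    have "fourier (u n 0) k = fourier (\<lambda>x. ustar 0 x + \<phi> n x) k"
      using u[of n] i by (intro fourier_cong_AE AE_torus) (auto simp: is_sol_def)
    also have "\<dots> = as k + fourier (\<phi> n) k" unfolding as_def by (rule fourier_add[OF i(2,3)])
    finally show ?thesis by (simp add: \<phi>_def fourier_trig2)
  qed
  have "cmod (as 0 + c) > 0" using c(2) by simp
  from uniform_smoothing[OF R this assms(9)] obtain \<delta> N where \<delta>: "\<delta> \<longlonglongrightarrow> 0"
    and N: "\<And>n u s'. n \<ge> N \<Longrightarrow> continuous_in_sobolev s \<tau> u \<Longrightarrow>
     solution_on_halfopen \<alpha>\<^sub>1 \<alpha>\<^sub>2 \<gamma>\<^sub>1 \<gamma>\<^sub>2 \<Gamma> s' \<tau> (u 0) u \<Longrightarrow> \<forall>t\<in>{0..\<tau>}. l2_weighted s R (fourier (u t)) \<Longrightarrow>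
     cmod (as 0 + c) \<le> cmod (fourier (u 0) 0) \<Longrightarrow> bracket (real n) powr s * cmod (fourier (u 0) (int n)) \<le> \<delta> n"
    by blast
  \<comment> \<open>\<open>n >= 1\<close> separates mode \<open>n\<close> from mode 0, so that mode
    0 of the data is exactly \<open>as 0 + c\<close> and mode \<open>n\<close> exactly
    \<open>as n + b n\<close>.\<close>
  have low: "\<epsilon> / 8 \<le> \<delta> n + bracket (real n) powr s * cmod (as (int n))" if n: "n \<ge> max N 1" for n
  proof -
    obtain s' where "solution_on_halfopen \<alpha>\<^sub>1 \<alpha>\<^sub>2 \<gamma>\<^sub>1 \<gamma>\<^sub>2 \<Gamma> s' \<tau> (u n 0) (u n)"
      using u[of n] by (auto simp: is_sol_def solution_on_closed_def)
    moreover have "continuous_in_sobolev s \<tau> (u n)" using u by (simp add: is_sol_def)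
    moreover have "cmod (as 0 + c) \<le> cmod (fourier (u n 0) 0)" using n by (simp add: init)
    ultimately have "bracket (real n) powr s * cmod (fourier (u n 0) (int n)) \<le> \<delta> n"
      using n bound by (intro N) auto
    moreover have "fourier (u n 0) (int n) = as (int n) + b n" using n by (simp add: init)
    ultimately have 1: "bracket (real n) powr s * cmod (as (int n) + b n) \<le> \<delta> n" by simp
    have "cmod (b n) \<le> cmod (as (int n) + b n) + cmod (as (int n))"
      using norm_triangle_ineq4[of "as (int n) + b n" "as (int n)"] by simp
    then have "bracket (real n) powr s * cmod (b n) \<le> bracket (real n) powr s * (cmod (as (int n) + b n) + cmod (as (int n)))"
      by (intro mult_left_mono) auto
    with 1 show ?thesis by (simp add: b distrib_left)
  qed
  \<comment> \<open>Both summands tend to 0, one by the uniform smoothing and the other because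
    \<open>ustar 0\<close> is a fixed element of \<open>H^s\<close>, although their sum is at least
    \<open>\<epsilon> / 8\<close>.\<close>
  have "(\<lambda>n. \<delta> n + bracket (real n) powr s * cmod (as (int n))) \<longlonglongrightarrow> 0 + 0"
    unfolding as_def using assms(5) by (intro tendsto_add \<delta> l2_weighted_tendsto_0[OF Rs]) auto
  then have "\<epsilon> / 8 \<le> 0 + 0"
    by (rule LIMSEQ_le_const) (use low in blast)
  with assms(8) show False by simp
qed

end
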